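(* Let $P\in\mathcal X$ with $(\mathcal D,P)$-orders $j_0<\cdots<j_n$, and let $(\kappa_0,\ldots,\kappa_{n-2})$ be the $(q^u,q^m)$-Frobenius order-sequence of $\mathcal X$ with respect to $\mathcal D$, with $\kappa_0=0$. Then: (1) if $P\in\mathcal X(\mathbb F_q)$, then $v_P(T_{u,m})\ge j_1q^u+\sum_{i=0}^{n-2}(j_{i+2}-\kappa_i)$; (2) if $P\in\mathcal X(\mathbb F_{q^{m-u}})$, then $v_P(T_{u,m})\ge j_1q^u+\sum_{i=0}^{n-2}(j_i-\kappa_i)$; (3) if $P\in\mathcal X(\mathbb F_{q^r})$ for $r\in\{u,m\}$, then $v_P(T_{u,m})\ge\sum_{i=1}^{n-1}(j_i-\kappa_{i-1})$; (4) for arbitrary $P\in\mathcal X$, $v_P(T_{u,m})\ge\sum_{i=0}^{n-2}(j_i-\kappa_i)$. In addition: (i) equality holds in (1) if and only if $p\nmid\det\left(\binom{j_i}{\kappa_s}\right)_{2\le i\le n,\ 0\le s\le n-2}$; (ii) if $p\mid\det\left(\binom{j_i}{\kappa_s}\right)_{1\le i\le n-1,\ 0\le s\le n-2}$, then the strict inequality holds in both cases ($r=u$ and $r=m$) of (3); (iii) if $p\mid\det\left(\binom{j_i}{\kappa_s}\right)_{0\le i,s\le n-2}$, then the strict inequality holds in (2) and (4).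
   Context: Setting. $\mathbb F_q$ is a finite field of characteristic $p$, $\overline{\mathbb F}_q$ its algebraic closure. $\mathcal X$ is a projective, geometrically irreducible, nonsingular algebraic curve defined over $\mathbb F_q$. $n\ge 2$, and $\phi=(f_0:\cdots:f_n):\mathcal X\to\mathbb P^n(\overline{\mathbb F}_q)$ is a nondegenerate morphism (image not contained in a hyperplane) defined over $\mathbb F_q$, with $f_i\in\mathbb F_q(\mathcal X)$. $u,m$ are coprime integers with $m>u\ge1$. $v_P$ is the valuation at $P$ (for a divisor, its coefficient at $P$), and $D_t^{(r)}$ is the $r$-th Hasse derivative with respect to a separating variable $t$. Linear series. Put $e_P=-\min\{v_P(f_0),\ldots,v_P(f_n)\}$, $E=\sum_P e_PP$, $\mathcal D=\{\operatorname{div}(\sum_i a_if_i)+E : (a_0:\cdots:a_n)\in\mathbb P^n(\overline{\mathbb F}_q)\}$. The $(\mathcal D,P)$-orders $0=j_0(P)<\cdots<j_n(P)$ are the integers $j\geq 0$ with $v_P(D)=j$ for some $D\in\mathcal D$; write $j_i=j_i(P)$. $(q^u,q^m)$-Frobenius order-sequence. For a separating variable $t\in\mathbb F_q(\mathcal X)$ and non-negative integers $\rho_0,\ldots,\rho_{n-2}$, let $\mathcal A_t^{\rho_0,\ldots,\rho_{n-2}}(f_0,\ldots,f_n)$ be the determinant of the $(n+1)\times(n+1)$ matrix whose rows are $(f_0^{q^m},\ldots,f_n^{q^m})$, $(f_0^{q^u},\ldots,f_n^{q^u})$, and $(D_t^{(\rho_i)}f_0,\ldots,D_t^{(\rho_i)}f_n)$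 for $i=0,\ldots,n-2$. The sequence $(\kappa_0,\ldots,\kappa_{n-2})$ is the lexicographically minimal sequence $0\le\kappa_0<\cdots<\kappa_{n-2}$ with $\mathcal A_t^{\kappa_0,\ldots,\kappa_{n-2}}(f_0,\ldots,f_n)\neq0$. Standing assumption: $\kappa_0=0$. $(q^u,q^m)$-Frobenius divisor. $T_{u,m}=\operatorname{div}(\mathcal A_t^{\kappa_0,\ldots,\kappa_{n-2}}(f_0,\ldots,f_n))+(\kappa_0+\cdots+\kappa_{n-2})\operatorname{div}(dt)+(q^m+q^u+n-1)E$. The sequence $(\kappa_i)$ and the divisor $T_{u,m}$ depend only on $\mathcal D$ (given $q,u,m$). *)

theory Defs
  imports
    "HOL-Library.Cardinality"
    "HOL-Library.Poly_Mapping"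
    "HOL-Computational_Algebra.Polynomial"
    "HOL-Algebra.Algebraic_Closure_Type"
    "Jordan_Normal_Form.Determinant"
begin

text \<open>
  Throughout, the finite field is a type \<open>'a :: {field, finite}\<close>, so that \<open>q = CARD('a)\<close>, and the
  field of constants is its algebraic closure \<open>'a alg_closure\<close>, into which \<open>'a\<close> is embedded by
  \<^const>\<open>to_ac\<close>. The homogeneous coordinates of the ambient projective space are indexed by a
  finite type \<open>'v\<close>.
\<close>

section \<open>Projective algebraic sets\<close>

type_synonym ('v, 'b) mpoly = "('v \<Rightarrow>\<^sub>0 nat) \<Rightarrow>\<^sub>0 'b"

text \<open>\<open>mpoly_eval \<phi> x G\<close> is the value at \<open>x\<close> of the polynomial whose coefficients are the
  images under \<open>\<phi>\<close> of those of \<open>G\<close>.\<close>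

definition mpoly_eval ::
  "('b::zero \<Rightarrow> 'c::comm_semiring_1) \<Rightarrow> ('v::finite \<Rightarrow> 'c) \<Rightarrow> ('v, 'b) mpoly \<Rightarrow> 'c" where
  "mpoly_eval \<phi> x G =
     (\<Sum>m\<in>Poly_Mapping.keys G. \<phi> (Poly_Mapping.lookup G m) * (\<Prod>i\<in>UNIV. x i ^ Poly_Mapping.lookup m i))"

definition homogeneous :: "nat \<Rightarrow> ('v::finite, 'b::zero) mpoly \<Rightarrow> bool" where
  "homogeneous d G \<longleftrightarrow> (\<forall>m\<in>Poly_Mapping.keys G. (\<Sum>i\<in>UNIV. Poly_Mapping.lookup m i) = d)"

text \<open>A point of projective space is the set of all its homogeneous coordinate vectors.\<close>

type_synonym ('v, 'k) point = "('v \<Rightarrow> 'k) set"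

definition proj_space :: "('v, 'k::field) point set" where
  "proj_space = {P. \<exists>a. a \<noteq> (\<lambda>_. 0) \<and> P = {(\<lambda>i. c * a i) |c. c \<noteq> 0}}"

definition vanishes_at ::
  "('b::zero \<Rightarrow> 'k::field) \<Rightarrow> ('v::finite, 'b) mpoly \<Rightarrow> ('v, 'k) point \<Rightarrow> bool" where
  "vanishes_at \<phi> G P \<longleftrightarrow> (\<forall>a\<in>P. mpoly_eval \<phi> a G = 0)"

text \<open>Zero loci of sets of homogeneous polynomials with coefficients in the image of \<open>\<phi>\<close>. With
  \<open>\<phi> = id\<close> these are the Zariski closed sets, with \<open>\<phi> = to_ac\<close> those defined over the finite
  field (a perfect field).\<close>

definition proj_closed :: "('b::zero \<Rightarrow> 'k::field) \<Rightarrow> ('v::finite, 'k) point set \<Rightarrow> bool" where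
  "proj_closed \<phi> Z \<longleftrightarrow> (\<exists>S :: ('v, 'b) mpoly set. (\<forall>G\<in>S. \<exists>d. homogeneous d G) \<and>
      Z = {P \<in> proj_space. \<forall>G\<in>S. vanishes_at \<phi> G P})"

definition proj_irreducible :: "('v::finite, 'k::field) point set \<Rightarrow> bool" where
  "proj_irreducible C \<longleftrightarrow> C \<noteq> {} \<and>
     (\<forall>Z1 Z2. proj_closed (id :: 'k \<Rightarrow> 'k) Z1 \<longrightarrow> proj_closed (id :: 'k \<Rightarrow> 'k) Z2 \<longrightarrow>
        C \<subseteq> Z1 \<union> Z2 \<longrightarrow> C \<subseteq> Z1 \<or> C \<subseteq> Z2)"

text \<open>The points having a homogeneous coordinate vector with entries in the subfield of \<open>Q\<close>
  elements, for \<open>Q\<close> a power of \<open>q\<close>.\<close>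

definition rational_points :: "('v, 'k::field) point set \<Rightarrow> nat \<Rightarrow> ('v, 'k) point set" where
  "rational_points C Q = {P \<in> C. \<exists>a\<in>P. \<forall>i. a i ^ Q = a i}"


section \<open>Function field, local rings and valuations\<close>

text \<open>\<open>homog_quotients \<phi> \<xi>\<close> are the quotients of forms of equal degree, with coefficients in the
  image of \<open>\<phi>\<close>, at the coordinate vector \<open>\<xi>\<close>.\<close>

definition homog_quotients :: "('b::zero \<Rightarrow> 'f::field) \<Rightarrow> ('v::finite \<Rightarrow> 'f) \<Rightarrow> 'f set" where
  "homog_quotients \<phi> \<xi> = {mpoly_eval \<phi> \<xi> G / mpoly_eval \<phi> \<xi> H |d G H.
     homogeneous d G \<and> homogeneous d H \<and> mpoly_eval \<phi> \<xi> H \<noteq> 0}"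

text \<open>The function field of a projective variety \<open>C\<close> over the field \<open>'k\<close> consists of the quotients
  \<open>G/H\<close> of forms of equal degree, \<open>H\<close> not vanishing identically on \<open>C\<close>, two of them being
  identified if \<open>G H' - G' H\<close> vanishes on \<open>C\<close>. The following says that the field \<open>'f\<close>, with the
  constants embedded by \<open>\<iota>\<close>, is this field. Here \<open>\<xi>\<close> is a coordinate vector of the generic point
  of \<open>C\<close>: the function \<open>G/H\<close> is \<open>mpoly_eval \<iota> \<xi> G / mpoly_eval \<iota> \<xi> H\<close>. The pair of \<open>'f\<close> and \<open>\<xi>\<close> is
  determined by \<open>C\<close> up to isomorphism and scaling of \<open>\<xi>\<close>.\<close>

definition function_field ::
  "('v::finite, 'k::field) point set \<Rightarrow> ('k \<Rightarrow> 'f::field) \<Rightarrow> ('v \<Rightarrow> 'f) \<Rightarrow> bool" where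
  "function_field C \<iota> \<xi> \<longleftrightarrow> field_hom \<iota> \<and>
     (\<forall>d G. homogeneous d G \<longrightarrow> (mpoly_eval \<iota> \<xi> G = 0 \<longleftrightarrow> (\<forall>P\<in>C. vanishes_at id G P))) \<and>
     homog_quotients \<iota> \<xi> = UNIV"

text \<open>The functions defined over the finite field, as a subset of \<open>'f\<close>.\<close>

definition base_functions ::
  "('a::field alg_closure \<Rightarrow> 'f::field) \<Rightarrow> ('v::finite \<Rightarrow> 'f) \<Rightarrow> 'f set" where
  "base_functions \<iota> \<xi> = homog_quotients (\<iota> \<circ> to_ac) \<xi>"

text \<open>\<open>takes_value \<iota> \<xi> P g c\<close>: the function \<open>g\<close> is regular at the point \<open>P\<close> of \<open>C\<close>, with value \<open>c\<close>.\<close>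

definition takes_value ::
  "('k::field \<Rightarrow> 'f::field) \<Rightarrow> ('v::finite \<Rightarrow> 'f) \<Rightarrow> ('v, 'k) point \<Rightarrow> 'f \<Rightarrow> 'k \<Rightarrow> bool" where
  "takes_value \<iota> \<xi> P g c \<longleftrightarrow> (\<exists>d G H. \<exists>a\<in>P. homogeneous d G \<and> homogeneous d H \<and>
     mpoly_eval id a H \<noteq> 0 \<and>
     g = mpoly_eval \<iota> \<xi> G / mpoly_eval \<iota> \<xi> H \<and> c = mpoly_eval id a G / mpoly_eval id a H)"

definition local_ring ::
  "('k::field \<Rightarrow> 'f::field) \<Rightarrow> ('v::finite \<Rightarrow> 'f) \<Rightarrow> ('v, 'k) point \<Rightarrow> 'f set" where
  "local_ring \<iota> \<xi> P = {g. \<exists>c. takes_value \<iota> \<xi> P g c}"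

definition max_ideal ::
  "('k::field \<Rightarrow> 'f::field) \<Rightarrow> ('v::finite \<Rightarrow> 'f) \<Rightarrow> ('v, 'k) point \<Rightarrow> 'f set" where
  "max_ideal \<iota> \<xi> P = {g. takes_value \<iota> \<xi> P g 0}"

definition local_parameter ::
  "('k::field \<Rightarrow> 'f::field) \<Rightarrow> ('v::finite \<Rightarrow> 'f) \<Rightarrow> ('v, 'k) point \<Rightarrow> 'f \<Rightarrow> bool" where
  "local_parameter \<iota> \<xi> P \<pi> \<longleftrightarrow> max_ideal \<iota> \<xi> P = {\<pi> * g |g. g \<in> local_ring \<iota> \<xi> P}"

text \<open>The value \<open>val \<iota> \<xi> P 0\<close> (mathematically \<open>\<infinity>\<close>) is unspecified.\<close>

definition val ::
  "('k::field \<Rightarrow> 'f::field) \<Rightarrow> ('v::finite \<Rightarrow> 'f) \<Rightarrow> ('v, 'k) point \<Rightarrow> 'f \<Rightarrow> int" where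
  "val \<iota> \<xi> P g = (THE k. \<exists>\<pi> w. local_parameter \<iota> \<xi> P \<pi> \<and>
     w \<in> local_ring \<iota> \<xi> P - max_ideal \<iota> \<xi> P \<and> g = w * \<pi> powi k)"


section \<open>Curves\<close>

definition transcendental_over :: "('b::zero \<Rightarrow> 'f::field) \<Rightarrow> 'f \<Rightarrow> bool" where
  "transcendental_over \<phi> t \<longleftrightarrow> (\<forall>p. poly (map_poly \<phi> p) t = 0 \<longrightarrow> p = 0)"

text \<open>The subfield generated by \<open>t\<close> over the field embedded by \<open>\<phi>\<close>.\<close>

definition simple_ext :: "('b::zero \<Rightarrow> 'f::field) \<Rightarrow> 'f \<Rightarrow> 'f set" where
  "simple_ext \<phi> t = {poly (map_poly \<phi> a) t / poly (map_poly \<phi> b) t |a b.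
     poly (map_poly \<phi> b) t \<noteq> 0}"

definition algebraic_over :: "'f::field set \<Rightarrow> 'f \<Rightarrow> bool" where
  "algebraic_over L g \<longleftrightarrow> (\<exists>B. set (coeffs B) \<subseteq> L \<and> B \<noteq> 0 \<and> poly B g = 0)"

definition separable_over :: "'f::field set \<Rightarrow> 'f \<Rightarrow> bool" where
  "separable_over L g \<longleftrightarrow> (\<exists>B. set (coeffs B) \<subseteq> L \<and> coprime B (pderiv B) \<and> poly B g = 0)"

definition tr_deg_one :: "('k::zero \<Rightarrow> 'f::field) \<Rightarrow> bool" where
  "tr_deg_one \<iota> \<longleftrightarrow> (\<exists>t. transcendental_over \<iota> t \<and> (\<forall>g. algebraic_over (simple_ext \<iota> t) g))"

text \<open>A projective, geometrically irreducible, nonsingular curve defined over \<open>'a\<close>, together with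
  its function field over \<open>'a alg_closure\<close>. Its dimension is the transcendence degree of
  the function field. Since the local rings have dimension one, they are regular iff their maximal
  ideals are principal.\<close>

definition nonsingular_projective_curve ::
  "('v::finite, 'a::{field,finite} alg_closure) point set \<Rightarrow>
   ('a alg_closure \<Rightarrow> 'f::field) \<Rightarrow> ('v \<Rightarrow> 'f) \<Rightarrow> bool" where
  "nonsingular_projective_curve C \<iota> \<xi> \<longleftrightarrow>
     proj_closed (to_ac :: 'a \<Rightarrow> 'a alg_closure) C \<and> proj_irreducible C \<and>
     function_field C \<iota> \<xi> \<and> tr_deg_one \<iota> \<and>
     (\<forall>P\<in>C. \<exists>\<pi>. local_parameter \<iota> \<xi> P \<pi>)"

text \<open>\<open>t\<close> is a separating variable of the function field over the finite field; that the latter is a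
  finite extension of \<open>simple_ext (\<iota> \<circ> to_ac) t\<close> is automatic, as it is finitely generated.\<close>

definition separating_variable ::
  "('a::field alg_closure \<Rightarrow> 'f::field) \<Rightarrow> ('v::finite \<Rightarrow> 'f) \<Rightarrow> 'f \<Rightarrow> bool" where
  "separating_variable \<iota> \<xi> t \<longleftrightarrow> t \<in> base_functions \<iota> \<xi> \<and> transcendental_over (\<iota> \<circ> to_ac) t \<and>
     (\<forall>g\<in>base_functions \<iota> \<xi>. separable_over (simple_ext (\<iota> \<circ> to_ac) t) g)"

text \<open>The Hasse derivatives with respect to \<open>t\<close>: the unique system of constant-linear maps on the
  function field satisfying the product rule and the formula on powers of \<open>t\<close>
  (if the function field is separable over the subfield generated by \<open>t\<close> over the constants).\<close>

definition hasse_derivatives ::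
  "('k::field \<Rightarrow> 'f::field) \<Rightarrow> 'f \<Rightarrow> (nat \<Rightarrow> 'f \<Rightarrow> 'f) \<Rightarrow> bool" where
  "hasse_derivatives \<iota> t D \<longleftrightarrow>
     D 0 = id \<and>
     (\<forall>r g h. D r (g + h) = D r g + D r h) \<and>
     (\<forall>r c g. D r (\<iota> c * g) = \<iota> c * D r g) \<and>
     (\<forall>r g h. D r (g * h) = (\<Sum>s\<le>r. D s g * D (r - s) h)) \<and>
     (\<forall>r s. D r (t ^ s) = of_nat (s choose r) * t ^ (s - r))"

definition hasse :: "('k::field \<Rightarrow> 'f::field) \<Rightarrow> 'f \<Rightarrow> nat \<Rightarrow> 'f \<Rightarrow> 'f" where
  "hasse \<iota> t = (THE D. hasse_derivatives \<iota> t D)"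


section \<open>Divisors and linear series\<close>

text \<open>A divisor is given by its coefficients, of which only those at the points of \<open>C\<close> matter.\<close>

type_synonym ('v, 'k) divisor = "('v, 'k) point \<Rightarrow> int"

definition div_fun ::
  "('k::field \<Rightarrow> 'f::field) \<Rightarrow> ('v::finite \<Rightarrow> 'f) \<Rightarrow> 'f \<Rightarrow> ('v, 'k) divisor" where
  "div_fun \<iota> \<xi> g = (\<lambda>P. val \<iota> \<xi> P g)"

text \<open>The divisor of the differential \<open>dt\<close>: at \<open>P\<close> one has \<open>dt = (dt/d\<pi>) d\<pi>\<close> for a local parameter
  \<open>\<pi>\<close>, and \<open>dt/d\<pi>\<close> is the first Hasse derivative of \<open>t\<close> with respect to \<open>\<pi>\<close>.\<close>

definition div_diff ::
  "('k::field \<Rightarrow> 'f::field) \<Rightarrow> ('v::finite \<Rightarrow> 'f) \<Rightarrow> 'f \<Rightarrow> ('v, 'k) divisor" where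
  "div_diff \<iota> \<xi> t = (\<lambda>P. val \<iota> \<xi> P (hasse \<iota> (SOME \<pi>. local_parameter \<iota> \<xi> P \<pi>) 1 t))"

text \<open>The morphism \<open>(f 0 : \<dots> : f n)\<close> sends \<open>P\<close> to the point with coordinates \<open>(h f 0)(P), \<dots>,
  (h f n)(P)\<close>, where the scaling factor \<open>h\<close> is such that these are defined and not all \<open>0\<close>.\<close>

definition image_coords ::
  "('k::field \<Rightarrow> 'f::field) \<Rightarrow> ('v::finite \<Rightarrow> 'f) \<Rightarrow> nat \<Rightarrow> (nat \<Rightarrow> 'f) \<Rightarrow> ('v, 'k) point \<Rightarrow> (nat \<Rightarrow> 'k) set" where
  "image_coords \<iota> \<xi> n f P =
     {b. (\<exists>i\<le>n. b i \<noteq> 0) \<and> (\<exists>h. \<forall>i\<le>n. takes_value \<iota> \<xi> P (h * f i) (b i))}"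

definition nondegenerate ::
  "('v::finite, 'k::field) point set \<Rightarrow> ('k \<Rightarrow> 'f::field) \<Rightarrow> ('v \<Rightarrow> 'f) \<Rightarrow> nat \<Rightarrow> (nat \<Rightarrow> 'f) \<Rightarrow> bool" where
  "nondegenerate C \<iota> \<xi> n f \<longleftrightarrow> (\<forall>a. (\<exists>i\<le>n. a i \<noteq> 0) \<longrightarrow>
     (\<exists>P\<in>C. \<exists>b\<in>image_coords \<iota> \<xi> n f P. (\<Sum>i\<le>n. a i * b i) \<noteq> 0))"

definition E_div ::
  "('k::field \<Rightarrow> 'f::field) \<Rightarrow> ('v::finite \<Rightarrow> 'f) \<Rightarrow> nat \<Rightarrow> (nat \<Rightarrow> 'f) \<Rightarrow> ('v, 'k) divisor" where
  "E_div \<iota> \<xi> n f = (\<lambda>P. - Min ((\<lambda>i. val \<iota> \<xi> P (f i)) ` {..n}))"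

definition linear_series ::
  "('k::field \<Rightarrow> 'f::field) \<Rightarrow> ('v::finite \<Rightarrow> 'f) \<Rightarrow> nat \<Rightarrow> (nat \<Rightarrow> 'f) \<Rightarrow> ('v, 'k) divisor set" where
  "linear_series \<iota> \<xi> n f =
     {(\<lambda>P. div_fun \<iota> \<xi> (\<Sum>i\<le>n. \<iota> (a i) * f i) P + E_div \<iota> \<xi> n f P) |a. \<exists>i\<le>n. a i \<noteq> 0}"

definition order_set :: "('v, 'k) divisor set \<Rightarrow> ('v, 'k) point \<Rightarrow> nat set" where
  "order_set \<D> P = {j. \<exists>D\<in>\<D>. D P = int j}"

text \<open>The increasing list of the orders, so that \<open>orders \<D> P ! i\<close> is \<open>j\<^sub>i(P)\<close>.\<close>

definition orders :: "('v, 'k) divisor set \<Rightarrow> ('v, 'k) point \<Rightarrow> nat list" where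
  "orders \<D> P = sorted_list_of_set (order_set \<D> P)"


section \<open>Frobenius orders and the Frobenius divisor\<close>

definition frob_det ::
  "('a::{field,finite} alg_closure \<Rightarrow> 'f::field) \<Rightarrow> 'f \<Rightarrow> nat \<Rightarrow> nat \<Rightarrow> nat \<Rightarrow> (nat \<Rightarrow> 'f) \<Rightarrow> nat list \<Rightarrow> 'f" where
  "frob_det \<iota> t u m n f \<rho> = det (mat (n + 1) (n + 1) (\<lambda>(r, c).
     if r = 0 then f c ^ (CARD('a) ^ m)
     else if r = 1 then f c ^ (CARD('a) ^ u)
     else hasse \<iota> t (\<rho> ! (r - 2)) (f c)))"

definition frob_order_sequence ::
  "('a::{field,finite} alg_closure \<Rightarrow> 'f::field) \<Rightarrow> 'f \<Rightarrow> nat \<Rightarrow> nat \<Rightarrow> nat \<Rightarrow> (nat \<Rightarrow> 'f) \<Rightarrow> nat list \<Rightarrow> bool" where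
  "frob_order_sequence \<iota> t u m n f \<kappa> \<longleftrightarrow>
     length \<kappa> = n - 1 \<and> sorted_wrt (<) \<kappa> \<and> frob_det \<iota> t u m n f \<kappa> \<noteq> 0 \<and>
     (\<forall>\<rho>. length \<rho> = n - 1 \<and> sorted_wrt (<) \<rho> \<and> frob_det \<iota> t u m n f \<rho> \<noteq> 0 \<longrightarrow>
        \<kappa> = \<rho> \<or> (\<kappa>, \<rho>) \<in> lexord less_than)"

definition frob_divisor ::
  "('a::{field,finite} alg_closure \<Rightarrow> 'f::field) \<Rightarrow> ('v::finite \<Rightarrow> 'f) \<Rightarrow> 'f \<Rightarrow> nat \<Rightarrow> nat \<Rightarrow> nat \<Rightarrow>
   (nat \<Rightarrow> 'f) \<Rightarrow> nat list \<Rightarrow> ('v, 'a alg_closure) divisor" where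
  "frob_divisor \<iota> \<xi> t u m n f \<kappa> = (\<lambda>P.
     div_fun \<iota> \<xi> (frob_det \<iota> t u m n f \<kappa>) P
     + int (sum_list \<kappa>) * div_diff \<iota> \<xi> t P
     + int (CARD('a) ^ m + CARD('a) ^ u + n - 1) * E_div \<iota> \<xi> n f P)"

text \<open>\<open>binom_det j \<kappa> n k\<close> is the determinant of the binomial coefficients \<open>j\<^sub>i\<close> over \<open>\<kappa>\<^sub>s\<close> for
  \<open>k \<le> i \<le> k + n - 2\<close> and \<open>0 \<le> s \<le> n - 2\<close>.\<close>

definition binom_det :: "nat list \<Rightarrow> nat list \<Rightarrow> nat \<Rightarrow> nat \<Rightarrow> int" where
  "binom_det j \<kappa> n k = det (mat (n - 1) (n - 1) (\<lambda>(i, s). int ((j ! (k + i)) choose (\<kappa> ! s))))"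

end

theory Submission
  imports Defs
begin

text \<open>
Choose a local parameter \<open>\<pi>\<close> at \<open>P\<close> and divide the \<open>f i\<close> by one of least valuation. By the minimality
  of the Frobenius orders, passing from \<open>t\<close> to \<open>\<pi>\<close> and from \<open>f i\<close> to \<open>f i / f i0\<close> multiplies the
  determinant by exactly the factors which the terms with \<open>div(dt)\<close> and \<open>E\<close> of the Frobenius divisor
  account for: the derivatives of orders not in \<open>\<kappa>\<close> are combinations of the earlier rows, so the change is
  triangular (\<open>det_rows_mat_triangular\<close>, \<open>hasse_param_mult_change\<close>). Replacing the columns by a basis \<open>g i\<close>
  of the linear series with \<open>g i\<close> of order \<open>j\<^sub>i\<close> multiplies the determinant by a nonzero constant. Hence the
  coefficient of the divisor at \<open>P\<close> is the valuation of one determinant (\<open>T_eq_vl_N\<close>). Its rows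
  of derivatives can be read off from power series in \<open>\<pi>\<close>: the \<open>\<kappa>\<^sub>s\<close>-th derivative of a series with leading
  term \<open>c x ^ j\<close> begins with \<open>binomial (j, \<kappa>\<^sub>s) c x ^ (j - \<kappa>\<^sub>s)\<close>. Laplace expansion along the two rows of
  Frobenius powers then bounds the valuation, and the coefficients of the leading terms are the
  determinants of binomial coefficients (\<open>graded_rows\<close>).

  The four cases differ in what is known about the two rows of powers. Without rationality, only
  that their entries are regular (\<open>bound_arbitrary\<close>). If \<open>P\<close> is rational over the field of \<open>q ^ r\<close>
  elements, then the \<open>q ^ r\<close>-Frobenius map on the constants extends to a semilinear automorphism of
  the function field that fixes the \<open>f i\<close> and preserves the valuation at \<open>P\<close> (\<open>semilinear\<close>). So the entries
  of the row of \<open>q ^ r\<close>-th powers are \<open>q ^ r\<close>-th powers of functions of the orders \<open>j\<^sub>i\<close>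
  (\<open>frob_row_rational\<close>). If \<open>P\<close> is rational over the field of \<open>q ^ (m - u)\<close> elements, the difference of the
  two rows vanishes to order \<open>j\<^sub>1 q ^ u\<close>. If it is rational over the field of \<open>q\<close> elements, both rows are
  known, and clearing the first column by subtractions leaves a single term of least order, which
  gives the criterion for equality (\<open>bound_rational\<close>).

  These arguments need local theory of curves. The local ring at \<open>P\<close> is a discrete valuation
  ring, because any two functions are algebraically dependent over the constants
  (\<open>alg_dependent_if_algebraic\<close>, \<open>param_power_multiple\<close>), and it embeds into the power series over the
  constants. The Hasse derivatives with respect to \<open>\<pi>\<close> are those of power series: they preserve the
  local ring since each regular function is separable over the polynomials in \<open>\<pi>\<close>
  (\<open>separable_relation\<close>, \<open>fps_hasse_expand\<close>). Those with respect to a separating variable \<open>t\<close> arise from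
  them by inverting the Taylor expansion of \<open>t\<close> (\<open>hasse_change_variable\<close>).
\<close>

no_notation vec_index (infixl \<open>$\<close> 100)

section \<open>Evaluation of forms\<close>

lemma mpoly_eval_superset:
  assumes "finite A" "Poly_Mapping.keys G \<subseteq> A" "\<phi> 0 = 0"
  shows "mpoly_eval \<phi> x G =
    (\<Sum>m\<in>A. \<phi> (Poly_Mapping.lookup G m) * (\<Prod>i\<in>UNIV. x i ^ Poly_Mapping.lookup m i))"
  unfolding mpoly_eval_def
  by (rule sum.mono_neutral_left) (use assms in \<open>auto simp: in_keys_iff\<close>)

lemma poly_mapping_eq_sum_single:
  "G = (\<Sum>m\<in>Poly_Mapping.keys G. Poly_Mapping.single m (Poly_Mapping.lookup G m))"
  by (rule poly_mapping_eqI) (simp add: lookup_sum lookup_single when_def in_keys_iff)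

lemma mpoly_eval_zero [simp]: "mpoly_eval \<phi> x 0 = 0"
  by (simp add: mpoly_eval_def)

context comm_ring_hom
begin

lemma mpoly_eval_single:
  "mpoly_eval hom x (Poly_Mapping.single m c) = hom c * (\<Prod>i\<in>UNIV. x i ^ Poly_Mapping.lookup m i)"
  by (subst mpoly_eval_superset[of "{m}"]) auto

lemma mpoly_eval_add: "mpoly_eval hom x (G + H) = mpoly_eval hom x G + mpoly_eval hom x H"
proof -
  let ?A = "Poly_Mapping.keys G \<union> Poly_Mapping.keys H"
  show ?thesis
    by (subst (1 2 3) mpoly_eval_superset[of ?A])
       (use Poly_Mapping.keys_add[of G H] in
         \<open>auto simp: lookup_add hom_add algebra_simps sum.distrib\<close>)
qed

lemma mpoly_eval_sum: "mpoly_eval hom x (sum G A) = (\<Sum>a\<in>A. mpoly_eval hom x (G a))"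
  by (induction A rule: infinite_finite_induct) (auto simp: mpoly_eval_add)

lemma mpoly_eval_one [simp]: "mpoly_eval hom x 1 = 1"
  using mpoly_eval_single[of x 0 1] by simp

lemma mpoly_eval_mult: "mpoly_eval hom x (G * H) = mpoly_eval hom x G * mpoly_eval hom x H"
proof -
  let ?g = "Poly_Mapping.lookup G" and ?h = "Poly_Mapping.lookup H"
  let ?s = "\<lambda>m m'. Poly_Mapping.single (m + m') (?g m * ?h m')"
  have "G * H = (\<Sum>m\<in>Poly_Mapping.keys G. \<Sum>m'\<in>Poly_Mapping.keys H. ?s m m')"
    by (subst poly_mapping_eq_sum_single[of G], subst poly_mapping_eq_sum_single[of H])
       (simp add: sum_product mult_single)
  hence "mpoly_eval hom x (G * H) = (\<Sum>m\<in>Poly_Mapping.keys G. \<Sum>m'\<in>Poly_Mapping.keys H.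
      mpoly_eval hom x (?s m m'))"
    by (simp add: mpoly_eval_sum)
  also have "\<dots> = mpoly_eval hom x G * mpoly_eval hom x H"
    by (simp add: mpoly_eval_def[of _ _ G] mpoly_eval_def[of _ _ H] mpoly_eval_single sum_product
        lookup_add power_add prod.distrib hom_mult mult_ac)
  finally show ?thesis .
qed

end

lemma homogeneous_add: "homogeneous d G \<Longrightarrow> homogeneous d H \<Longrightarrow> homogeneous d (G + H)"
  using Poly_Mapping.keys_add[of G H] unfolding homogeneous_def by blast

lemma homogeneous_single:
  "(\<Sum>i\<in>UNIV. Poly_Mapping.lookup m i) = d \<Longrightarrow> homogeneous d (Poly_Mapping.single m c)"
  by (auto simp: homogeneous_def split: if_splits)

lemma homogeneous_const: "homogeneous 0 (Poly_Mapping.single 0 c)"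
  by (rule homogeneous_single) simp

lemma homogeneous_mult:
  fixes G H :: "('v::finite, 'b::comm_ring_1) mpoly"
  assumes "homogeneous d G" "homogeneous e H" shows "homogeneous (d + e) (G * H)"
  unfolding homogeneous_def
proof
  fix m assume "m \<in> Poly_Mapping.keys (G * H)"
  then obtain a b where "a \<in> Poly_Mapping.keys G" "b \<in> Poly_Mapping.keys H" "m = a + b"
    using keys_mult[of G H] by blast
  thus "(\<Sum>i\<in>UNIV. Poly_Mapping.lookup m i) = d + e"
    using assms by (simp add: homogeneous_def lookup_add sum.distrib)
qed

lemma mpoly_eval_scale:
  assumes "homogeneous d G"
  shows "mpoly_eval \<phi> (\<lambda>i. c * x i) G = c ^ d * mpoly_eval \<phi> x G"
  unfolding mpoly_eval_def sum_distrib_left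
proof (rule sum.cong)
  fix m assume m: "m \<in> Poly_Mapping.keys G"
  have "(\<Prod>i\<in>UNIV. (c * x i) ^ Poly_Mapping.lookup m i) =
      (\<Prod>i\<in>UNIV. c ^ Poly_Mapping.lookup m i) * (\<Prod>i\<in>UNIV. x i ^ Poly_Mapping.lookup m i)"
    by (simp add: power_mult_distrib prod.distrib)
  also have "(\<Prod>i\<in>UNIV. c ^ Poly_Mapping.lookup m i) = c ^ d"
    using assms m by (simp add: homogeneous_def power_sum[symmetric])
  finally show "\<phi> (Poly_Mapping.lookup G m) * (\<Prod>i\<in>UNIV. (c * x i) ^ Poly_Mapping.lookup m i) =
      c ^ d * (\<phi> (Poly_Mapping.lookup G m) * (\<Prod>i\<in>UNIV. x i ^ Poly_Mapping.lookup m i))"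
    by (simp add: mult_ac)
qed simp

lemma homogeneous_one: "homogeneous 0 (1 :: ('v::finite, 'b::comm_ring_1) mpoly)"
  using homogeneous_const[of 1] by (simp flip: single_one)

definition coord_form :: "'v \<Rightarrow> ('v::finite, 'b::comm_ring_1) mpoly" where
  "coord_form i = Poly_Mapping.single (Poly_Mapping.single i 1) 1"

lemma homogeneous_coord_form: "homogeneous 1 (coord_form i)"
  unfolding coord_form_def
  by (rule homogeneous_single) (simp add: lookup_single when_def)

lemma homogeneous_coord_form_power: "homogeneous d (coord_form i ^ d)"
proof (induction d)
  case 0 show ?case by (simp add: homogeneous_one)
next
  case (Suc d) thus ?case using homogeneous_mult[OF homogeneous_coord_form[of i] Suc] by simp
qed

context comm_ring_hom begin

lemma mpoly_eval_coord_form [simp]: "mpoly_eval hom x (coord_form i) = x i"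
proof -
  have "(\<Prod>j\<in>UNIV. x j ^ Poly_Mapping.lookup (Poly_Mapping.single i 1) j) =
      (\<Prod>j\<in>UNIV. if j = i then x j else 1)"
    by (rule prod.cong) (auto simp: lookup_single when_def)
  thus ?thesis by (simp add: coord_form_def mpoly_eval_single)
qed

lemma mpoly_eval_power: "mpoly_eval hom x (G ^ d) = mpoly_eval hom x G ^ d"
  by (induction d) (auto simp: mpoly_eval_mult)

end

lemma idom_hom_id: "idom_hom (id :: 'k::idom \<Rightarrow> 'k)"
  by unfold_locales auto


section \<open>Regular functions at a point\<close>

locale curve_point =
  fixes C :: "('v::finite, 'k::field) point set" and \<iota> :: "'k \<Rightarrow> 'f::field" and \<xi> :: "'v \<Rightarrow> 'f"
    and P :: "('v, 'k) point"
  assumes ff: "function_field C \<iota> \<xi>" and P: "P \<in> C" and C_proj: "C \<subseteq> proj_space"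
begin

sublocale const: field_hom \<iota> using ff by (simp add: function_field_def)
sublocale const_id: idom_hom "id :: 'k \<Rightarrow> 'k" by (rule idom_hom_id)

lemma point_scale: "a \<in> P \<Longrightarrow> b \<in> P \<Longrightarrow> \<exists>c. c \<noteq> 0 \<and> b = (\<lambda>i. c * a i)"
  and point_nonzero: "a \<in> P \<Longrightarrow> \<exists>i. a i \<noteq> 0"
proof -
  obtain a0 where a0: "a0 \<noteq> (\<lambda>_. 0)" "P = {(\<lambda>i. c * a0 i) |c. c \<noteq> 0}"
    using P C_proj unfolding proj_space_def by blast
  show "\<exists>i. a i \<noteq> 0" if "a \<in> P"
    using that a0 by fastforce
  assume "a \<in> P" "b \<in> P"
  then obtain c d where "c \<noteq> 0" "d \<noteq> 0" "a = (\<lambda>i. c * a0 i)" "b = (\<lambda>i. d * a0 i)"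
    using a0 by blast
  thus "\<exists>c. c \<noteq> 0 \<and> b = (\<lambda>i. c * a i)"
    by (intro exI[of _ "d / c"]) auto
qed

lemma point_nonempty: "\<exists>a. a \<in> P"
proof -
  obtain a :: "'v \<Rightarrow> 'k" where "P = {(\<lambda>i. c * a i) |c. c \<noteq> 0}"
    using P C_proj unfolding proj_space_def by blast
  hence "a \<in> P" by (auto intro!: exI[of _ 1])
  thus ?thesis by (intro exI[of _ a])
qed

lemma vanish_imp_zero:
  assumes "homogeneous d G" "mpoly_eval \<iota> \<xi> G = 0" "a \<in> P" shows "mpoly_eval id a G = 0"
  using assms ff P unfolding function_field_def vanishes_at_def by blast

text \<open>The value of a quotient of forms does not depend on the coordinate vector used for the
  point, so a fixed one may be chosen.\<close>

lemma takes_value_iff: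
  assumes a: "a \<in> P"
  shows "takes_value \<iota> \<xi> P g c \<longleftrightarrow> (\<exists>d G H. homogeneous d G \<and> homogeneous d H \<and>
     mpoly_eval id a H \<noteq> 0 \<and>
     g = mpoly_eval \<iota> \<xi> G / mpoly_eval \<iota> \<xi> H \<and> c = mpoly_eval id a G / mpoly_eval id a H)"
proof
  assume "takes_value \<iota> \<xi> P g c"
  then obtain d G H b where *: "b \<in> P" "homogeneous d G" "homogeneous d H"
    "mpoly_eval id b H \<noteq> 0" "g = mpoly_eval \<iota> \<xi> G / mpoly_eval \<iota> \<xi> H"
    "c = mpoly_eval id b G / mpoly_eval id b H"
    unfolding takes_value_def by blast
  obtain e where e: "e \<noteq> 0" "b = (\<lambda>i. e * a i)" using point_scale[OF a *(1)] by blast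
  have "mpoly_eval id b G = e ^ d * mpoly_eval id a G" "mpoly_eval id b H = e ^ d * mpoly_eval id a H"
    using mpoly_eval_scale[OF *(2), of id e a] mpoly_eval_scale[OF *(3), of id e a] e by auto
  thus "\<exists>d G H. homogeneous d G \<and> homogeneous d H \<and> mpoly_eval id a H \<noteq> 0 \<and>
     g = mpoly_eval \<iota> \<xi> G / mpoly_eval \<iota> \<xi> H \<and> c = mpoly_eval id a G / mpoly_eval id a H"
    using * e(1) by (intro exI[of _ d] exI[of _ G] exI[of _ H]) auto
qed (use a in \<open>auto simp: takes_value_def\<close>)

text \<open>The difference of two representations \<open>G / H\<close> and \<open>G' / H'\<close> is a form \<open>G H' - G' H\<close> vanishing at
  the generic point, hence on \<open>C\<close>, hence at \<open>P\<close>.\<close>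

lemma takes_value_unique:
  assumes "takes_value \<iota> \<xi> P g c" "takes_value \<iota> \<xi> P g c'" shows "c = c'"
proof -
  obtain a where a: "a \<in> P" using point_nonempty by blast
  obtain d G H where 1: "homogeneous d G" "homogeneous d H" "mpoly_eval id a H \<noteq> 0"
     "g = mpoly_eval \<iota> \<xi> G / mpoly_eval \<iota> \<xi> H" "c = mpoly_eval id a G / mpoly_eval id a H"
    using assms(1) unfolding takes_value_iff[OF a] by blast
  obtain d' G' H' where 2: "homogeneous d' G'" "homogeneous d' H'" "mpoly_eval id a H' \<noteq> 0"
     "g = mpoly_eval \<iota> \<xi> G' / mpoly_eval \<iota> \<xi> H'" "c' = mpoly_eval id a G' / mpoly_eval id a H'"
    using assms(2) unfolding takes_value_iff[OF a] by blast
  let ?m1 = "Poly_Mapping.single 0 (-1) :: ('v, 'k) mpoly"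
  let ?F = "G * H' + ?m1 * (G' * H)"
  have nz: "mpoly_eval \<iota> \<xi> H \<noteq> 0" "mpoly_eval \<iota> \<xi> H' \<noteq> 0"
    using vanish_imp_zero 1(2,3) 2(2,3) a by blast+
  have hom: "homogeneous (d + d') ?F"
    using homogeneous_mult[OF homogeneous_const homogeneous_mult[OF 2(1) 1(2)], of "-1"]
    by (intro homogeneous_add homogeneous_mult[OF 1(1) 2(2)]) (simp add: add.commute)
  have "mpoly_eval \<iota> \<xi> ?F = 0"
    using 1(4) 2(4) nz
    by (simp add: const.mpoly_eval_add const.mpoly_eval_mult const.mpoly_eval_single const.hom_uminus
        field_simps)
  hence "mpoly_eval id a ?F = 0" using vanish_imp_zero[OF hom _ a] by blast
  hence "mpoly_eval id a G * mpoly_eval id a H' = mpoly_eval id a G' * mpoly_eval id a H"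
    by (simp add: const_id.mpoly_eval_add const_id.mpoly_eval_mult const_id.mpoly_eval_single)
  thus ?thesis unfolding 1(5) 2(5) frac_eq_eq[OF 1(3) 2(3)] .
qed

lemma takes_value_const: "takes_value \<iota> \<xi> P (\<iota> c) c"
proof -
  obtain a where a: "a \<in> P" using point_nonempty by blast
  have "mpoly_eval \<iota> \<xi> (Poly_Mapping.single 0 c) = \<iota> c" "mpoly_eval id a (Poly_Mapping.single 0 c) = c"
    by (simp_all add: const.mpoly_eval_single const_id.mpoly_eval_single)
  thus ?thesis using homogeneous_const[of c] homogeneous_one
    unfolding takes_value_iff[OF a]
    by (intro exI[of _ "0::nat"] exI[of _ "Poly_Mapping.single 0 c"] exI[of _ "1 :: ('v, 'k) mpoly"])
       (simp only: const.mpoly_eval_one const_id.mpoly_eval_one, simp)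
qed

lemma takes_value_add:
  assumes "takes_value \<iota> \<xi> P g c" "takes_value \<iota> \<xi> P h e"
  shows "takes_value \<iota> \<xi> P (g + h) (c + e)"
  and takes_value_mult: "takes_value \<iota> \<xi> P (g * h) (c * e)"
proof -
  obtain a where a: "a \<in> P" using point_nonempty by blast
  obtain d G H where 1: "homogeneous d G" "homogeneous d H" "mpoly_eval id a H \<noteq> 0"
     "g = mpoly_eval \<iota> \<xi> G / mpoly_eval \<iota> \<xi> H" "c = mpoly_eval id a G / mpoly_eval id a H"
    using assms(1) unfolding takes_value_iff[OF a] by blast
  obtain d' G' H' where 2: "homogeneous d' G'" "homogeneous d' H'" "mpoly_eval id a H' \<noteq> 0"
     "h = mpoly_eval \<iota> \<xi> G' / mpoly_eval \<iota> \<xi> H'" "e = mpoly_eval id a G' / mpoly_eval id a H'"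
    using assms(2) unfolding takes_value_iff[OF a] by blast
  have nz: "mpoly_eval \<iota> \<xi> H \<noteq> 0" "mpoly_eval \<iota> \<xi> H' \<noteq> 0"
    using vanish_imp_zero 1(2,3) 2(2,3) a by blast+
  have hom: "homogeneous (d + d') (G * H' + G' * H)" "homogeneous (d + d') (H * H')"
    "homogeneous (d + d') (G * G')"
    using homogeneous_mult[OF 2(1) 1(2)] homogeneous_mult[OF 1(1) 2(2)]
      homogeneous_mult[OF 1(2) 2(2)] homogeneous_mult[OF 1(1) 2(1)]
    by (auto intro!: homogeneous_add simp: add.commute)
  show "takes_value \<iota> \<xi> P (g + h) (c + e)" unfolding takes_value_iff[OF a]
    by (intro exI[of _ "d + d'"] exI[of _ "G * H' + G' * H"] exI[of _ "H * H'"])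
       (simp add: hom 1(3) 2(3) 1(4,5) 2(4,5) add_frac_eq nz const.mpoly_eval_add
          const.mpoly_eval_mult const_id.mpoly_eval_add const_id.mpoly_eval_mult)
  show "takes_value \<iota> \<xi> P (g * h) (c * e)" unfolding takes_value_iff[OF a]
    by (intro exI[of _ "d + d'"] exI[of _ "G * G'"] exI[of _ "H * H'"])
       (simp add: hom 1(3) 2(3) 1(4,5) 2(4,5) nz const.mpoly_eval_mult const_id.mpoly_eval_mult)
qed

lemma takes_value_inverse:
  assumes "takes_value \<iota> \<xi> P g c" "c \<noteq> 0"
  shows "takes_value \<iota> \<xi> P (inverse g) (inverse c)"
proof -
  obtain a where a: "a \<in> P" using point_nonempty by blast
  obtain d G H where 1: "homogeneous d G" "homogeneous d H" "mpoly_eval id a H \<noteq> 0"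
     "g = mpoly_eval \<iota> \<xi> G / mpoly_eval \<iota> \<xi> H" "c = mpoly_eval id a G / mpoly_eval id a H"
    using assms(1) unfolding takes_value_iff[OF a] by blast
  show ?thesis unfolding takes_value_iff[OF a]
    by (intro exI[of _ d] exI[of _ H] exI[of _ G]) (use 1(1-3) assms(2) in \<open>simp add: 1(4,5)\<close>)
qed

lemma takes_value_coord_quotient:
  assumes a: "a \<in> P" "a i \<noteq> 0" and G: "homogeneous d G"
  shows "takes_value \<iota> \<xi> P (mpoly_eval \<iota> \<xi> G / \<xi> i ^ d) (mpoly_eval id a G / a i ^ d)"
  unfolding takes_value_iff[OF a(1)]
  by (intro exI[of _ d] exI[of _ G] exI[of _ "coord_form i ^ d"])
     (simp add: a G homogeneous_coord_form_power const.mpoly_eval_power const_id.mpoly_eval_power)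

lemma coord_nonzero: "a \<in> P \<Longrightarrow> a i \<noteq> 0 \<Longrightarrow> \<xi> i \<noteq> 0"
  using vanish_imp_zero[OF homogeneous_coord_form[of i]] by auto

lemma fraction_of_regular:
  "\<exists>g h. g \<in> local_ring \<iota> \<xi> P \<and> h \<in> local_ring \<iota> \<xi> P \<and> h \<noteq> 0 \<and> f = g / h"
proof -
  have "f \<in> homog_quotients \<iota> \<xi>" using ff by (simp add: function_field_def)
  then obtain d G H where *: "homogeneous d G" "homogeneous d H" "mpoly_eval \<iota> \<xi> H \<noteq> 0"
    "f = mpoly_eval \<iota> \<xi> G / mpoly_eval \<iota> \<xi> H" unfolding homog_quotients_def by blast
  obtain a where a: "a \<in> P" using point_nonempty by blast
  then obtain i where i: "a i \<noteq> 0" using point_nonzero by blast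
  note c = takes_value_coord_quotient[OF a i *(1)] takes_value_coord_quotient[OF a i *(2)]
  show ?thesis
    by (intro exI[of _ "mpoly_eval \<iota> \<xi> G / \<xi> i ^ d"] exI[of _ "mpoly_eval \<iota> \<xi> H / \<xi> i ^ d"])
       (use c *(3,4) coord_nonzero[OF a i] in \<open>auto simp: local_ring_def simp del: id_apply\<close>)
qed

end

section \<open>Algebraic dependence in a function field\<close>

definition alg_dependent :: "('k::zero \<Rightarrow> 'f::field) \<Rightarrow> 'f \<Rightarrow> 'f \<Rightarrow> bool" where
  "alg_dependent \<iota> y z \<longleftrightarrow> (\<exists>N c. (\<exists>i j. i + j \<le> N \<and> c i j \<noteq> 0) \<and>
     (\<Sum>(i, j)\<in>{(i, j). i + j \<le> N}. \<iota> (c i j) * y ^ i * z ^ j) = 0)"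

lemma finite_triangle [simp, intro]: "finite {(i, j). i + j \<le> (N::nat)}"
  by (rule finite_subset[of _ "{..N} \<times> {..N}"]) auto

context vector_space
begin

text \<open>Indexed families rather than sets: equal members of the family give a relation, too.\<close>

lemma nontrivial_relation_if_card_gt:
  assumes "finite I" "finite G" "\<And>i. i \<in> I \<Longrightarrow> F i \<in> span G" "card G < card I"
  shows "\<exists>c. (\<exists>i\<in>I. c i \<noteq> 0) \<and> (\<Sum>i\<in>I. scale (c i) (F i)) = 0"
proof (cases "inj_on F I")
  case True
  have "dependent (F ` I)"
    using independent_span_bound[OF assms(2), of "F ` I"] assms(3,4) card_image[OF True] by auto
  then obtain u where u: "\<exists>v\<in>F ` I. u v \<noteq> 0" "(\<Sum>v\<in>F ` I. scale (u v) v) = 0"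
    using assms(1) by (subst (asm) dependent_finite) auto
  thus ?thesis
    by (intro exI[of _ "u \<circ> F"]) (auto simp: sum.reindex[OF True])
next
  case False
  then obtain i j where ij: "i \<in> I" "j \<in> I" "i \<noteq> j" "F i = F j" by (auto simp: inj_on_def)
  let ?c = "\<lambda>k. if k = i then 1 else if k = j then - 1 else 0"
  have "(\<Sum>k\<in>I. scale (?c k) (F k)) = (\<Sum>k\<in>{i, j}. scale (?c k) (F k))"
    using ij assms(1) by (intro sum.mono_neutral_right) auto
  also have "\<dots> = 0" using ij by simp
  finally show ?thesis using ij(1) by (intro exI[of _ ?c]) auto
qed

end

lemma vector_space_field_hom:
  assumes "field_hom \<iota>" shows "vector_space (\<lambda>c x. \<iota> c * x)"
proof -
  interpret field_hom \<iota> by fact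
  show ?thesis by unfold_locales (auto simp: hom_add hom_mult algebra_simps)
qed

context field_hom
begin

lemma poly_map_mult: "poly (map_poly hom (p * q)) t = poly (map_poly hom p) t * poly (map_poly hom q) t"
proof -
  have "map_poly hom (p * q) = map_poly hom p * map_poly hom q"
    by (rule poly_eqI) (simp add: coeff_map_poly coeff_mult hom_sum hom_mult)
  thus "poly (map_poly hom (p * q)) t = poly (map_poly hom p) t * poly (map_poly hom q) t" by simp
qed

lemma poly_map_uminus: "poly (map_poly hom (- p)) t = - poly (map_poly hom p) t"
proof -
  have "map_poly hom (- p) = - map_poly hom p"
    by (rule poly_eqI) (simp add: coeff_map_poly hom_uminus)
  thus ?thesis by simp
qed

lemma poly_map_altdef:
  assumes "degree p \<le> e"
  shows "poly (map_poly hom p) t = (\<Sum>i\<le>e. hom (coeff p i) * t ^ i)"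
  using assms
  by (subst poly_altdef, intro sum.mono_neutral_cong_left)
     (auto simp: coeff_map_poly coeff_eq_0 degree_map_poly intro: le_degree)

lemma clear_denominators:
  assumes "\<And>j. j \<le> (d::nat) \<Longrightarrow> b j \<in> simple_ext hom t"
  shows "\<exists>D r. poly (map_poly hom D) t \<noteq> 0 \<and>
     (\<forall>j\<le>d. poly (map_poly hom D) t * b j = poly (map_poly hom (r j)) t)"
  using assms
proof (induction d)
  case 0
  then obtain p q where "b 0 = poly (map_poly hom p) t / poly (map_poly hom q) t"
    "poly (map_poly hom q) t \<noteq> 0" unfolding simple_ext_def by auto
  thus ?case by (intro exI[of _ q] exI[of _ "\<lambda>_. p"]) auto
next
  case (Suc d)
  then obtain D r where Dr: "poly (map_poly hom D) t \<noteq> 0"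
    "\<And>j. j \<le> d \<Longrightarrow> poly (map_poly hom D) t * b j = poly (map_poly hom (r j)) t" by auto
  have "b (Suc d) \<in> simple_ext hom t" using Suc.prems by auto
  then obtain p q where pq: "b (Suc d) = poly (map_poly hom p) t / poly (map_poly hom q) t"
    "poly (map_poly hom q) t \<noteq> 0" unfolding simple_ext_def by auto
  show ?case
  proof (intro exI[of _ "D * q"] exI[of _ "\<lambda>j. if j \<le> d then q * r j else D * p"] conjI allI impI)
    show "poly (map_poly hom (D * q)) t \<noteq> 0" using Dr(1) pq by (simp add: poly_map_mult)
    fix j assume j: "j \<le> Suc d"
    show "poly (map_poly hom (D * q)) t * b j =
        poly (map_poly hom (if j \<le> d then q * r j else D * p)) t"
    proof (cases "j \<le> d")
      case True
      thus ?thesis using Dr(2)[OF True] by (simp add: poly_map_mult mult_ac)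
    next
      case False
      hence "j = Suc d" using j by simp
      thus ?thesis using pq by (simp add: poly_map_mult)
    qed
  qed
qed

lemma algebraic_over_cleared:
  assumes "algebraic_over (simple_ext hom t) y"
  shows "\<exists>d c r. d > 0 \<and> poly (map_poly hom c) t \<noteq> 0 \<and>
     poly (map_poly hom c) t * y ^ d = (\<Sum>j<d. poly (map_poly hom (r j)) t * y ^ j)"
proof -
  obtain B where B: "set (coeffs B) \<subseteq> simple_ext hom t" "B \<noteq> 0" "poly B y = 0"
    using assms unfolding algebraic_over_def by blast
  define d where "d = degree B"
  have mem: "coeff B j \<in> simple_ext hom t" if "j \<le> d" for j
    using B(1,2) that nth_mem[of j "coeffs B"] coeffs_nth[of B j]
    by (auto simp: d_def length_coeffs_degree)
  obtain D r where Dr: "poly (map_poly hom D) t \<noteq> 0"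
     "\<And>j. j \<le> d \<Longrightarrow> poly (map_poly hom D) t * coeff B j = poly (map_poly hom (r j)) t"
    using clear_denominators[of d "coeff B" t] mem by auto
  have d0: "d > 0"
  proof (rule ccontr)
    assume "\<not> d > 0"
    then obtain b where "B = [:b:]" by (auto simp: d_def elim: degree_eq_zeroE)
    thus False using B by simp
  qed
  have "0 = poly (map_poly hom D) t * (\<Sum>j\<le>d. coeff B j * y ^ j)"
    using B(3) by (simp add: poly_altdef d_def)
  also have "\<dots> = (\<Sum>j\<le>d. poly (map_poly hom (r j)) t * y ^ j)"
    by (auto simp: sum_distrib_left Dr(2)[symmetric] mult_ac intro!: sum.cong)
  also have "\<dots> = (\<Sum>j<d. poly (map_poly hom (r j)) t * y ^ j) + poly (map_poly hom (r d)) t * y ^ d"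
    by (simp add: lessThan_Suc_atMost[symmetric])
  finally have eq: "poly (map_poly hom (r d)) t * y ^ d =
      (\<Sum>j<d. poly (map_poly hom (- r j)) t * y ^ j)"
    by (simp add: poly_map_uminus sum_negf eq_neg_iff_add_eq_0 add.commute)
  have "poly (map_poly hom (r d)) t \<noteq> 0"
    using Dr(1) Dr(2)[of d, symmetric] B(2) by (simp add: d_def)
  thus ?thesis using eq d0 by (intro exI[of _ d] exI[of _ "r d"] exI[of _ "\<lambda>j. - r j"]) auto
qed

text \<open>Clearing denominators, \<open>y\<close> and \<open>z\<close> satisfy equations of degrees \<open>d1\<close> and \<open>d2\<close> over the
  polynomials in \<open>t\<close>. So, up to one common factor, the monomials in \<open>y\<close> and \<open>z\<close> with exponents up to
  \<open>M\<close> all lie in the span of the \<open>t ^ a * y ^ b * z ^ b'\<close> with \<open>b < d1\<close>, \<open>b' < d2\<close> and \<open>a\<close> bounded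
  linearly in \<open>M\<close>. There are quadratically many of the former and linearly many of the latter.\<close>

lemma alg_dependent_if_algebraic:
  assumes "algebraic_over (simple_ext hom t) y" "algebraic_over (simple_ext hom t) z"
  shows "alg_dependent hom y z"
proof -
  interpret V: vector_space "\<lambda>c x. hom c * x" by (rule vector_space_field_hom) unfold_locales
  let ?T = "\<lambda>p. poly (map_poly hom p) t"
  obtain d1 c1 r1 where 1: "d1 > 0" "?T c1 \<noteq> 0" "?T c1 * y ^ d1 = (\<Sum>j<d1. ?T (r1 j) * y ^ j)"
    using algebraic_over_cleared[OF assms(1)] by blast
  obtain d2 c2 r2 where 2: "d2 > 0" "?T c2 \<noteq> 0" "?T c2 * z ^ d2 = (\<Sum>j<d2. ?T (r2 j) * z ^ j)"
    using algebraic_over_cleared[OF assms(2)] by blast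
  define e where "e = Max (degree ` ({c1, c2} \<union> r1 ` {..<d1} \<union> r2 ` {..<d2}))"
  have e: "degree p \<le> e" if "p \<in> {c1, c2} \<union> r1 ` {..<d1} \<union> r2 ` {..<d2}" for p
    unfolding e_def using that by (intro Max_ge) auto
  define g where "g a b b' = t ^ a * y ^ b * z ^ b'" for a b b' :: nat
  define G where "G N = (\<lambda>(a, b, b'). g a b b') ` ({..N} \<times> {..<d1} \<times> {..<d2})" for N
  have G: "g a b b' \<in> V.span (G N)" if "a \<le> N" "b < d1" "b' < d2" for a b b' N
    using that by (intro V.span_base) (force simp: G_def)
  have mapsI: "w * s \<in> V.span (G (N + e))"
    if "s \<in> V.span (G N)"
      "\<And>a b b'. a \<le> N \<Longrightarrow> b < d1 \<Longrightarrow> b' < d2 \<Longrightarrow> w * g a b b' \<in> V.span (G (N + e))" for w s N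
  proof -
    have "V.subspace {s. w * s \<in> V.span (G (N + e))}"
      using V.span_add V.span_scale V.span_zero
      by (auto simp: V.subspace_def distrib_left mult.left_commute[of w "hom c" for c])
    hence "V.span (G N) \<subseteq> {s. w * s \<in> V.span (G (N + e))}"
      by (rule V.span_minimal[rotated]) (use that(2) in \<open>auto simp: G_def[of N]\<close>)
    thus ?thesis using that(1) by auto
  qed
  have T: "?T p * s \<in> V.span (G (N + e))" if "s \<in> V.span (G N)" "degree p \<le> e" for p s N
  proof (rule mapsI[OF that(1)])
    fix a b b' assume "a \<le> N" "b < d1" "b' < d2"
    hence "(\<Sum>i\<le>e. hom (coeff p i) * g (i + a) b b') \<in> V.span (G (N + e))"
      by (intro V.span_sum V.span_scale G) auto
    also have "(\<Sum>i\<le>e. hom (coeff p i) * g (i + a) b b') = ?T p * g a b b'"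
      unfolding poly_map_altdef[OF that(2)] sum_distrib_right
      by (intro sum.cong) (simp_all add: g_def power_add mult_ac)
    finally show "?T p * g a b b' \<in> V.span (G (N + e))" .
  qed
  have Tg: "?T p * g a b b' \<in> V.span (G (N + e))"
    if "p \<in> {c1, c2} \<union> r1 ` {..<d1} \<union> r2 ` {..<d2}" "a \<le> N" "b < d1" "b' < d2" for p a b b' N
    using T[OF G e] that by blast
  have Y: "?T c1 * y * s \<in> V.span (G (N + e))" if "s \<in> V.span (G N)" for s N
  proof (rule mapsI[OF that])
    fix a b b' assume *: "a \<le> N" "b < d1" "b' < d2"
    show "?T c1 * y * g a b b' \<in> V.span (G (N + e))"
    proof (cases "Suc b < d1")
      case True
      have "?T c1 * g a (Suc b) b' \<in> V.span (G (N + e))" by (rule Tg) (use * True in auto)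
      thus ?thesis by (simp add: g_def mult_ac)
    next
      case False
      hence b: "d1 = Suc b" using * by simp
      have "?T c1 * y * g a b b' = (?T c1 * y ^ d1) * g a 0 b'" by (simp add: g_def b mult_ac)
      also have "\<dots> = (\<Sum>j<d1. ?T (r1 j) * g a j b')"
        unfolding 1(3) sum_distrib_right by (intro sum.cong) (simp_all add: g_def mult_ac)
      also have "\<dots> \<in> V.span (G (N + e))" by (intro V.span_sum Tg) (use * in auto)
      finally show ?thesis .
    qed
  qed
  have Z: "?T c2 * z * s \<in> V.span (G (N + e))" if "s \<in> V.span (G N)" for s N
  proof (rule mapsI[OF that])
    fix a b b' assume *: "a \<le> N" "b < d1" "b' < d2"
    show "?T c2 * z * g a b b' \<in> V.span (G (N + e))"
    proof (cases "Suc b' < d2")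
      case True
      have "?T c2 * g a b (Suc b') \<in> V.span (G (N + e))" by (rule Tg) (use * True in auto)
      thus ?thesis by (simp add: g_def mult_ac)
    next
      case False
      hence b: "d2 = Suc b'" using * by simp
      have "?T c2 * z * g a b b' = (?T c2 * z ^ d2) * g a b 0" by (simp add: g_def b mult_ac)
      also have "\<dots> = (\<Sum>j<d2. ?T (r2 j) * g a b j)"
        unfolding 2(3) sum_distrib_right by (intro sum.cong) (simp_all add: g_def mult_ac)
      also have "\<dots> \<in> V.span (G (N + e))" by (intro V.span_sum Tg) (use * in auto)
      finally show ?thesis .
    qed
  qed
  have iter: "w ^ k * s \<in> V.span (G (N + k * e))"
    if "\<And>N s. s \<in> V.span (G N) \<Longrightarrow> w * s \<in> V.span (G (N + e))" "s \<in> V.span (G N)" for w k s N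
  proof (induction k)
    case (Suc k)
    show ?case using that(1)[OF Suc] by (simp add: mult_ac add_ac)
  qed (use that in auto)
  define M where "M = 2 * (2 * e + 1) * d1 * d2"
  define F where "F = (\<lambda>(i, j). ?T c1 ^ M * ?T c2 ^ M * y ^ i * z ^ j)"
  have F: "F ij \<in> V.span (G (2 * M * e))" if ij: "ij \<in> {..M} \<times> {..M}" for ij
  proof -
    obtain i j where ij': "ij = (i, j)" "i \<le> M" "j \<le> M" using ij by auto
    have "1 \<in> V.span (G 0)" using G[of 0 0 0 0] 1 2 by (simp add: g_def)
    from iter[OF Y this, of i] have "(?T c1 * y) ^ i * 1 \<in> V.span (G (0 + i * e))" .
    from iter[OF Z this, of j]
      have "(?T c2 * z) ^ j * ((?T c1 * y) ^ i * 1) \<in> V.span (G (0 + i * e + j * e))" .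
    from iter[OF T[of _ _ c1] this, of "M - i"] e
      have "?T c1 ^ (M - i) * ((?T c2 * z) ^ j * ((?T c1 * y) ^ i * 1))
        \<in> V.span (G (0 + i * e + j * e + (M - i) * e))" by auto
    from iter[OF T[of _ _ c2] this, of "M - j"] e
    have *: "?T c2 ^ (M - j) * (?T c1 ^ (M - i) * ((?T c2 * z) ^ j * ((?T c1 * y) ^ i * 1)))
        \<in> V.span (G (0 + i * e + j * e + (M - i) * e + (M - j) * e))" by auto
    have "0 + i * e + j * e + (M - i) * e + (M - j) * e = (i + (M - i) + (j + (M - j))) * e"
      by (simp add: algebra_simps)
    also have "\<dots> = 2 * M * e" using ij' by simp
    finally have "0 + i * e + j * e + (M - i) * e + (M - j) * e = 2 * M * e" .
    moreover have "?T c2 ^ (M - j) * (?T c1 ^ (M - i) * ((?T c2 * z) ^ j * ((?T c1 * y) ^ i * 1)))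
      = (?T c1 ^ i * ?T c1 ^ (M - i)) * (?T c2 ^ j * ?T c2 ^ (M - j)) * y ^ i * z ^ j"
      by (simp add: power_mult_distrib mult_ac)
    moreover have "\<dots> = F ij" using ij' by (simp add: F_def flip: power_add)
    ultimately show ?thesis using * by simp
  qed
  have "card (G (2 * M * e)) \<le> card ({..2 * M * e} \<times> {..<d1} \<times> {..<d2})"
    unfolding G_def by (rule card_image_le) auto
  also have "\<dots> = (2 * M * e + 1) * (d1 * d2)" by (simp add: card_cartesian_product)
  also have "M > 0" using 1(1) 2(1) by (simp add: M_def)
  hence "(2 * M * e + 1) * (d1 * d2) \<le> (M * (2 * e + 1)) * (d1 * d2)"
    by (intro mult_right_mono) (auto simp: algebra_simps)
  also have "M * (2 * e + 1) * (d1 * d2) = M * ((2 * e + 1) * d1 * d2)" by (simp only: mult.assoc)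
  also have "\<dots> \<le> M * M" by (rule mult_left_mono) (simp_all add: M_def)
  also have "\<dots> < card ({..M} \<times> {..M})" by (simp add: card_cartesian_product)
  finally have card: "card (G (2 * M * e)) < card ({..M} \<times> {..M})" .
  have fin: "finite (G (2 * M * e))" by (simp add: G_def)
  have "\<exists>c. (\<exists>ij\<in>{..M} \<times> {..M}. c ij \<noteq> 0) \<and> (\<Sum>ij\<in>{..M} \<times> {..M}. hom (c ij) * F ij) = 0"
    by (rule V.nontrivial_relation_if_card_gt[OF _ fin F card]) auto
  then obtain c where c: "\<exists>ij\<in>{..M} \<times> {..M}. c ij \<noteq> 0" "(\<Sum>ij\<in>{..M} \<times> {..M}. hom (c ij) * F ij) = 0"
    by blast
  define c' where "c' i j = (if i \<le> M \<and> j \<le> M then c (i, j) else 0)" for i j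
  have "(\<Sum>(i, j)\<in>{(i, j). i + j \<le> 2 * M}. hom (c' i j) * y ^ i * z ^ j) =
      (\<Sum>(i, j)\<in>{..M} \<times> {..M}. hom (c (i, j)) * y ^ i * z ^ j)"
    by (intro sum.mono_neutral_cong_right) (auto simp: c'_def split: if_splits)
  moreover have "?T c1 ^ M * ?T c2 ^ M * (\<Sum>(i, j)\<in>{..M} \<times> {..M}. hom (c (i, j)) * y ^ i * z ^ j) = 0"
    using c(2) by (simp add: F_def sum_distrib_left case_prod_unfold mult_ac)
  ultimately have "(\<Sum>(i, j)\<in>{(i, j). i + j \<le> 2 * M}. hom (c' i j) * y ^ i * z ^ j) = 0"
    using 1 2 by simp
  moreover obtain i j where "i \<le> M" "j \<le> M" "c (i, j) \<noteq> 0" using c(1) by auto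
  hence "\<exists>i j. i + j \<le> 2 * M \<and> c' i j \<noteq> 0" by (intro exI[of _ i] exI[of _ j]) (auto simp: c'_def)
  ultimately show ?thesis unfolding alg_dependent_def by blast
qed

end


section \<open>Hasse derivatives of power series\<close>

text \<open>Differentiating \<open>r\<close> times and dividing by \<open>r!\<close>, in a form that makes sense in any characteristic.\<close>

definition fps_hasse :: "nat \<Rightarrow> 'a::comm_ring_1 fps \<Rightarrow> 'a fps" where
  "fps_hasse r s = Abs_fps (\<lambda>n. of_nat ((n + r) choose r) * s $ (n + r))"

lemma fps_hasse_nth: "fps_hasse r s $ n = of_nat ((n + r) choose r) * s $ (n + r)"
  by (simp add: fps_hasse_def)

lemma fps_hasse_0 [simp]: "fps_hasse 0 s = s"
  by (simp add: fps_eq_iff fps_hasse_nth)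

text \<open>The series \<open>s (X + T)\<close>, as a power series in \<open>T\<close> over the power series in \<open>X\<close>. The product rule for Hasse
  derivatives says that this substitution is multiplicative.\<close>

definition fps_taylor :: "'a::comm_ring_1 fps \<Rightarrow> 'a fps fps" where
  "fps_taylor s = Abs_fps (\<lambda>r. fps_hasse r s)"

lemma fps_taylor_nth: "fps_taylor s $ r = fps_hasse r s"
  by (simp add: fps_taylor_def)

lemma fps_taylor_add: "fps_taylor (s + t) = fps_taylor s + fps_taylor t"
  by (simp add: fps_eq_iff fps_taylor_nth fps_hasse_nth distrib_left)

lemma fps_taylor_const: "fps_taylor (fps_const c) = fps_const (fps_const c)"
  by (auto simp: fps_eq_iff fps_taylor_nth fps_hasse_nth)

lemma fps_taylor_X: "fps_taylor fps_X = fps_const fps_X + fps_X"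
proof -
  have "of_nat ((n + r) choose r) * (if n + r = 1 then 1 else 0) =
      ((if r = 0 then fps_X $ n else 0) + (if r = 1 then if n = 0 then 1 else 0 else 0) :: 'a)" for n r
    by (cases r) auto
  thus ?thesis
    by (auto simp: fps_eq_iff fps_taylor_nth fps_hasse_nth fps_X_def)
qed

text \<open>The coefficients of a product agree by Vandermonde's identity.\<close>

lemma fps_taylor_mult: "fps_taylor (s * t) = fps_taylor s * fps_taylor t"
proof (intro fps_ext)
  fix r n :: nat
  define F where "F i a = of_nat ((a choose i) * ((n + r - a) choose (r - i))) * (s $ a * t $ (n + r - a))" for i a :: nat
  have "(fps_taylor s * fps_taylor t) $ r $ n =
      (\<Sum>i\<le>r. \<Sum>a\<le>n. of_nat ((a + i) choose i) * s $ (a + i) *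
         (of_nat ((n - a + (r - i)) choose (r - i)) * t $ (n - a + (r - i))))"
    by (simp add: fps_mult_nth fps_taylor_nth fps_hasse_nth fps_sum_nth atLeast0AtMost)
  also have "\<dots> = (\<Sum>i\<le>r. \<Sum>a\<le>n. F i (a + i))"
  proof (intro sum.cong refl)
    fix i a assume "i \<in> {..r}" "a \<in> {..n}"
    hence "n - a + (r - i) = n + r - (a + i)" by auto
    thus "of_nat ((a + i) choose i) * s $ (a + i) *
         (of_nat ((n - a + (r - i)) choose (r - i)) * t $ (n - a + (r - i))) = F i (a + i)"
      by (simp add: F_def mult_ac)
  qed
  also have "\<dots> = (\<Sum>i\<le>r. \<Sum>a\<in>{i..n + i}. F i a)"
  proof (rule sum.cong[OF refl])
    fix i
    show "(\<Sum>a\<le>n. F i (a + i)) = (\<Sum>a\<in>{i..n + i}. F i a)"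
      by (rule sum.reindex_bij_witness[of _ "\<lambda>a. a - i" "\<lambda>a. a + i"]) auto
  qed
  also have "\<dots> = (\<Sum>i\<le>r. \<Sum>a\<le>n + r. F i a)"
  proof (rule sum.cong[OF refl], rule sum.mono_neutral_left)
    fix i assume i: "i \<in> {..r}"
    show "{i..n + i} \<subseteq> {..n + r}" using i by auto
    show "\<forall>a\<in>{..n + r} - {i..n + i}. F i a = 0"
    proof
      fix a assume "a \<in> {..n + r} - {i..n + i}"
      hence "a < i \<or> n + r - a < r - i" using i by auto
      hence "(a choose i) * ((n + r - a) choose (r - i)) = 0" by (auto simp: binomial_eq_0)
      thus "F i a = 0" by (simp only: F_def of_nat_0 mult_zero_left)
    qed
  qed auto
  also have "\<dots> = (\<Sum>a\<le>n + r. \<Sum>i\<le>r. F i a)" by (rule sum.swap)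
  also have "\<dots> = (\<Sum>a\<le>n + r. of_nat ((n + r) choose r) * (s $ a * t $ (n + r - a)))"
  proof (intro sum.cong refl)
    fix a assume "a \<in> {..n + r}"
    hence "(\<Sum>i\<le>r. (a choose i) * ((n + r - a) choose (r - i))) = (n + r) choose r"
      using vandermonde[of a "n + r - a" r] by simp
    thus "(\<Sum>i\<le>r. F i a) = of_nat ((n + r) choose r) * (s $ a * t $ (n + r - a))"
      unfolding F_def sum_distrib_right[symmetric] of_nat_sum[symmetric] by simp
  qed
  also have "\<dots> = fps_taylor (s * t) $ r $ n"
    by (simp add: fps_taylor_nth fps_hasse_nth fps_mult_nth sum_distrib_left atLeast0AtMost)
  finally show "fps_taylor (s * t) $ r $ n = (fps_taylor s * fps_taylor t) $ r $ n" ..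
qed

lemma fps_taylor_power: "fps_taylor (s ^ n) = fps_taylor s ^ n"
  using fps_taylor_const[of 1] by (induction n) (auto simp: fps_taylor_mult)

lemma fps_taylor_sum: "fps_taylor (sum f A) = (\<Sum>a\<in>A. fps_taylor (f a))"
  using fps_taylor_const[of 0] by (induction A rule: infinite_finite_induct) (auto simp: fps_taylor_add)


section \<open>Comparing the first coefficients of power series\<close>

lemma fps_mult_nth_diff:
  fixes A B C :: "'a::comm_ring_1 fps"
  assumes "\<And>s. s < r \<Longrightarrow> A $ s = B $ s"
  shows "(C * A) $ r - (C * B) $ r = C $ 0 * (A $ r - B $ r)"
proof -
  have "(C * A) $ r - (C * B) $ r = (\<Sum>i\<le>r. C $ i * (A $ (r - i) - B $ (r - i)))"
    by (simp add: fps_mult_nth atLeast0AtMost right_diff_distrib sum_subtractf)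
  also have "\<dots> = (\<Sum>i\<in>{0}. C $ i * (A $ (r - i) - B $ (r - i)))"
    by (rule sum.mono_neutral_right) (auto simp: assms)
  finally show ?thesis by simp
qed

lemma fps_power_nth_diff:
  fixes A B :: "'a::comm_ring_1 fps"
  assumes "r > 0" "\<And>s. s < r \<Longrightarrow> A $ s = B $ s"
  shows "(A ^ j) $ r - (B ^ j) $ r = of_nat j * (A $ 0) ^ (j - 1) * (A $ r - B $ r)"
    and "s < r \<Longrightarrow> (A ^ j) $ s = (B ^ j) $ s"
proof -
  have low: "(A ^ j) $ s = (B ^ j) $ s" if "s < r" for s j
    using that
  proof (induction j arbitrary: s)
    case (Suc j)
    thus ?case using assms(2) by (auto simp: fps_mult_nth intro!: sum.cong)
  qed auto
  thus "s < r \<Longrightarrow> (A ^ j) $ s = (B ^ j) $ s" .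
  show "(A ^ j) $ r - (B ^ j) $ r = of_nat j * (A $ 0) ^ (j - 1) * (A $ r - B $ r)"
  proof (induction j)
    case (Suc j)
    have "(A ^ Suc j) $ r - (B ^ Suc j) $ r =
        ((A * A ^ j) $ r - (A * B ^ j) $ r) + ((B ^ j * A) $ r - (B ^ j * B) $ r)"
      by (simp add: mult.commute)
    also have "(A * A ^ j) $ r - (A * B ^ j) $ r = A $ 0 * ((A ^ j) $ r - (B ^ j) $ r)"
      by (rule fps_mult_nth_diff) (use low in auto)
    also have "(B ^ j * A) $ r - (B ^ j * B) $ r = (B ^ j) $ 0 * (A $ r - B $ r)"
      by (rule fps_mult_nth_diff) (use assms in auto)
    also have "(B ^ j) $ 0 = (A $ 0) ^ j" using low[of 0 j] assms(1) by (simp add: fps_nth_power_0)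
    also have "A $ 0 * ((A ^ j) $ r - (B ^ j) $ r) + (A $ 0) ^ j * (A $ r - B $ r) =
        of_nat (Suc j) * (A $ 0) ^ (Suc j - 1) * (A $ r - B $ r)"
      unfolding Suc by (cases j) (auto simp: algebra_simps)
    finally show ?case .
  qed auto
qed

text \<open>An expansion of \<open>y\<close> that satisfies a separable equation is determined by the expansions of the
  coefficients: this is the uniqueness part of Hensel's lemma, coefficient by coefficient.\<close>

lemma fps_separable_nth_diff:
  fixes A B :: "'a::comm_ring_1 fps"
  assumes "r > 0" "\<And>s. s < r \<Longrightarrow> A $ s = B $ s"
  shows "(\<Sum>j\<le>d. b j * A ^ j) $ r - (\<Sum>j\<le>d. b j * B ^ j) $ r =
    (\<Sum>j\<le>d. of_nat j * b j $ 0 * (A $ 0) ^ (j - 1)) * (A $ r - B $ r)"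
proof -
  have "(b j * A ^ j) $ r - (b j * B ^ j) $ r = of_nat j * b j $ 0 * (A $ 0) ^ (j - 1) * (A $ r - B $ r)" for j
  proof -
    have "(b j * A ^ j) $ r - (b j * B ^ j) $ r = b j $ 0 * ((A ^ j) $ r - (B ^ j) $ r)"
      by (rule fps_mult_nth_diff, rule fps_power_nth_diff(2)[of r]) (use assms in auto)
    thus ?thesis using fps_power_nth_diff(1)[of r A B j] assms by (simp add: mult_ac)
  qed
  thus ?thesis
    by (simp add: fps_sum_nth sum_subtractf[symmetric] sum_distrib_right)
qed

section \<open>Places\<close>

text \<open>What the local ring of a nonsingular point of a curve gives without geometry: a ring \<open>R\<close> with
  evaluation map \<open>ev\<close> onto the constants and quotient field \<open>'f\<close>, in which any two elements are
  algebraically dependent. The field of constants is perfect of positive characteristic.\<close>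

locale place = const: field_hom \<iota>
  for \<iota> :: "'k::field \<Rightarrow> 'f::field" +
  fixes R :: "'f set" and ev :: "'f \<Rightarrow> 'k"
  assumes R_const: "\<iota> c \<in> R" and ev_const: "ev (\<iota> c) = c"
    and R_add: "g \<in> R \<Longrightarrow> h \<in> R \<Longrightarrow> g + h \<in> R"
    and ev_add: "g \<in> R \<Longrightarrow> h \<in> R \<Longrightarrow> ev (g + h) = ev g + ev h"
    and R_mult: "g \<in> R \<Longrightarrow> h \<in> R \<Longrightarrow> g * h \<in> R"
    and ev_mult: "g \<in> R \<Longrightarrow> h \<in> R \<Longrightarrow> ev (g * h) = ev g * ev h"
    and R_inverse: "g \<in> R \<Longrightarrow> ev g \<noteq> 0 \<Longrightarrow> inverse g \<in> R"
    and R_fraction: "\<exists>a b. a \<in> R \<and> b \<in> R \<and> b \<noteq> 0 \<and> g = a / b"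
    and nonconst: "\<exists>g. g \<notin> range \<iota>"
    and dependent: "alg_dependent \<iota> g h"
    and prime_char: "prime CHAR('k)"
    and perfect: "\<exists>b. b ^ CHAR('k) = (c :: 'k)"
begin

definition parameter :: "'f \<Rightarrow> bool" where
  "parameter \<pi> \<longleftrightarrow> {g \<in> R. ev g = 0} = {\<pi> * g |g. g \<in> R}"

text \<open>This is the shape of the definition of \<open>val\<close>: the parameter is part of the existential statement,
  so that the valuation does not depend on a choice.\<close>

definition vl :: "'f \<Rightarrow> int" where
  "vl g = (THE k. \<exists>\<pi> w. parameter \<pi> \<and> w \<in> R - {g \<in> R. ev g = 0} \<and> g = w * \<pi> powi k)"

lemma R_0 [simp]: "0 \<in> R" and R_1 [simp]: "1 \<in> R" and ev_0 [simp]: "ev 0 = 0" and ev_1 [simp]: "ev 1 = 1"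
  using R_const[of 0] R_const[of 1] ev_const[of 0] ev_const[of 1] by auto

lemma R_uminus: "g \<in> R \<Longrightarrow> - g \<in> R" and ev_uminus: "g \<in> R \<Longrightarrow> ev (- g) = - ev g"
  using R_mult[OF R_const, of g "-1"] ev_mult[OF R_const, of g "-1"]
    ev_const[of "-1"]
  by (auto simp: const.hom_uminus)

lemma R_diff: "g \<in> R \<Longrightarrow> h \<in> R \<Longrightarrow> g - h \<in> R"
  and ev_diff: "g \<in> R \<Longrightarrow> h \<in> R \<Longrightarrow> ev (g - h) = ev g - ev h"
  using R_add[OF _ R_uminus, of g h] ev_add[OF _ R_uminus, of g h] by (auto simp: ev_uminus)

lemma R_sum: "(\<And>i. i \<in> A \<Longrightarrow> g i \<in> R) \<Longrightarrow> sum g A \<in> R"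
  by (induction A rule: infinite_finite_induct) (auto simp: R_add)

lemma R_prod: "(\<And>i. i \<in> A \<Longrightarrow> g i \<in> R) \<Longrightarrow> prod g A \<in> R"
  by (induction A rule: infinite_finite_induct) (auto simp: R_mult)

lemma R_power: "g \<in> R \<Longrightarrow> g ^ n \<in> R" and ev_power: "g \<in> R \<Longrightarrow> ev (g ^ n) = ev g ^ n"
proof -
  show *: "g \<in> R \<Longrightarrow> g ^ n \<in> R" for n by (induction n) (auto simp: R_mult)
  show "g \<in> R \<Longrightarrow> ev (g ^ n) = ev g ^ n" by (induction n) (auto simp: * ev_mult)
qed

lemma R_of_nat: "of_nat n \<in> R"
  by (induction n) (auto simp: R_add)

lemma ev_inverse: "g \<in> R \<Longrightarrow> ev g \<noteq> 0 \<Longrightarrow> ev (inverse g) = inverse (ev g)"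
  using ev_mult[OF _ R_inverse, of g g] by (cases "g = 0") (auto simp: field_simps)

lemmas R_intros = R_const R_add R_mult R_uminus R_diff R_sum R_prod R_power R_of_nat R_0 R_1

end

lemma sum_triangle:
  "(\<Sum>(i, j)\<in>{(i, j). i + j \<le> (N::nat)}. f i j) = (\<Sum>j\<le>N. \<Sum>i\<le>N - j. f i j)"
proof -
  have "(\<Sum>j\<le>N. \<Sum>i\<le>N - j. f i j) = (\<Sum>(j, i)\<in>(SIGMA j:{..N}. {..N - j}). f i j)"
    by (rule sum.Sigma) auto
  also have "\<dots> = (\<Sum>(i, j)\<in>{(i, j). i + j \<le> N}. f i j)"
    by (rule sum.reindex_bij_witness[of _ prod.swap prod.swap]) auto
  finally show ?thesis ..
qed


section \<open>The valuation and the expansion in a local parameter\<close>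

locale place_param = place \<iota> R ev for \<iota> :: "'k::field \<Rightarrow> 'f::field" and R ev +
  fixes \<pi> :: 'f
  assumes param: "parameter \<pi>"
begin

lemma param_R [simp]: "\<pi> \<in> R" and ev_param [simp]: "ev \<pi> = 0"
proof -
  have "\<pi> \<in> {\<pi> * g |g. g \<in> R}" by (auto intro!: exI[of _ 1])
  thus "\<pi> \<in> R" "ev \<pi> = 0" using param unfolding parameter_def by blast+
qed

lemma param_dvd: "g \<in> R \<Longrightarrow> ev g = 0 \<Longrightarrow> \<exists>h\<in>R. g = \<pi> * h"
  using param unfolding parameter_def by blast

lemma param_nonzero [simp]: "\<pi> \<noteq> 0"
proof
  assume z: "\<pi> = 0"
  have c: "g = \<iota> (ev g)" if "g \<in> R" for g
    using param_dvd[of "g - \<iota> (ev g)"] that z by (auto simp: R_diff R_const ev_diff ev_const)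
  obtain g where "g \<notin> range \<iota>" using nonconst by blast
  moreover obtain a b where "a \<in> R" "b \<in> R" "g = a / b" using R_fraction by blast
  hence "g = \<iota> (ev a / ev b)" using c[of a] c[of b] by (metis const.hom_div)
  ultimately show False by blast
qed

lemma polynomial_factor:
  assumes "i \<le> M" "a i \<noteq> 0"
  shows "\<exists>e w. w \<in> R \<and> ev w \<noteq> 0 \<and> (\<Sum>i\<le>M. \<iota> (a i) * \<pi> ^ i) = \<pi> ^ e * w"
  using assms
proof (induction M arbitrary: a i)
  case 0
  thus ?case by (intro exI[of _ 0] exI[of _ "\<iota> (a 0)"]) (auto simp: R_const ev_const)
next
  case (Suc M)
  have eq: "(\<Sum>i\<le>Suc M. \<iota> (a i) * \<pi> ^ i) = \<iota> (a 0) + \<pi> * (\<Sum>i\<le>M. \<iota> (a (Suc i)) * \<pi> ^ i)"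
    by (subst sum.atMost_Suc_shift) (simp add: sum_distrib_left mult_ac)
  show ?case
  proof (cases "a 0 = 0")
    case True
    then obtain i' where "i = Suc i'" using Suc.prems by (cases i) auto
    then obtain e w where "w \<in> R" "ev w \<noteq> 0" "(\<Sum>i\<le>M. \<iota> (a (Suc i)) * \<pi> ^ i) = \<pi> ^ e * w"
      using Suc.IH[of i' "\<lambda>i. a (Suc i)"] Suc.prems by auto
    thus ?thesis using True eq by (intro exI[of _ "Suc e"] exI[of _ w]) auto
  next
    case False
    have R: "(\<Sum>i\<le>M. \<iota> (a (Suc i)) * \<pi> ^ i) \<in> R" by (intro R_intros) auto
    show ?thesis unfolding eq
      by (intro exI[of _ 0] exI[of _ "\<iota> (a 0) + \<pi> * (\<Sum>i\<le>M. \<iota> (a (Suc i)) * \<pi> ^ i)"])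
         (use False R in \<open>auto simp: ev_add ev_mult R_mult R_const ev_const intro!: R_intros\<close>)
  qed
qed

text \<open>The relation between \<open>\<pi>\<close> and \<open>g\<close>, divided by a power of \<open>g\<close>, makes a nonzero polynomial in
  \<open>\<pi>\<close>, hence a power of \<open>\<pi>\<close>, a multiple of \<open>g\<close>. So \<open>g\<close> cannot be divisible by all powers of \<open>\<pi>\<close>. This
  takes the place of Krull's intersection theorem.\<close>

lemma param_power_multiple:
  assumes g: "g \<in> R" "g \<noteq> 0"
  shows "\<exists>e. \<exists>h\<in>R. \<pi> ^ e = g * h"
proof -
  obtain N c where c: "\<exists>i j. i + j \<le> N \<and> c i j \<noteq> 0"
    "(\<Sum>(i, j)\<in>{(i, j). i + j \<le> N}. \<iota> (c i j) * \<pi> ^ i * g ^ j) = 0"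
    using dependent[of \<pi> g] unfolding alg_dependent_def by blast
  define p where "p j = (\<Sum>i\<le>N - j. \<iota> (c i j) * \<pi> ^ i)" for j
  have pR: "p j \<in> R" for j unfolding p_def by (intro R_intros) auto
  have sum0: "(\<Sum>j\<le>N. p j * g ^ j) = 0"
    using c(2) by (simp add: sum_triangle p_def sum_distrib_right)
  let ?Q = "\<lambda>j. \<exists>i. i + j \<le> N \<and> c i j \<noteq> 0"
  obtain j0 where j0: "?Q j0" "\<And>j. j < j0 \<Longrightarrow> \<not> ?Q j"
    using c(1) exists_least_iff[of ?Q] by blast
  have j0N: "j0 \<le> N" using j0(1) by auto
  obtain e w where w: "w \<in> R" "ev w \<noteq> 0" "p j0 = \<pi> ^ e * w"
  proof -
    obtain i where "i \<le> N - j0" "c i j0 \<noteq> 0" using j0(1) by (auto simp: le_diff_conv2 j0N)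
    from polynomial_factor[of i "N - j0" "\<lambda>i. c i j0", OF this] show thesis
      using that unfolding p_def by blast
  qed
  have z: "p j = 0" if "j < j0" for j
    using j0(2)[OF that] that j0N unfolding p_def by (intro sum.neutral) auto
  define B where "B = (\<Sum>j\<in>{j0<..N}. p j * g ^ (j - Suc j0))"
  have BR: "B \<in> R" unfolding B_def using pR g by (intro R_intros) auto
  have "(\<Sum>j\<le>N. p j * g ^ j) = (\<Sum>j\<in>{j0..N}. p j * g ^ j)"
    by (intro sum.mono_neutral_right) (auto simp: z)
  also have "\<dots> = p j0 * g ^ j0 + (\<Sum>j\<in>{j0<..N}. p j * g ^ j)"
    using j0N by (simp add: sum.head)
  also have "(\<Sum>j\<in>{j0<..N}. p j * g ^ j) = g ^ Suc j0 * B"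
    unfolding B_def sum_distrib_left
    by (intro sum.cong) (auto simp: mult.left_commute simp flip: power_add power_Suc)
  finally have "g ^ j0 * (p j0 + g * B) = 0" using sum0 by (simp add: algebra_simps)
  hence "\<pi> ^ e * w = g * (- B)" using g(2) w(3) by (simp add: eq_neg_iff_add_eq_0)
  moreover have "w \<noteq> 0" using w(2) by auto
  ultimately have "\<pi> ^ e = g * (- B * inverse w)" by (simp add: field_simps)
  moreover have "- B * inverse w \<in> R" using BR w by (intro R_mult R_uminus R_inverse)
  ultimately show ?thesis by blast
qed

lemma ev_param_mult_neq_1: "h \<in> R \<Longrightarrow> \<pi> * h \<noteq> 1"
  using ev_mult[OF param_R, of h] by auto

lemma factorization:
  assumes g: "g \<in> R" "g \<noteq> 0"
  shows "\<exists>e w. w \<in> R \<and> ev w \<noteq> 0 \<and> g = \<pi> ^ e * w"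
proof -
  obtain e h where e: "h \<in> R" "\<pi> ^ e = g * h" using param_power_multiple[OF g] by blast
  let ?Q = "\<lambda>n. \<not> (\<exists>h\<in>R. g = \<pi> ^ n * h)"
  have "?Q (Suc e)"
  proof
    assume "\<exists>h\<in>R. g = \<pi> ^ Suc e * h"
    then obtain h' where h': "h' \<in> R" "g = \<pi> ^ Suc e * h'" by blast
    have "\<pi> ^ e * (\<pi> * (h * h')) = \<pi> ^ e * 1" using e(2) h'(2) by (simp add: mult_ac)
    hence "\<pi> * (h * h') = 1" by simp
    thus False using ev_param_mult_neq_1[of "h * h'"] e(1) h'(1) by (simp add: R_mult)
  qed
  then obtain n where n: "?Q n" "\<And>m. m < n \<Longrightarrow> \<not> ?Q m" using exists_least_iff[of ?Q] by blast
  have "n \<noteq> 0" using n(1) g by (intro notI) auto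
  then obtain m where m: "n = Suc m" by (cases n) auto
  then obtain w where w: "w \<in> R" "g = \<pi> ^ m * w" using n(2)[of m] by auto
  have "ev w \<noteq> 0"
  proof
    assume "ev w = 0"
    then obtain h where "h \<in> R" "w = \<pi> * h" using param_dvd w by blast
    thus False using n(1) w(2) m by (auto simp: mult_ac)
  qed
  thus ?thesis using w by blast
qed

lemma unit_mult: "w \<in> R \<Longrightarrow> ev w \<noteq> 0 \<Longrightarrow> w' \<in> R \<Longrightarrow> ev w' \<noteq> 0 \<Longrightarrow> w * w' \<in> R \<and> ev (w * w') \<noteq> 0"
  by (simp add: R_mult ev_mult)

lemma unit_inverse: "w \<in> R \<Longrightarrow> ev w \<noteq> 0 \<Longrightarrow> inverse w \<in> R \<and> ev (inverse w) \<noteq> 0"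
  by (simp add: R_inverse ev_inverse)

lemma unit_power_int: "w \<in> R \<Longrightarrow> ev w \<noteq> 0 \<Longrightarrow> w powi k \<in> R \<and> ev (w powi k) \<noteq> 0"
  by (cases k rule: int_cases4) (auto simp: power_int_minus R_power ev_power intro!: unit_inverse R_inverse)

lemma factorization_unique:
  assumes "w \<in> R" "ev w \<noteq> 0" "w' \<in> R" "ev w' \<noteq> 0" "w * \<pi> powi k = w' * \<pi> powi k'"
  shows "k = k'"
proof -
  have *: False if "w \<in> R" "ev w \<noteq> 0" "w' \<in> R" "w * \<pi> powi k = w' * \<pi> powi k'" "k < k'" for w w' k k'
  proof -
    have "w * \<pi> powi k = w' * (\<pi> powi (k' - k)) * \<pi> powi k"
      using that(4) by (simp add: power_int_diff)
    hence "w = w' * (\<pi> powi (k' - k))" by simp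
    also obtain n where "k' - k = int (Suc n)"
      using \<open>k < k'\<close> zero_less_imp_eq_int[of "k' - k"] by (metis gr0_implies_Suc diff_gt_0_iff_gt)
    hence "\<pi> powi (k' - k) = \<pi> * \<pi> ^ n" by (simp only: power_int_of_nat power_Suc)
    finally have "ev w = 0" using that(3) by (simp add: ev_mult R_mult R_power)
    thus False using that(2) by simp
  qed
  show ?thesis using *[of w w' k k'] *[of w' w k' k] assms by (cases k k' rule: linorder_cases) auto
qed

text \<open>Two local parameters differ by a unit, so the exponent does not depend on the parameter.\<close>

lemma vl_eqI:
  assumes "w \<in> R" "ev w \<noteq> 0" "g = w * \<pi> powi k"
  shows "vl g = k"
  unfolding vl_def
proof (rule the_equality)
  show "\<exists>\<pi> w. parameter \<pi> \<and> w \<in> R - {g \<in> R. ev g = 0} \<and> g = w * \<pi> powi k"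
    using param assms by blast
next
  fix k' assume "\<exists>\<pi> w. parameter \<pi> \<and> w \<in> R - {g \<in> R. ev g = 0} \<and> g = w * \<pi> powi k'"
  then obtain \<pi>' w' where *: "parameter \<pi>'" "w' \<in> R" "ev w' \<noteq> 0" "g = w' * \<pi>' powi k'" by blast
  interpret other: place_param \<iota> R ev \<pi>' by unfold_locales (rule *)
  obtain x where x: "x \<in> R" "\<pi>' = \<pi> * x" using param_dvd[OF other.param_R other.ev_param] by blast
  obtain y where y: "y \<in> R" "\<pi> = \<pi>' * y" using other.param_dvd[OF param_R ev_param] by blast
  note xy = x y
  have "\<pi> * (x * y) = \<pi> * 1" using xy by (metis mult.assoc mult.right_neutral)
  hence "x * y = 1" by simp
  hence "ev x \<noteq> 0" using ev_mult[OF xy(1,3)] by auto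
  hence "x powi k' \<in> R \<and> ev (x powi k') \<noteq> 0" using unit_power_int xy(1) by blast
  moreover have "w * \<pi> powi k = (w' * x powi k') * \<pi> powi k'"
    using assms(3) *(4) xy(2) by (simp add: power_int_mult_distrib mult_ac)
  ultimately show "k' = k"
    using factorization_unique[OF assms(1,2), of "w' * x powi k'" k k'] unit_mult[of w' "x powi k'"] *(2,3)
    by auto
qed

lemma vl_factor:
  assumes "g \<noteq> 0" shows "\<exists>w. w \<in> R \<and> ev w \<noteq> 0 \<and> g = w * \<pi> powi (vl g)"
proof -
  obtain a b where ab: "a \<in> R" "b \<in> R" "b \<noteq> 0" "g = a / b" using R_fraction by blast
  obtain e w where w: "w \<in> R" "ev w \<noteq> 0" "a = \<pi> ^ e * w" using factorization[of a] ab assms by auto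
  obtain e' w' where w': "w' \<in> R" "ev w' \<noteq> 0" "b = \<pi> ^ e' * w'" using factorization[of b] ab by auto
  have u: "w * inverse w' \<in> R \<and> ev (w * inverse w') \<noteq> 0" using w w' unit_mult unit_inverse by blast
  have g: "g = (w * inverse w') * \<pi> powi (int e - int e')"
    using w w' ab by (simp add: power_int_diff field_simps)
  hence "vl g = int e - int e'" using vl_eqI u by blast
  thus ?thesis using u g by (intro exI[of _ "w * inverse w'"]) simp
qed

lemma vl_mult:
  assumes "g \<noteq> 0" "h \<noteq> 0" shows "vl (g * h) = vl g + vl h"
proof -
  obtain w where w: "w \<in> R" "ev w \<noteq> 0" "g = w * \<pi> powi (vl g)" using vl_factor assms(1) by blast
  obtain w' where w': "w' \<in> R" "ev w' \<noteq> 0" "h = w' * \<pi> powi (vl h)" using vl_factor assms(2) by blast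
  have "g * h = (w * \<pi> powi (vl g)) * (w' * \<pi> powi (vl h))" using w(3) w'(3) by simp
  also have "\<dots> = (w * w') * \<pi> powi (vl g + vl h)" by (simp add: power_int_add mult_ac)
  finally show ?thesis using vl_eqI unit_mult w(1,2) w'(1,2) by blast
qed

lemma vl_1: "vl 1 = 0"
  by (rule vl_eqI[of 1]) auto

lemma vl_power: "g \<noteq> 0 \<Longrightarrow> vl (g ^ n) = int n * vl g"
  by (induction n) (auto simp: vl_mult vl_1 algebra_simps)

lemma vl_inverse: "g \<noteq> 0 \<Longrightarrow> vl (inverse g) = - vl g"
  using vl_mult[of g "inverse g"] by (simp add: vl_1)

lemma vl_unit: "w \<in> R \<Longrightarrow> ev w \<noteq> 0 \<Longrightarrow> vl w = 0"
  by (rule vl_eqI[of w]) auto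

lemma vl_nonneg_iff:
  assumes "g \<noteq> 0" shows "vl g \<ge> 0 \<longleftrightarrow> g \<in> R"
proof
  assume "vl g \<ge> 0"
  then obtain n where n: "vl g = int n" by (rule nonneg_int_cases)
  obtain w where "w \<in> R" "ev w \<noteq> 0" "g = w * \<pi> powi (vl g)" using vl_factor[OF assms] by blast
  thus "g \<in> R" using n by (metis R_mult R_power param_R power_int_of_nat)
next
  assume "g \<in> R"
  then obtain e w where "w \<in> R" "ev w \<noteq> 0" "g = \<pi> ^ e * w" using factorization assms by blast
  hence "vl g = int e" by (intro vl_eqI[of w]) (auto simp: mult.commute)
  thus "vl g \<ge> 0" by simp
qed

end

context place_param
begin

text \<open>Iterating \<open>g \<mapsto> (g - g (P)) / \<pi>\<close> and evaluating at \<open>P\<close> gives the coefficients of the expansion of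
  \<open>g\<close> in powers of \<open>\<pi>\<close>.\<close>

definition shift :: "'f \<Rightarrow> 'f" where "shift g = (g - \<iota> (ev g)) / \<pi>"

definition expand :: "'f \<Rightarrow> 'k fps" where "expand g = Abs_fps (\<lambda>n. ev ((shift ^^ n) g))"

lemma shift_R: "g \<in> R \<Longrightarrow> shift g \<in> R"
  and shift_eq: "g = \<iota> (ev g) + \<pi> * shift g"
proof -
  show "g = \<iota> (ev g) + \<pi> * shift g" by (simp add: shift_def)
  assume g: "g \<in> R"
  then obtain h where "h \<in> R" "g - \<iota> (ev g) = \<pi> * h"
    using param_dvd[of "g - \<iota> (ev g)"] by (auto simp: R_diff R_const ev_diff ev_const)
  thus "shift g \<in> R" by (simp add: shift_def)
qed

lemma expand_nth_0: "expand g $ 0 = ev g"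
  by (simp add: expand_def)

lemma expand_nth_Suc: "expand g $ Suc n = expand (shift g) $ n"
  by (simp add: expand_def funpow_swap1)

lemma expand_eq: "expand g = fps_const (ev g) + fps_X * expand (shift g)"
proof (rule fps_ext)
  fix n show "expand g $ n = (fps_const (ev g) + fps_X * expand (shift g)) $ n"
    by (cases n) (simp_all add: expand_nth_0 expand_nth_Suc)
qed

lemma shift_add: "g \<in> R \<Longrightarrow> h \<in> R \<Longrightarrow> shift (g + h) = shift g + shift h"
  by (simp add: shift_def ev_add const.hom_add diff_divide_distrib[symmetric] add_divide_distrib[symmetric])

lemma shift_mult:
  assumes "g \<in> R" "h \<in> R" shows "shift (g * h) = shift g * h + \<iota> (ev g) * shift h"
proof -
  have "\<pi> * shift (g * h) = g * h - \<iota> (ev g) * \<iota> (ev h)"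
    using assms by (simp add: shift_def ev_mult const.hom_mult)
  also have "\<dots> = \<pi> * (shift g * h + \<iota> (ev g) * shift h)"
    by (simp add: shift_def field_simps)
  finally show ?thesis by simp
qed

lemma expand_add:
  assumes "g \<in> R" "h \<in> R" shows "expand (g + h) = expand g + expand h"
proof -
  have "expand (g + h) $ n = expand g $ n + expand h $ n" for n
    using assms by (induction n arbitrary: g h) (auto simp: expand_nth_0 expand_nth_Suc ev_add shift_add shift_R)
  thus ?thesis by (simp add: fps_eq_iff)
qed

lemma expand_0 [simp]: "expand 0 = 0"
  using expand_add[OF R_0 R_0] by (metis add.right_neutral add_left_cancel)

lemma expand_const: "expand (\<iota> c) = fps_const c"
proof -
  have "shift (\<iota> c) = 0" by (simp add: shift_def ev_const)
  thus ?thesis using expand_eq[of "\<iota> c"] by (simp add: ev_const)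
qed

lemma expand_1 [simp]: "expand 1 = 1"
  using expand_const[of 1] by simp

lemma expand_param: "expand \<pi> = fps_X"
  using expand_eq[of \<pi>] by (simp add: shift_def)

lemma expand_mult:
  assumes "g \<in> R" "h \<in> R" shows "expand (g * h) = expand g * expand h"
proof -
  have "expand (g * h) $ n = (expand g * expand h) $ n" for n
    using assms
  proof (induction n arbitrary: g h)
    case 0
    thus ?case by (simp add: expand_nth_0 ev_mult)
  next
    case (Suc n)
    have R: "shift g * h \<in> R" "\<iota> (ev g) * shift h \<in> R"
      using Suc.prems by (auto intro!: R_intros shift_R)
    have c: "expand (\<iota> c * x) $ n = c * expand x $ n" if "x \<in> R" for c x
      using Suc.IH[OF R_const that, of c] by (simp add: expand_const)
    have "expand (g * h) $ Suc n = expand (shift g * h) $ n + expand (\<iota> (ev g) * shift h) $ n"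
      using Suc.prems by (simp add: expand_nth_Suc shift_mult expand_add R)
    also have "\<dots> = (expand (shift g) * expand h) $ n + ev g * expand h $ Suc n"
      using Suc.IH Suc.prems by (simp add: shift_R c expand_nth_Suc)
    also have "\<dots> = (expand g * expand h) $ Suc n"
      by (subst (3) expand_eq) (simp add: distrib_right mult.assoc)
    finally show ?case .
  qed
  thus ?thesis by (simp add: fps_eq_iff)
qed

lemma expand_uminus: "g \<in> R \<Longrightarrow> expand (- g) = - expand g"
  using expand_add[of g "- g"] by (simp add: R_uminus add_eq_0_iff)

lemma expand_diff: "g \<in> R \<Longrightarrow> h \<in> R \<Longrightarrow> expand (g - h) = expand g - expand h"
  using expand_add[of g "- h"] by (simp add: R_uminus expand_uminus)

lemma expand_power: "g \<in> R \<Longrightarrow> expand (g ^ n) = expand g ^ n"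
  by (induction n) (auto simp: expand_mult R_power)

lemma expand_sum: "(\<And>i. i \<in> A \<Longrightarrow> g i \<in> R) \<Longrightarrow> expand (sum g A) = (\<Sum>i\<in>A. expand (g i))"
  by (induction A rule: infinite_finite_induct) (auto simp: expand_add R_sum)

lemma expand_prod: "(\<And>i. i \<in> A \<Longrightarrow> g i \<in> R) \<Longrightarrow> expand (prod g A) = (\<Prod>i\<in>A. expand (g i))"
  by (induction A rule: infinite_finite_induct) (auto simp: expand_mult R_prod)

lemma expand_of_nat: "expand (of_nat n) = of_nat n"
  by (induction n) (auto simp: expand_add R_of_nat)

lemma expand_factorization:
  assumes "w \<in> R" "g = \<pi> ^ e * w" shows "expand g = fps_X ^ e * expand w"
  using assms by (simp add: expand_mult R_power expand_power expand_param)

lemma subdegree_expand: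
  assumes "g \<in> R" "g \<noteq> 0" shows "expand g \<noteq> 0" "int (subdegree (expand g)) = vl g"
proof -
  obtain e w where w: "w \<in> R" "ev w \<noteq> 0" "g = \<pi> ^ e * w" using factorization assms by blast
  have ew: "expand w $ 0 \<noteq> 0" using w by (simp add: expand_nth_0)
  hence nz: "expand w \<noteq> 0" by auto
  show "expand g \<noteq> 0" using nz by (simp add: expand_factorization[OF w(1,3)])
  have "subdegree (expand g) = e"
    using nz ew by (simp add: expand_factorization[OF w(1,3)] subdegree_mult)
  moreover have "vl g = int e" by (rule vl_eqI[of w]) (use w in \<open>auto simp: mult.commute\<close>)
  ultimately show "int (subdegree (expand g)) = vl g" by simp
qed

lemma expand_inj: "g \<in> R \<Longrightarrow> h \<in> R \<Longrightarrow> expand g = expand h \<Longrightarrow> g = h"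
  using subdegree_expand(1)[of "g - h"] by (auto simp: R_diff expand_diff)

text \<open>The image of the local ring among the power series is closed under exact division, since a
  quotient of regular functions is regular once its order is not negative.\<close>

lemma expand_quotient:
  assumes "a \<in> R" "b \<in> R" "b \<noteq> 0" "expand b * s = expand a"
  shows "\<exists>h\<in>R. expand h = s"
proof (cases "a = 0")
  case True
  thus ?thesis using assms subdegree_expand(1)[of b] by (intro bexI[of _ 0]) auto
next
  case False
  have nz: "expand a \<noteq> 0" "expand b \<noteq> 0" using subdegree_expand(1) assms False by auto
  hence "s \<noteq> 0" using assms(4) by auto
  hence "subdegree (expand a) = subdegree (expand b) + subdegree s"
    using assms(4)[symmetric] nz by simp
  hence "vl a \<ge> vl b" using subdegree_expand(2) assms False by (metis of_nat_le_iff le_add1)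
  hence "vl (a * inverse b) \<ge> 0" using False assms(3) by (simp add: vl_mult vl_inverse)
  hence R: "a / b \<in> R" using vl_nonneg_iff[of "a / b"] False assms(3) by (simp add: divide_inverse)
  have "expand b * expand (a / b) = expand a" using expand_mult[OF assms(2) R] assms(3) by simp
  hence "expand (a / b) = s" using assms(4) nz(2) by (metis mult_left_cancel)
  thus ?thesis using R by blast
qed


section \<open>Separability over the field generated by a local parameter\<close>

definition relation :: "nat \<Rightarrow> (nat \<Rightarrow> nat \<Rightarrow> 'k) \<Rightarrow> 'f \<Rightarrow> 'f" where
  "relation N c y = (\<Sum>(i, j)\<in>{(i, j). i + j \<le> N}. \<iota> (c i j) * \<pi> ^ i * y ^ j)"

lemma sum_triangle_pred_fst:
  "(\<Sum>(i, j)\<in>{(i, j). i + j \<le> N}. of_nat i * f i j) =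
   (\<Sum>(i, j)\<in>{(i, j). i + j < N}. of_nat (Suc i) * (f (Suc i) j :: 'b::comm_ring_1))"
proof -
  have "(\<Sum>(i, j)\<in>{(i, j). i + j \<le> N}. of_nat i * f i j) =
      (\<Sum>(i, j)\<in>{(i, j). i + j \<le> N} \<inter> {(i, j). i > 0}. of_nat i * f i j)"
    by (rule sum.mono_neutral_right) (auto intro!: Nat.gr0I)
  also have "\<dots> = (\<Sum>(i, j)\<in>{(i, j). i + j < N}. of_nat (Suc i) * f (Suc i) j)"
    by (rule sum.reindex_bij_witness[of _ "\<lambda>(i, j). (Suc i, j)" "\<lambda>(i, j). (i - 1, j)"]) auto
  finally show ?thesis .
qed

lemma sum_triangle_pred_snd:
  "(\<Sum>(i, j)\<in>{(i, j). i + j \<le> N}. of_nat j * f i j) =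
   (\<Sum>(i, j)\<in>{(i, j). i + j < N}. of_nat (Suc j) * (f i (Suc j) :: 'b::comm_ring_1))"
proof -
  have "(\<Sum>(i, j)\<in>{(i, j). i + j \<le> N}. of_nat j * f i j) =
      (\<Sum>(i, j)\<in>{(i, j). i + j \<le> N} \<inter> {(i, j). j > 0}. of_nat j * f i j)"
    by (rule sum.mono_neutral_right) (auto intro!: Nat.gr0I)
  also have "\<dots> = (\<Sum>(i, j)\<in>{(i, j). i + j < N}. of_nat (Suc j) * f i (Suc j))"
    by (rule sum.reindex_bij_witness[of _ "\<lambda>(i, j). (i, Suc j)" "\<lambda>(i, j). (i, j - 1)"]) auto
  finally show ?thesis .
qed

lemma char_f: "CHAR('f) = CHAR('k)"
proof (rule CHAR_eqI)
  show "of_nat CHAR('k) = (0 :: 'f)" using const.hom_of_nat[of "CHAR('k)"] by simp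
next
  fix n assume "of_nat n = (0 :: 'f)"
  hence "\<iota> (of_nat n) = \<iota> 0" by (simp add: const.hom_of_nat)
  hence "of_nat n = (0 :: 'k)" using ev_const by metis
  thus "CHAR('k) dvd n" by (simp add: of_nat_eq_0_iff_char_dvd)
qed

text \<open>Take a relation \<open>F (\<pi>, y) = 0\<close> of least total degree. If the partial derivative with respect to
  \<open>y\<close> vanished at \<open>(\<pi>, y)\<close>, then differentiating the expansion would show that the one with respect to
  \<open>\<pi>\<close> vanishes as well. By minimality both partial derivatives are zero as polynomials, so that \<open>F\<close> is
  a polynomial in \<open>p\<close>-th powers. Its coefficients are \<open>p\<close>-th powers, too, so \<open>F\<close> is the \<open>p\<close>-th power
  of a relation of smaller degree.\<close>

lemma separable_relation:
  assumes y: "y \<in> R"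
  shows "\<exists>N c. relation N c y = 0 \<and>
    (\<Sum>(i, j)\<in>{(i, j). i + j \<le> N}. of_nat j * (\<iota> (c i j) * \<pi> ^ i * y ^ (j - 1))) \<noteq> 0"
proof -
  let ?T = "\<lambda>N. {(i, j). i + j \<le> (N::nat)}"
  let ?Q = "\<lambda>N. \<exists>c. (\<exists>i j. i + j \<le> N \<and> c i j \<noteq> 0) \<and> relation N c y = 0"
  have "\<exists>N. ?Q N" using dependent[of \<pi> y] unfolding alg_dependent_def relation_def by blast
  then obtain N where N: "?Q N" "\<And>M. M < N \<Longrightarrow> \<not> ?Q M" using exists_least_iff[of ?Q] by blast
  then obtain c where c: "\<exists>i j. i + j \<le> N \<and> c i j \<noteq> 0" "relation N c y = 0" by blast
  define Fy where "Fy = (\<Sum>(i, j)\<in>?T N. of_nat j * (\<iota> (c i j) * \<pi> ^ i * y ^ (j - 1)))"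
  define Fx where "Fx = (\<Sum>(i, j)\<in>?T N. of_nat i * (\<iota> (c i j) * \<pi> ^ (i - 1) * y ^ j))"
  have FR: "Fy \<in> R" "Fx \<in> R"
    unfolding Fx_def Fy_def using y by (auto intro!: R_intros)
  have "Fy \<noteq> 0"
  proof
    assume Fy0: "Fy = 0"
    let ?Y = "expand y"
    let ?t = "\<lambda>i j. fps_const (c i j) * fps_X ^ i * ?Y ^ j"
    have "0 = expand (relation N c y)" using c(2) by simp
    also have "\<dots> = (\<Sum>(i, j)\<in>?T N. ?t i j)"
      unfolding relation_def using y
      by (subst expand_sum) (auto simp: expand_mult expand_power expand_param expand_const
        R_mult R_power R_const case_prod_unfold intro!: sum.cong)
    finally have "0 = fps_deriv (\<Sum>(i, j)\<in>?T N. ?t i j)" by simp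
    also have "\<dots> = (\<Sum>(i, j)\<in>?T N. of_nat i * (fps_const (c i j) * fps_X ^ (i - 1) * ?Y ^ j) +
        of_nat j * (fps_const (c i j) * fps_X ^ i * ?Y ^ (j - 1)) * fps_deriv ?Y)"
      unfolding fps_deriv_sum
      by (intro sum.cong refl) (auto simp: fps_deriv_power fps_of_nat[symmetric] algebra_simps)
    also have "\<dots> = (\<Sum>(i, j)\<in>?T N. of_nat i * (fps_const (c i j) * fps_X ^ (i - 1) * ?Y ^ j)) +
        (\<Sum>(i, j)\<in>?T N. of_nat j * (fps_const (c i j) * fps_X ^ i * ?Y ^ (j - 1))) * fps_deriv ?Y"
      by (simp add: sum.distrib case_prod_unfold sum_distrib_right)
    also have "(\<Sum>(i, j)\<in>?T N. of_nat i * (fps_const (c i j) * fps_X ^ (i - 1) * ?Y ^ j)) = expand Fx"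
      unfolding Fx_def using y
      by (subst expand_sum) (auto simp: expand_mult expand_power expand_param expand_const expand_of_nat
        R_mult R_power R_const R_of_nat case_prod_unfold intro!: sum.cong)
    also have "(\<Sum>(i, j)\<in>?T N. of_nat j * (fps_const (c i j) * fps_X ^ i * ?Y ^ (j - 1))) = expand Fy"
      unfolding Fy_def using y
      by (subst expand_sum) (auto simp: expand_mult expand_power expand_param expand_const expand_of_nat
        R_mult R_power R_const R_of_nat case_prod_unfold intro!: sum.cong)
    finally have "expand Fx = 0" using Fy0 by simp
    hence Fx0: "Fx = 0" using subdegree_expand(1) FR by blast
    have N0: "N > 0"
    proof (rule ccontr)
      assume "\<not> N > 0"
      hence "{(i, j). i + j \<le> N} = {(0, 0)}" by auto
      thus False using c \<open>\<not> N > 0\<close> const.hom_0_iff by (auto simp: relation_def)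
    qed
    hence TN: "{(i, j). i + j < N} = ?T (N - 1)" by auto
    have minimal: "c' i j = 0" if "relation (N - 1) c' y = 0" "i + j < N" for c' i j
      using N(2)[of "N - 1"] N0 that by force
    have rx: "relation (N - 1) (\<lambda>i j. of_nat (Suc i) * c (Suc i) j) y = Fx"
      unfolding Fx_def relation_def sum_triangle_pred_fst TN
      by (intro sum.cong) (auto simp: const.hom_mult const.hom_add const.hom_of_nat mult_ac)
    have ci: "of_nat i * c i j = 0" if "i + j \<le> N" for i j
      using that minimal[OF rx[unfolded Fx0], of "i - 1" j] by (cases i) auto
    have ry: "relation (N - 1) (\<lambda>i j. of_nat (Suc j) * c i (Suc j)) y = Fy"
      unfolding Fy_def relation_def sum_triangle_pred_snd TN
      by (intro sum.cong) (auto simp: const.hom_mult const.hom_add const.hom_of_nat mult_ac)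
    have cj: "of_nat j * c i j = 0" if "i + j \<le> N" for i j
      using that minimal[OF ry[unfolded Fy0], of i "j - 1"] by (cases j) auto
    define p where "p = CHAR('k)"
    have p: "prime p" "p > 1" using prime_char prime_gt_1_nat by (auto simp: p_def)
    have dvd: "p dvd i" "p dvd j" if "i + j \<le> N" "c i j \<noteq> 0" for i j
      using ci[OF that(1)] cj[OF that(1)] that(2) by (auto simp: p_def of_nat_eq_0_iff_char_dvd)
    define b where "b i j = (SOME b. b ^ p = c (p * i) (p * j))" for i j
    have b: "b i j ^ p = c (p * i) (p * j)" for i j
      unfolding b_def by (rule someI_ex) (use perfect in \<open>simp add: p_def\<close>)
    have "relation (N div p) b y ^ p =
        (\<Sum>(i, j)\<in>?T (N div p). (\<iota> (b i j) * \<pi> ^ i * y ^ j) ^ p)"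
      unfolding relation_def case_prod_unfold
      by (rule freshmans_dream_sum) (use p char_f in \<open>auto simp: p_def\<close>)
    also have "\<dots> = (\<Sum>(i, j)\<in>?T (N div p). \<iota> (c (p * i) (p * j)) * \<pi> ^ (p * i) * y ^ (p * j))"
      by (intro sum.cong refl)
         (auto simp: power_mult_distrib power_mult[symmetric] const.hom_power[symmetric] b mult.commute)
    also have "\<dots> = (\<Sum>(i, j)\<in>(\<lambda>(i, j). (p * i, p * j)) ` ?T (N div p). \<iota> (c i j) * \<pi> ^ i * y ^ j)"
      using p by (subst sum.reindex) (auto simp: inj_on_def case_prod_unfold)
    also have "\<dots> = relation N c y"
      unfolding relation_def
    proof (rule sum.mono_neutral_left)
      show "(\<lambda>(i, j). (p * i, p * j)) ` ?T (N div p) \<subseteq> ?T N"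
        using p by (auto simp: less_eq_div_iff_mult_less_eq algebra_simps)
      show "\<forall>x\<in>?T N - (\<lambda>(i, j). (p * i, p * j)) ` ?T (N div p).
          (case x of (i, j) \<Rightarrow> \<iota> (c i j) * \<pi> ^ i * y ^ j) = 0"
      proof (clarify, rule ccontr)
        fix i j assume *: "i + j \<le> N" "(i, j) \<notin> (\<lambda>(i, j). (p * i, p * j)) ` ?T (N div p)"
          "\<iota> (c i j) * \<pi> ^ i * y ^ j \<noteq> 0"
        hence "c i j \<noteq> 0" by auto
        then obtain i' j' where ij: "i = p * i'" "j = p * j'" using dvd[OF *(1)] by (auto elim!: dvdE)
        hence "i' + j' \<le> N div p"
          using *(1) p by (auto simp: less_eq_div_iff_mult_less_eq algebra_simps)
        thus False using *(2) ij by auto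
      qed
    qed auto
    finally have "relation (N div p) b y = 0" using c(2) p by simp
    moreover have "\<exists>i j. i + j \<le> N div p \<and> b i j \<noteq> 0"
    proof -
      obtain i j where ij: "i + j \<le> N" "c i j \<noteq> 0" using c(1) by blast
      then obtain i' j' where ij': "i = p * i'" "j = p * j'" using dvd[OF ij] by (auto elim!: dvdE)
      hence "i' + j' \<le> N div p"
        using ij p by (auto simp: less_eq_div_iff_mult_less_eq algebra_simps)
      moreover have "b i' j' \<noteq> 0"
      proof
        assume "b i' j' = 0"
        hence "c (p * i') (p * j') = 0" using p b[of i' j', symmetric] by (simp add: power_0_left)
        thus False using ij ij' by simp
      qed
      ultimately show ?thesis by blast
    qed
    moreover have "N div p < N" using p N0 by simp
    ultimately show False using N(2) by blast
  qed
  thus ?thesis using c(2) unfolding Fy_def by blast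
qed

lemma separable_equation:
  assumes y: "y \<in> R"
  obtains d M a where "(\<Sum>j\<le>d. (\<Sum>i\<le>M j. \<iota> (a i j) * \<pi> ^ i) * y ^ j) = 0"
    "(\<Sum>j\<le>d. of_nat j * (\<Sum>i\<le>M j. \<iota> (a i j) * \<pi> ^ i) * y ^ (j - 1)) \<noteq> 0"
proof -
  obtain N c where c: "relation N c y = 0"
    "(\<Sum>(i, j)\<in>{(i, j). i + j \<le> N}. of_nat j * (\<iota> (c i j) * \<pi> ^ i * y ^ (j - 1))) \<noteq> 0"
    using separable_relation[OF y] by blast
  show thesis
  proof (rule that[where d = N and M = "\<lambda>j. N - j" and a = c])
    show "(\<Sum>j\<le>N. (\<Sum>i\<le>N - j. \<iota> (c i j) * \<pi> ^ i) * y ^ j) = 0"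
      using c(1) by (simp add: relation_def sum_triangle sum_distrib_right)
    show "(\<Sum>j\<le>N. of_nat j * (\<Sum>i\<le>N - j. \<iota> (c i j) * \<pi> ^ i) * y ^ (j - 1)) \<noteq> 0"
      using c(2) by (simp add: sum_triangle sum_distrib_right sum_distrib_left mult.assoc)
  qed
qed

end

section \<open>Hasse derivatives as Taylor expansions\<close>

text \<open>The product rule, linearity and the values on powers of \<open>t\<close> together say that
  \<open>g \<mapsto> \<Sum> D\<^sub>r g T ^ r\<close> is a homomorphism over the constants sending \<open>t\<close> to \<open>t + T\<close>.\<close>

definition taylor_hom :: "('k::field \<Rightarrow> 'f::field) \<Rightarrow> 'f \<Rightarrow> ('f \<Rightarrow> 'f fps) \<Rightarrow> bool" where
  "taylor_hom \<iota> t \<sigma> \<longleftrightarrow> (\<forall>g h. \<sigma> (g + h) = \<sigma> g + \<sigma> h) \<and> (\<forall>g h. \<sigma> (g * h) = \<sigma> g * \<sigma> h) \<and>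
     (\<forall>c. \<sigma> (\<iota> c) = fps_const (\<iota> c)) \<and> (\<forall>g. \<sigma> g $ 0 = g) \<and> \<sigma> t = fps_const t + fps_X"

text \<open>The whole field is obtained from the constants and \<open>t\<close> by field operations and by adjoining roots of
  separable equations. In this form, a property that is preserved by these steps holds everywhere.\<close>

definition separable_variable :: "('k::field \<Rightarrow> 'f::field) \<Rightarrow> 'f \<Rightarrow> bool" where
  "separable_variable \<iota> t \<longleftrightarrow> (\<forall>A. range \<iota> \<subseteq> A \<longrightarrow> t \<in> A \<longrightarrow>
     (\<forall>g\<in>A. \<forall>h\<in>A. g + h \<in> A \<and> g * h \<in> A) \<longrightarrow> (\<forall>g\<in>A. inverse g \<in> A) \<longrightarrow>
     (\<forall>d b y. (\<forall>j\<le>d. b j \<in> A) \<longrightarrow> (\<Sum>j\<le>d. b j * y ^ j) = 0 \<longrightarrow>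
        (\<Sum>j\<le>d. of_nat j * b j * y ^ (j - 1)) \<noteq> 0 \<longrightarrow> y \<in> A) \<longrightarrow> A = (UNIV :: 'f set))"

context
  fixes \<iota> :: "'k::field \<Rightarrow> 'f::field" and t :: 'f and \<sigma> :: "'f \<Rightarrow> 'f fps"
  assumes const: "field_hom \<iota>" and \<sigma>: "taylor_hom \<iota> t \<sigma>"
begin

interpretation const: field_hom \<iota> by (fact const)

lemma taylor_add: "\<sigma> (g + h) = \<sigma> g + \<sigma> h" and taylor_mult: "\<sigma> (g * h) = \<sigma> g * \<sigma> h"
  and taylor_const: "\<sigma> (\<iota> c) = fps_const (\<iota> c)" and taylor_nth_0: "\<sigma> g $ 0 = g"
  and taylor_var: "\<sigma> t = fps_const t + fps_X"
  using \<sigma> by (simp_all add: taylor_hom_def)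

lemma taylor_0: "\<sigma> 0 = 0" and taylor_1: "\<sigma> 1 = 1"
  using taylor_const[of 0] taylor_const[of 1] by auto

lemma taylor_sum: "\<sigma> (sum f A) = (\<Sum>a\<in>A. \<sigma> (f a))"
  by (induction A rule: infinite_finite_induct) (auto simp: taylor_0 taylor_add)

lemma taylor_power: "\<sigma> (g ^ n) = \<sigma> g ^ n"
  by (induction n) (auto simp: taylor_1 taylor_mult)

lemma taylor_inverse: "\<sigma> (inverse g) = inverse (\<sigma> g)"
proof (cases "g = 0")
  case False
  have "\<sigma> g * \<sigma> (inverse g) = 1" using False by (simp flip: taylor_mult add: taylor_1)
  moreover have "\<sigma> g * inverse (\<sigma> g) = 1"
    using False inverse_mult_eq_1'[of "\<sigma> g"] by (simp add: taylor_nth_0)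
  moreover have "\<sigma> g \<noteq> 0" using False taylor_nth_0[of g] by auto
  ultimately show ?thesis by (metis mult_left_cancel)
qed (simp add: taylor_0)

lemma hasse_derivatives_taylor: "hasse_derivatives \<iota> t (\<lambda>r g. \<sigma> g $ r)"
  unfolding hasse_derivatives_def
proof (intro conjI allI)
  show "(\<lambda>g. \<sigma> g $ 0) = id" by (auto simp: taylor_nth_0)
  show "\<sigma> (g + h) $ r = \<sigma> g $ r + \<sigma> h $ r" for r g h by (simp add: taylor_add)
  show "\<sigma> (\<iota> c * g) $ r = \<iota> c * \<sigma> g $ r" for r c g by (simp add: taylor_mult taylor_const)
  show "\<sigma> (g * h) $ r = (\<Sum>s\<le>r. \<sigma> g $ s * \<sigma> h $ (r - s))" for r g h
    by (simp add: taylor_mult fps_mult_nth atLeast0AtMost)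
  fix r s
  have "\<sigma> (t ^ s) = (\<Sum>k\<le>s. fps_const (of_nat (s choose k) * t ^ (s - k)) * fps_X ^ k)"
    unfolding taylor_power taylor_var add.commute[of "fps_const t"] binomial_ring
    by (simp add: fps_const_power fps_of_nat[symmetric] mult_ac flip: fps_const_mult)
  hence "\<sigma> (t ^ s) $ r = (\<Sum>k\<le>s. if k = r then of_nat (s choose k) * t ^ (s - k) else 0)"
    by (simp add: fps_sum_nth fps_X_power_nth if_distrib cong: if_cong) 
  thus "\<sigma> (t ^ s) $ r = of_nat (s choose r) * t ^ (s - r)"
    by (simp add: binomial_eq_0)
qed

end

lemma taylor_hom_hasse:
  assumes const: "field_hom \<iota>" and D: "hasse_derivatives \<iota> t D"
  shows "taylor_hom \<iota> t (\<lambda>g. Abs_fps (\<lambda>r. D r g))"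
proof -
  interpret const: field_hom \<iota> by fact
  have D0: "D 0 = id" and add: "D r (g + h) = D r g + D r h" and lin: "D r (\<iota> c * g) = \<iota> c * D r g"
    and mult: "D r (g * h) = (\<Sum>s\<le>r. D s g * D (r - s) h)"
    and var: "D r (t ^ s) = of_nat (s choose r) * t ^ (s - r)" for r c s g h
    using D unfolding hasse_derivatives_def by auto
  have c: "D r (\<iota> c) = (if r = 0 then \<iota> c else 0)" for r c
    using lin[of r c 1] var[of r 0] by (cases r) auto
  have v: "D r t = (if r = 0 then t else if r = 1 then 1 else 0)" for r
    using var[of r 1] by (cases r) (auto simp: binomial_eq_0)
  show ?thesis unfolding taylor_hom_def
  proof (intro conjI allI)
    show "Abs_fps (\<lambda>r. D r t) = fps_const t + fps_X"
      by (rule fps_ext) (simp add: v fps_X_def)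
  qed (simp_all add: fps_eq_iff add mult c D0 fps_mult_nth atLeast0AtMost)
qed

lemma taylor_hom_agree_separable:
  assumes const: "field_hom \<iota>" and \<sigma>: "taylor_hom \<iota> t \<sigma>" and \<sigma>': "taylor_hom \<iota> t \<sigma>'"
    and b: "\<And>j. j \<le> d \<Longrightarrow> \<sigma> (b j) = \<sigma>' (b j)" and eq: "(\<Sum>j\<le>d. b j * y ^ j) = 0"
    and sep: "(\<Sum>j\<le>d. of_nat j * b j * y ^ (j - 1)) \<noteq> 0"
  shows "\<sigma> y = \<sigma>' y"
proof (rule fps_ext)
  note [simp] = taylor_nth_0[OF const \<sigma>] taylor_nth_0[OF const \<sigma>']
  have e: "(\<Sum>j\<le>d. \<sigma> (b j) * \<sigma> y ^ j) = 0" "(\<Sum>j\<le>d. \<sigma> (b j) * \<sigma>' y ^ j) = 0"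
    using arg_cong[OF eq, of \<sigma>] arg_cong[OF eq, of \<sigma>'] b
    by (simp_all add: taylor_sum[OF const \<sigma>] taylor_mult[OF const \<sigma>] taylor_power[OF const \<sigma>] taylor_0[OF const \<sigma>]
        taylor_sum[OF const \<sigma>'] taylor_mult[OF const \<sigma>'] taylor_power[OF const \<sigma>'] taylor_0[OF const \<sigma>'])
  fix r show "\<sigma> y $ r = \<sigma>' y $ r"
  proof (induction r rule: less_induct)
    case (less r)
    show ?case
    proof (cases "r = 0")
      case False
      have "0 = (\<Sum>j\<le>d. of_nat j * \<sigma> (b j) $ 0 * (\<sigma> y $ 0) ^ (j - 1)) * (\<sigma> y $ r - \<sigma>' y $ r)"
        using fps_separable_nth_diff[of r "\<sigma> y" "\<sigma>' y" "\<lambda>j. \<sigma> (b j)" d] False less by (simp add: e)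
      thus ?thesis using sep by simp
    qed simp
  qed
qed

lemma taylor_hom_unique:
  assumes const: "field_hom \<iota>" and t: "separable_variable \<iota> t"
    and \<sigma>: "taylor_hom \<iota> t \<sigma>" and \<sigma>': "taylor_hom \<iota> t \<sigma>'"
  shows "\<sigma> = \<sigma>'"
proof -
  let ?A = "{g. \<sigma> g = \<sigma>' g}"
  have "?A = UNIV"
    by (rule t[unfolded separable_variable_def, rule_format])
       (auto simp: taylor_add[OF const \<sigma>] taylor_add[OF const \<sigma>'] taylor_mult[OF const \<sigma>]
         taylor_mult[OF const \<sigma>'] taylor_const[OF const \<sigma>] taylor_const[OF const \<sigma>']
         taylor_var[OF const \<sigma>] taylor_var[OF const \<sigma>'] taylor_inverse[OF const \<sigma>]
         taylor_inverse[OF const \<sigma>'] simp del: One_nat_def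
         intro: taylor_hom_agree_separable[OF const \<sigma> \<sigma>'])
  thus ?thesis by auto
qed

lemma hasse_eq_taylor:
  assumes const: "field_hom \<iota>" and t: "separable_variable \<iota> t" and \<sigma>: "taylor_hom \<iota> t \<sigma>"
  shows "hasse \<iota> t = (\<lambda>r g. \<sigma> g $ r)"
  unfolding hasse_def
proof (rule the_equality)
  show "hasse_derivatives \<iota> t (\<lambda>r g. \<sigma> g $ r)" by (rule hasse_derivatives_taylor[OF const \<sigma>])
next
  fix D assume "hasse_derivatives \<iota> t D"
  from taylor_hom_unique[OF const t \<sigma> taylor_hom_hasse[OF const this]]
  show "D = (\<lambda>r g. \<sigma> g $ r)" by (auto simp: fun_eq_iff)
qed


section \<open>Hasse derivatives with respect to a local parameter\<close>

context place_param
begin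

lemma field_hom_const: "field_hom \<iota>" ..

text \<open>Regular functions satisfy separable equations over the polynomials in \<open>\<pi>\<close>, and all others are
  quotients of regular ones.\<close>

lemma separable_param: "separable_variable \<iota> \<pi>"
  unfolding separable_variable_def
proof (intro allI impI)
  fix A assume A: "range \<iota> \<subseteq> A" "\<pi> \<in> A" "\<forall>g\<in>A. \<forall>h\<in>A. g + h \<in> A \<and> g * h \<in> A"
    "\<forall>g\<in>A. inverse g \<in> A"
    and sep: "\<forall>d b y. (\<forall>j\<le>d. b j \<in> A) \<longrightarrow> (\<Sum>j\<le>d. b j * y ^ j) = 0 \<longrightarrow>
        (\<Sum>j\<le>d. of_nat j * b j * y ^ (j - 1)) \<noteq> 0 \<longrightarrow> y \<in> A"
  have 01: "0 \<in> A" "1 \<in> A" using A(1) const.hom_zero const.hom_one by (metis rangeI subsetD)+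
  have sum: "(\<And>i. i \<in> I \<Longrightarrow> f i \<in> A) \<Longrightarrow> sum f I \<in> A" for f and I :: "nat set"
    by (induction I rule: infinite_finite_induct) (use A(3) 01 in auto)
  have power: "\<pi> ^ n \<in> A" for n by (induction n) (use A(2,3) 01 in auto)
  have poly: "(\<Sum>i\<le>M. \<iota> (a i) * \<pi> ^ i) \<in> A" for M a
    by (rule sum) (use A(1,3) power in blast)
  have RA: "y \<in> A" if yR: "y \<in> R" for y
  proof -
    obtain d M a where *: "(\<Sum>j\<le>d. (\<Sum>i\<le>M j. \<iota> (a i j) * \<pi> ^ i) * y ^ j) = 0"
      "(\<Sum>j\<le>d. of_nat j * (\<Sum>i\<le>M j. \<iota> (a i j) * \<pi> ^ i) * y ^ (j - 1)) \<noteq> 0"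
      by (rule separable_equation[OF yR])
    show ?thesis
      by (rule sep[rule_format, OF _ *]) (rule poly)
  qed
  have "g \<in> A" for g
  proof -
    obtain a b where "a \<in> R" "b \<in> R" "g = a * inverse b"
      using R_fraction[of g] by (auto simp: divide_inverse)
    thus ?thesis using RA A(3,4) by blast
  qed
  thus "A = UNIV" by blast
qed

text \<open>The equation of \<open>y\<close> expresses the \<open>r\<close>-th derivative of its expansion through the lower ones,
  dividing by an element of the ring. So it is the expansion of a quotient, and this quotient is
  regular since its expansion is a power series.\<close>

lemma fps_hasse_expand:
  assumes y: "y \<in> R" shows "\<exists>h\<in>R. expand h = fps_hasse r (expand y)"
proof -
  define E where "E = expand ` R"
  have E: "x \<in> E \<Longrightarrow> x' \<in> E \<Longrightarrow> x + x' \<in> E" "x \<in> E \<Longrightarrow> x' \<in> E \<Longrightarrow> x * x' \<in> E" "0 \<in> E" "1 \<in> E"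
    "fps_const c \<in> E" "fps_X \<in> E" for x x' c
    unfolding E_def
    using R_add R_mult R_const expand_add expand_mult expand_const expand_param
    by (auto simp: image_iff) (metis R_0 R_1 param_R expand_0 expand_1)+
  have E_sum: "(\<And>i. i \<in> I \<Longrightarrow> f i \<in> E) \<Longrightarrow> sum f I \<in> E" for f and I :: "nat set"
    by (induction I rule: infinite_finite_induct) (auto simp: E)
  define EE where "EE = {A. \<forall>n. A $ n \<in> E}"
  have EE: "A \<in> EE \<Longrightarrow> B \<in> EE \<Longrightarrow> A + B \<in> EE" "A \<in> EE \<Longrightarrow> B \<in> EE \<Longrightarrow> A * B \<in> EE" "0 \<in> EE" "1 \<in> EE"
    "x \<in> E \<Longrightarrow> fps_const x \<in> EE" "fps_X \<in> EE" for A B x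
    by (auto simp: EE_def fps_mult_nth fps_X_def intro!: E E_sum)
  have EE_sum: "(\<And>i. i \<in> I \<Longrightarrow> f i \<in> EE) \<Longrightarrow> sum f I \<in> EE" for f and I :: "nat set"
    by (induction I rule: infinite_finite_induct) (auto simp: EE)
  have EE_power: "A \<in> EE \<Longrightarrow> A ^ n \<in> EE" for A n by (induction n) (auto simp: EE)
  obtain d M a where *: "(\<Sum>j\<le>d. (\<Sum>i\<le>M j. \<iota> (a i j) * \<pi> ^ i) * y ^ j) = 0"
    "(\<Sum>j\<le>d. of_nat j * (\<Sum>i\<le>M j. \<iota> (a i j) * \<pi> ^ i) * y ^ (j - 1)) \<noteq> 0"
    by (rule separable_equation[OF y])
  define b where "b j = (\<Sum>i\<le>M j. \<iota> (a i j) * \<pi> ^ i)" for j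
  define Fy where "Fy = (\<Sum>j\<le>d. of_nat j * b j * y ^ (j - 1))"
  have bR: "b j \<in> R" for j unfolding b_def by (intro R_intros) auto
  have FyR: "Fy \<in> R" "Fy \<noteq> 0" unfolding Fy_def using bR y *(2) by (auto intro!: R_intros simp: b_def)
  have bE: "fps_taylor (expand (b j)) \<in> EE" for j
  proof -
    have "expand (b j) = (\<Sum>i\<le>M j. fps_const (a i j) * fps_X ^ i)"
      unfolding b_def by (subst expand_sum) (auto intro!: R_intros simp: expand_mult R_const R_power
          expand_const expand_power expand_param)
    thus ?thesis
      by (auto simp: fps_taylor_sum fps_taylor_mult fps_taylor_const fps_taylor_power fps_taylor_X
          intro!: EE_sum EE EE_power E)
  qed
  let ?\<tau> = "\<lambda>j. fps_taylor (expand (b j))" and ?Z = "fps_taylor (expand y)"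
  have "(\<Sum>j\<le>d. expand (b j) * expand y ^ j) = expand (\<Sum>j\<le>d. b j * y ^ j)"
    by (subst expand_sum) (use bR y in \<open>auto intro!: R_intros simp: expand_mult R_power expand_power\<close>)
  also have "\<dots> = 0" using *(1) by (simp add: b_def)
  finally have "fps_taylor (\<Sum>j\<le>d. expand (b j) * expand y ^ j) = 0"
    using fps_taylor_const[of "0 :: 'k"] by simp
  hence Z: "(\<Sum>j\<le>d. ?\<tau> j * ?Z ^ j) = 0"
    by (simp only: fps_taylor_sum fps_taylor_mult fps_taylor_power)
  show ?thesis
  proof (induction r rule: less_induct)
    case (less r)
    show ?case
    proof (cases "r = 0")
      case True
      thus ?thesis using y by auto
    next
      case False
      define Z' where "Z' = Abs_fps (\<lambda>s. if s < r then ?Z $ s else 0)"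
      have "Z' \<in> EE"
        using less by (auto simp: EE_def Z'_def fps_taylor_nth E E_def image_iff) (metis E(3) E_def image_iff)+
      hence "(\<Sum>j\<le>d. ?\<tau> j * Z' ^ j) \<in> EE" by (intro EE_sum EE EE_power bE)
      then obtain h where h: "h \<in> R" "(\<Sum>j\<le>d. ?\<tau> j * Z' ^ j) $ r = expand h"
        by (auto simp: EE_def E_def)
      have "(\<Sum>j\<le>d. ?\<tau> j * ?Z ^ j) $ r - (\<Sum>j\<le>d. ?\<tau> j * Z' ^ j) $ r =
          (\<Sum>j\<le>d. of_nat j * ?\<tau> j $ 0 * (?Z $ 0) ^ (j - 1)) * (?Z $ r - Z' $ r)"
        by (rule fps_separable_nth_diff) (use False in \<open>auto simp: Z'_def\<close>)
      also have "(\<Sum>j\<le>d. of_nat j * ?\<tau> j $ 0 * (?Z $ 0) ^ (j - 1)) = expand Fy"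
        unfolding Fy_def by (subst expand_sum) (use bR y in \<open>auto intro!: R_intros simp: expand_mult R_power
          R_mult R_of_nat expand_of_nat expand_power fps_taylor_nth\<close>)
      finally have "expand Fy * fps_hasse r (expand y) = expand (- h)"
        using h by (simp add: Z Z'_def fps_taylor_nth expand_uminus)
      thus ?thesis using expand_quotient[of "- h" Fy] FyR h(1) by (simp add: R_uminus)
    qed
  qed
qed

definition hasse_R :: "nat \<Rightarrow> 'f \<Rightarrow> 'f" where
  "hasse_R r g = (SOME h. h \<in> R \<and> expand h = fps_hasse r (expand g))"

lemma hasse_R: "g \<in> R \<Longrightarrow> hasse_R r g \<in> R" "g \<in> R \<Longrightarrow> expand (hasse_R r g) = fps_hasse r (expand g)"
proof -
  have "g \<in> R \<Longrightarrow> hasse_R r g \<in> R \<and> expand (hasse_R r g) = fps_hasse r (expand g)"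
    unfolding hasse_R_def by (rule someI_ex) (use fps_hasse_expand[of g r] in blast)
  thus "g \<in> R \<Longrightarrow> hasse_R r g \<in> R" "g \<in> R \<Longrightarrow> expand (hasse_R r g) = fps_hasse r (expand g)" by auto
qed

definition taylor_R :: "'f \<Rightarrow> 'f fps" where
  "taylor_R g = Abs_fps (\<lambda>r. hasse_R r g)"

lemma taylor_R_eqI:
  assumes "g \<in> R" "\<And>n. F $ n \<in> R" "\<And>n. expand (F $ n) = fps_taylor (expand g) $ n"
  shows "taylor_R g = F"
  using assms expand_inj hasse_R by (auto simp: taylor_R_def fps_eq_iff fps_taylor_nth)

lemma expand_taylor_R:
  "g \<in> R \<Longrightarrow> taylor_R g $ r \<in> R" "g \<in> R \<Longrightarrow> expand (taylor_R g $ r) = fps_taylor (expand g) $ r"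
  by (auto simp: taylor_R_def hasse_R fps_taylor_nth)

lemma taylor_R_add: "g \<in> R \<Longrightarrow> h \<in> R \<Longrightarrow> taylor_R (g + h) = taylor_R g + taylor_R h"
  by (rule taylor_R_eqI) (auto simp: R_add expand_taylor_R expand_add fps_taylor_add)

lemma taylor_R_mult: "g \<in> R \<Longrightarrow> h \<in> R \<Longrightarrow> taylor_R (g * h) = taylor_R g * taylor_R h"
  by (rule taylor_R_eqI)
     (auto simp: R_mult expand_taylor_R expand_mult fps_taylor_mult fps_mult_nth expand_sum
        intro!: R_intros sum.cong)

lemma taylor_R_const: "taylor_R (\<iota> c) = fps_const (\<iota> c)"
  by (rule taylor_R_eqI) (auto simp: R_const expand_const fps_taylor_const)

lemma taylor_R_param: "taylor_R \<pi> = fps_const \<pi> + fps_X"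
  by (rule taylor_R_eqI) (auto simp: expand_param fps_taylor_X)

lemma taylor_R_nth_0: "g \<in> R \<Longrightarrow> taylor_R g $ 0 = g"
  by (rule expand_inj) (auto simp: expand_taylor_R fps_taylor_nth)

text \<open>The extension of \<open>taylor_R\<close> to quotients: it is possible because a power series over a field is
  invertible as soon as its constant term, here the denominator itself, is not zero.\<close>

definition taylor :: "'f \<Rightarrow> 'f fps" where
  "taylor g = (SOME F. \<exists>a b. a \<in> R \<and> b \<in> R \<and> b \<noteq> 0 \<and> g = a / b \<and> F = taylor_R a * inverse (taylor_R b))"

lemma taylor_R_unit: "b \<in> R \<Longrightarrow> b \<noteq> 0 \<Longrightarrow> taylor_R b * inverse (taylor_R b) = 1"
  using inverse_mult_eq_1'[of "taylor_R b"] by (simp add: taylor_R_nth_0)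

lemma taylor_fraction:
  assumes "a \<in> R" "b \<in> R" "b \<noteq> 0"
  shows "taylor (a / b) = taylor_R a * inverse (taylor_R b)"
proof -
  have "\<exists>F a' b'. a' \<in> R \<and> b' \<in> R \<and> b' \<noteq> 0 \<and> a / b = a' / b' \<and> F = taylor_R a' * inverse (taylor_R b')"
    using assms by blast
  from someI_ex[OF this] obtain a' b' where *: "a' \<in> R" "b' \<in> R" "b' \<noteq> 0" "a / b = a' / b'"
    "taylor (a / b) = taylor_R a' * inverse (taylor_R b')" unfolding taylor_def by blast
  have "a * b' = a' * b" using *(3,4) assms(3) by (simp add: field_simps)
  hence eq: "taylor_R a * taylor_R b' = taylor_R a' * taylor_R b"
    using * assms by (metis taylor_R_mult)
  have "taylor_R a * inverse (taylor_R b) = taylor_R a * (taylor_R b' * inverse (taylor_R b')) * inverse (taylor_R b)"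
    using taylor_R_unit[OF *(2,3)] by simp
  also have "\<dots> = (taylor_R a * taylor_R b') * (inverse (taylor_R b') * inverse (taylor_R b))" by (simp add: mult_ac)
  also have "\<dots> = taylor_R a' * inverse (taylor_R b') * (taylor_R b * inverse (taylor_R b))"
    unfolding eq by (simp add: mult_ac)
  also have "\<dots> = taylor (a / b)" using taylor_R_unit[OF assms(2,3)] *(5) by simp
  finally show ?thesis ..
qed

lemma taylor_on_R: "g \<in> R \<Longrightarrow> taylor g = taylor_R g"
  using taylor_fraction[of g 1] taylor_R_const[of 1] by simp

lemma taylor_hom_param: "taylor_hom \<iota> \<pi> taylor"
  unfolding taylor_hom_def
proof (intro conjI allI)
  fix g h
  obtain a b where ab: "a \<in> R" "b \<in> R" "b \<noteq> 0" "g = a / b" using R_fraction by blast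
  obtain a' b' where ab': "a' \<in> R" "b' \<in> R" "b' \<noteq> 0" "h = a' / b'" using R_fraction by blast
  note u = taylor_R_unit[OF ab(2,3)] taylor_R_unit[OF ab'(2,3)]
  have inv: "inverse (taylor_R b * taylor_R b') = inverse (taylor_R b) * inverse (taylor_R b')"
    by (rule fps_inverse_mult)
  have gh: "g + h = (a * b' + a' * b) / (b * b')" "g * h = (a * a') / (b * b')"
    using ab ab' by (auto simp: field_simps)
  have "taylor (g * h) = (taylor_R a * taylor_R a') * (inverse (taylor_R b) * inverse (taylor_R b'))"
    unfolding gh(2) by (subst taylor_fraction) (use ab ab' in \<open>auto simp: R_mult taylor_R_mult inv\<close>)
  thus "taylor (g * h) = taylor g * taylor h"
    unfolding ab(4) ab'(4) by (simp add: taylor_fraction ab ab' mult_ac)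
  have "taylor (g + h) = (taylor_R a * taylor_R b' + taylor_R a' * taylor_R b) *
      (inverse (taylor_R b) * inverse (taylor_R b'))"
    unfolding gh(1) by (subst taylor_fraction)
      (use ab ab' in \<open>auto simp: R_mult R_add taylor_R_mult taylor_R_add inv\<close>)
  also have "\<dots> = taylor_R a * inverse (taylor_R b) * (taylor_R b' * inverse (taylor_R b')) +
      taylor_R a' * inverse (taylor_R b') * (taylor_R b * inverse (taylor_R b))"
    by (simp add: algebra_simps)
  finally show "taylor (g + h) = taylor g + taylor h"
    unfolding ab(4) ab'(4) by (simp add: taylor_fraction ab ab' u)
  have "taylor g $ 0 * b = (taylor_R a * inverse (taylor_R b) * taylor_R b) $ 0"
    unfolding ab(4) by (simp add: taylor_fraction ab taylor_R_nth_0)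
  also have "\<dots> = a" using u(1) ab by (simp add: mult.assoc mult.commute[of "inverse _"] taylor_R_nth_0 del: fps_mult_nth_0)
  finally have "taylor g $ 0 = a / b" using ab(3) by (simp add: eq_divide_eq)
  thus "taylor g $ 0 = g" using ab(4) by (rule trans[OF _ sym])
qed (simp_all add: taylor_on_R R_const taylor_R_const taylor_R_param)

lemma hasse_param_eq: "hasse \<iota> \<pi> = (\<lambda>r g. taylor g $ r)"
  by (rule hasse_eq_taylor[OF field_hom_const separable_param taylor_hom_param])

lemma hasse_param_R: "g \<in> R \<Longrightarrow> hasse \<iota> \<pi> r g \<in> R"
  and expand_hasse_param: "g \<in> R \<Longrightarrow> expand (hasse \<iota> \<pi> r g) = fps_hasse r (expand g)"
  by (auto simp: hasse_param_eq taylor_on_R expand_taylor_R fps_taylor_nth)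

end


section \<open>Change of the variable of differentiation\<close>

text \<open>Elements on which the first derivative vanishes form a separably closed subfield, so the
  derivative of a separable variable does not vanish unless the derivation is zero.\<close>

lemma taylor_separable_nonzero:
  assumes const: "field_hom \<iota>" and \<sigma>: "taylor_hom \<iota> x \<sigma>" and t: "separable_variable \<iota> t"
  shows "\<sigma> t $ 1 \<noteq> 0"
proof
  assume t0: "\<sigma> t $ 1 = 0"
  note simps = taylor_add[OF const \<sigma>] taylor_mult[OF const \<sigma>] taylor_const[OF const \<sigma>]
    taylor_nth_0[OF const \<sigma>] taylor_sum[OF const \<sigma>] taylor_power[OF const \<sigma>] taylor_0[OF const \<sigma>]
  have prod: "\<sigma> (g * h) $ 1 = g * \<sigma> h $ 1 + \<sigma> g $ 1 * h" for g h
    by (simp add: simps fps_mult_nth atLeast0_atMost_Suc)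
  let ?A = "{g. \<sigma> g $ 1 = 0}"
  have "?A = UNIV"
  proof (rule t[unfolded separable_variable_def, rule_format])
    show "range \<iota> \<subseteq> ?A" "t \<in> ?A" using t0 by (auto simp: simps)
    show "g + h \<in> ?A \<and> g * h \<in> ?A" if "g \<in> ?A" "h \<in> ?A" for g h
      using that by (auto simp: prod simps(1) simp del: One_nat_def)
    show "inverse g \<in> ?A" if "g \<in> ?A" for g
    proof (cases "g = 0")
      case False
      have "\<sigma> (g * inverse g) $ 1 = 0" using False taylor_1[OF const \<sigma>] by simp
      thus ?thesis using that False by (simp only: prod mem_Collect_eq) (simp del: One_nat_def)
    qed (use that in simp)
    fix d b y assume b: "\<And>j. j \<le> d \<Longrightarrow> b j \<in> ?A" and y: "(\<Sum>j\<le>d. b j * y ^ j) = 0"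
      "(\<Sum>j\<le>d. of_nat j * b j * y ^ (j - 1)) \<noteq> 0"
    have "(\<Sum>j\<le>d. \<sigma> (b j) * \<sigma> y ^ j) $ 1 - (\<Sum>j\<le>d. \<sigma> (b j) * fps_const y ^ j) $ 1 =
        (\<Sum>j\<le>d. of_nat j * \<sigma> (b j) $ 0 * (\<sigma> y $ 0) ^ (j - 1)) * (\<sigma> y $ 1 - fps_const y $ 1)"
      by (rule fps_separable_nth_diff) (auto simp: simps)
    moreover have "(\<Sum>j\<le>d. \<sigma> (b j) * \<sigma> y ^ j) = 0"
      using arg_cong[OF y(1), of \<sigma>] by (simp add: simps)
    moreover have "(\<Sum>j\<le>d. \<sigma> (b j) * fps_const y ^ j) $ 1 = 0"
      using b by (simp add: fps_sum_nth fps_const_power)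
    ultimately show "y \<in> ?A" using y(2) by (simp add: simps)
  qed
  hence "\<sigma> x $ 1 = 0" by blast
  thus False using taylor_var[OF const \<sigma>] by simp
qed

text \<open>Substituting the inverse of the power series \<open>\<sigma> t - t\<close> into \<open>\<sigma>\<close> gives the expansions with
  respect to \<open>t\<close>.\<close>

lemma hasse_change_variable:
  assumes const: "field_hom \<iota>" and \<sigma>: "taylor_hom \<iota> x \<sigma>" and t: "separable_variable \<iota> t"
  shows "hasse_derivatives \<iota> t (hasse \<iota> t)"
    and "\<sigma> g $ r = (\<Sum>i\<le>r. hasse \<iota> t i g * ((\<sigma> t - fps_const t) ^ i) $ r)"
proof -
  define s where "s = \<sigma> t - fps_const t"
  have s: "s $ 0 = 0" "s $ 1 \<noteq> 0"
    using taylor_separable_nonzero[OF assms] taylor_nth_0[OF const \<sigma>] by (auto simp: s_def)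
  define \<psi> where "\<psi> = fps_inv s"
  have \<psi>: "\<psi> $ 0 = 0" "s oo \<psi> = fps_X" "\<psi> oo s = fps_X"
    using s by (simp_all add: \<psi>_def fps_inv fps_inv_right) (simp add: fps_inv_def)
  have \<tau>: "taylor_hom \<iota> t (\<lambda>g. \<sigma> g oo \<psi>)"
    unfolding taylor_hom_def
  proof (intro conjI allI)
    have "\<sigma> t = fps_const t + s" by (simp add: s_def)
    thus "\<sigma> t oo \<psi> = fps_const t + fps_X" using \<psi> by (simp add: fps_compose_add_distrib)
  qed (use \<psi>(1) in \<open>simp_all add: taylor_add[OF const \<sigma>] taylor_mult[OF const \<sigma>] taylor_const[OF const \<sigma>]
     taylor_nth_0[OF const \<sigma>] fps_compose_add_distrib fps_compose_mult_distrib\<close>)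
  have h: "hasse \<iota> t = (\<lambda>r g. (\<sigma> g oo \<psi>) $ r)"
    by (rule hasse_eq_taylor[OF const t \<tau>])
  show "hasse_derivatives \<iota> t (hasse \<iota> t)"
    unfolding h by (rule hasse_derivatives_taylor[OF const \<tau>])
  have "\<sigma> g = (\<sigma> g oo \<psi>) oo s"
    using fps_compose_assoc[of s \<psi> "\<sigma> g"] \<psi> s by simp
  hence "\<sigma> g $ r = ((\<sigma> g oo \<psi>) oo s) $ r" by simp
  thus "\<sigma> g $ r = (\<Sum>i\<le>r. hasse \<iota> t i g * ((\<sigma> t - fps_const t) ^ i) $ r)"
    by (simp add: fps_compose_nth h s_def atLeast0AtMost)
qed

section \<open>Orders of a linear series at a place\<close>

context place_param
begin

lemma vector_space_const: "vector_space (\<lambda>c x. \<iota> c * x)"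
  by (rule vector_space_field_hom[OF field_hom_const])

text \<open>In a relation, the term of least order could not cancel.\<close>

lemma distinct_vl_independent:
  assumes I: "finite I" and G: "\<And>i. i \<in> I \<Longrightarrow> G i \<in> R \<and> G i \<noteq> 0"
    and inj: "inj_on (\<lambda>i. vl (G i)) I" and eq: "(\<Sum>i\<in>I. \<iota> (c i) * G i) = 0" and i: "i \<in> I"
  shows "c i = 0"
proof (rule ccontr)
  assume ci: "c i \<noteq> 0"
  define o' where "o' i = subdegree (expand (G i))" for i
  have o': "vl (G i) = int (o' i)" if "i \<in> I" for i
    using subdegree_expand(2) G[OF that] by (simp add: o'_def)
  let ?Q = "\<lambda>v. \<exists>i\<in>I. c i \<noteq> 0 \<and> o' i = v"
  obtain v where v: "?Q v" "\<And>w. w < v \<Longrightarrow> \<not> ?Q w"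
    using exists_least_iff[of ?Q] i ci by blast
  then obtain k where k: "k \<in> I" "c k \<noteq> 0" "o' k = v" by blast
  have "0 = expand (\<Sum>i\<in>I. \<iota> (c i) * G i) $ v" by (simp add: eq)
  also have "\<dots> = (\<Sum>i\<in>I. c i * expand (G i) $ v)"
    by (subst expand_sum) (use G in \<open>auto intro!: R_intros simp: expand_mult R_const expand_const fps_sum_nth\<close>)
  also have "\<dots> = (\<Sum>i\<in>{k}. c i * expand (G i) $ v)"
  proof (rule sum.mono_neutral_right)
    show "\<forall>i\<in>I - {k}. c i * expand (G i) $ v = 0"
    proof
      fix i assume i: "i \<in> I - {k}"
      show "c i * expand (G i) $ v = 0"
      proof (cases "c i = 0")
        case False
        have "o' i \<noteq> v" using inj_onD[OF inj, of i k] i k o' by auto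
        hence "v < o' i" using v(2)[of "o' i"] False i by (metis DiffD1 linorder_less_linear)
        hence "expand (G i) $ v = 0" unfolding o'_def by (rule nth_less_subdegree_zero)
        thus ?thesis by simp
      qed simp
    qed
  qed (use I k in auto)
  also have "\<dots> = c k * expand (G k) $ subdegree (expand (G k))" using k by (simp add: o'_def)
  finally show False using k G[OF k(1)] subdegree_expand(1) by simp
qed

text \<open>Subtracting a multiple of a function of the same order increases the order. So functions
  \<open>G j\<close> of order \<open>j\<close>, one for each order, span; and they are independent.\<close>

lemma order_basis:
  fixes F :: "nat \<Rightarrow> 'f" and n :: nat
  defines "L \<equiv> \<lambda>a. \<Sum>i\<le>n. \<iota> (a i) * F i"
  defines "J \<equiv> {j. \<exists>a. (\<exists>i\<le>n. a i \<noteq> 0) \<and> vl (L a) = int j}"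
  assumes F: "\<And>i. i \<le> n \<Longrightarrow> F i \<in> R" and indep: "\<And>a. \<exists>i\<le>n. a i \<noteq> 0 \<Longrightarrow> L a \<noteq> 0"
  shows "finite J" "card J = n + 1"
proof -
  interpret V: vector_space "\<lambda>c x. \<iota> c * x" by (rule vector_space_const)
  have LR: "L a \<in> R" for a unfolding L_def using F by (intro R_intros) auto
  have "\<forall>j\<in>J. \<exists>a. (\<exists>i\<le>n. a i \<noteq> 0) \<and> vl (L a) = int j" by (simp add: J_def)
  then obtain A where A: "\<And>j. j \<in> J \<Longrightarrow> \<exists>i\<le>n. A j i \<noteq> 0" "\<And>j. j \<in> J \<Longrightarrow> vl (L (A j)) = int j"
    using bchoice[of J] by metis
  define G where "G j = L (A j)" for j
  have G: "G j \<in> R" "G j \<noteq> 0" "vl (G j) = int j" if "j \<in> J" for j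
    using A[OF that] LR indep by (auto simp: G_def)
  have inj: "inj_on (\<lambda>j. vl (G j)) J" by (auto simp: inj_on_def G)
  have span: "L a \<in> V.span (F ` {..n})" for a
    unfolding L_def by (intro V.span_sum V.span_scale V.span_base) auto
  have bound: "card J' \<le> n + 1" if "J' \<subseteq> J" "finite J'" for J'
  proof (rule ccontr)
    assume "\<not> card J' \<le> n + 1"
    moreover have "card (F ` {..n}) \<le> n + 1" using card_image_le[of "{..n}" F] by simp
    ultimately have "card (F ` {..n}) < card J'" by simp
    hence "\<exists>c. (\<exists>j\<in>J'. c j \<noteq> 0) \<and> (\<Sum>j\<in>J'. \<iota> (c j) * G j) = 0"
      by (intro V.nontrivial_relation_if_card_gt[of J' "F ` {..n}" G])
         (use that span in \<open>auto simp: G_def\<close>)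
    then obtain c where c: "\<exists>j\<in>J'. c j \<noteq> 0" "(\<Sum>j\<in>J'. \<iota> (c j) * G j) = 0" by blast
    have "c j = 0" if "j \<in> J'" for j
      using distinct_vl_independent[OF \<open>finite J'\<close>, of G c j] G \<open>J' \<subseteq> J\<close> inj_on_subset[OF inj] c(2) that
      by blast
    thus False using c(1) by blast
  qed
  show fin: "finite J"
    by (rule conjunct1[OF finite_if_finite_subsets_card_bdd[OF bound]])
  have spanJ: "L a \<in> V.span (G ` J)" for a
  proof (induction "card {j \<in> J. int j \<ge> vl (L a)}" arbitrary: a rule: less_induct)
    case less
    show ?case
    proof (cases "\<exists>i\<le>n. a i \<noteq> 0")
      case False
      hence "L a = 0" by (simp add: L_def)
      thus ?thesis by (simp add: V.span_zero)
    next
      case True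
      define j where "j = subdegree (expand (L a))"
      have La: "L a \<noteq> 0" using indep True by blast
      have vj: "vl (L a) = int j" using subdegree_expand(2)[OF LR La] by (simp add: j_def)
      hence j: "j \<in> J" using True by (auto simp: J_def)
      have sG: "subdegree (expand (G j)) = j" using subdegree_expand(2)[of "G j"] G[OF j] by simp
      have nz: "expand (G j) $ j \<noteq> 0"
        using subdegree_expand(1)[of "G j"] G[OF j] sG by (metis nth_subdegree_nonzero)
      define c where "c = expand (L a) $ j / expand (G j) $ j"
      define a' where "a' i = a i - c * A j i" for i
      have La': "L a' = L a - \<iota> c * G j"
        by (simp add: L_def a'_def G_def const.hom_minus const.hom_mult algebra_simps sum_subtractf sum_distrib_left)
      have "L a' \<in> V.span (G ` J)"
      proof (cases "\<exists>i\<le>n. a' i \<noteq> 0")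
        case False
        hence "L a' = 0" by (simp add: L_def)
        thus ?thesis by (simp add: V.span_zero)
      next
        case True
        have La'0: "L a' \<noteq> 0" using indep True by blast
        have "expand (L a') $ i = 0" if "i \<le> j" for i
        proof (cases "i = j")
          case True
          thus ?thesis using nz unfolding La'
            by (simp add: expand_diff LR R_mult R_const G j expand_mult expand_const c_def)
        next
          case False
          hence "i < j" using that by simp
          have "expand (L a) $ i = 0" "expand (G j) $ i = 0"
            using \<open>i < j\<close> sG by (auto simp: j_def intro!: nth_less_subdegree_zero)
          thus ?thesis unfolding La'
            by (simp add: expand_diff LR R_mult R_const G j expand_mult expand_const)
        qed
        hence "subdegree (expand (L a')) > j"
          using subdegree_expand(1)[OF LR La'0] by (metis not_less nth_subdegree_nonzero)
        hence gt: "vl (L a') > int j" using subdegree_expand(2)[OF LR La'0] by simp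
        have "{i \<in> J. int i \<ge> vl (L a')} \<subseteq> {i \<in> J. int i \<ge> vl (L a)}"
          "j \<in> {i \<in> J. int i \<ge> vl (L a)}" "j \<notin> {i \<in> J. int i \<ge> vl (L a')}"
          using gt vj j by auto
        hence "card {i \<in> J. int i \<ge> vl (L a')} < card {i \<in> J. int i \<ge> vl (L a)}"
          using fin by (intro psubset_card_mono) auto
        thus ?thesis by (rule less.hyps)
      qed
      moreover have "\<iota> c * G j \<in> V.span (G ` J)" using j by (intro V.span_scale V.span_base) auto
      ultimately have "L a' + \<iota> c * G j \<in> V.span (G ` J)" by (rule V.span_add)
      thus ?thesis by (simp add: La')
    qed
  qed
  have FJ: "F i \<in> V.span (G ` J)" if "i \<le> n" for i
  proof -
    have "L (\<lambda>k. if k = i then 1 else 0) = (\<Sum>k\<le>n. if k = i then F k else 0)"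
      unfolding L_def by (rule sum.cong) auto
    hence "L (\<lambda>k. if k = i then 1 else 0) = F i" using that by simp
    thus ?thesis using spanJ by metis
  qed
  have "\<not> card J < n + 1"
  proof
    assume "card J < n + 1"
    hence "card (G ` J) < card {..n}" using card_image_le[OF fin, of G] by simp
    hence "\<exists>c. (\<exists>i\<in>{..n}. c i \<noteq> 0) \<and> (\<Sum>i\<in>{..n}. \<iota> (c i) * F i) = 0"
      by (intro V.nontrivial_relation_if_card_gt[of _ "G ` J"]) (use FJ fin in auto)
    thus False using indep unfolding L_def by auto
  qed
  thus "card J = n + 1" using bound[OF subset_refl fin] by simp
qed

end

section \<open>Determinants by rows and columns\<close>

lemma det_eq_0_iff_rows_dependent:
  fixes m :: "nat \<Rightarrow> nat \<Rightarrow> 'f::field"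
  shows "det (mat N N (\<lambda>(r, c). m r c)) = 0 \<longleftrightarrow>
    (\<exists>v. (\<exists>r<N. v r \<noteq> 0) \<and> (\<forall>c<N. (\<Sum>r<N. v r * m r c) = 0))"
proof -
  let ?A = "mat N N (\<lambda>(c, r). m r c)"
  have A: "?A \<in> carrier_mat N N" by simp
  have "mat N N (\<lambda>(r, c). m r c) = transpose_mat ?A" by auto
  hence "det (mat N N (\<lambda>(r, c). m r c)) = det ?A" using det_transpose[OF A] by simp
  also have "\<dots> = 0 \<longleftrightarrow> (\<exists>v. v \<in> carrier_vec N \<and> v \<noteq> 0\<^sub>v N \<and> ?A *\<^sub>v v = 0\<^sub>v N)"
    by (rule det_0_iff_vec_prod_zero_field[OF A])
  also have "\<dots> \<longleftrightarrow> (\<exists>v. (\<exists>r<N. v r \<noteq> 0) \<and> (\<forall>c<N. (\<Sum>r<N. v r * m r c) = 0))" (is "?l \<longleftrightarrow> ?r")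
  proof
    assume ?l
    then obtain v where v: "v \<in> carrier_vec N" "v \<noteq> 0\<^sub>v N" "?A *\<^sub>v v = 0\<^sub>v N" by blast
    have "(\<Sum>r<N. vec_index v r * m r c) = 0" if "c < N" for c
    proof -
      have "vec_index (?A *\<^sub>v v) c = (\<Sum>r<N. m r c * vec_index v r)"
        using that v(1) by (simp add: scalar_prod_def atLeast0LessThan)
      thus ?thesis using v(3) that by (simp add: mult.commute)
    qed
    moreover have "\<exists>r<N. vec_index v r \<noteq> 0"
    proof (rule ccontr)
      assume "\<not> ?thesis"
      hence "v = 0\<^sub>v N" using v(1) by (intro eq_vecI) auto
      thus False using v(2) by simp
    qed
    ultimately show ?r by blast
  next
    assume ?r
    then obtain v where v: "\<exists>r<N. v r \<noteq> 0" "\<And>c. c < N \<Longrightarrow> (\<Sum>r<N. v r * m r c) = 0" by blast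
    have "vec N v \<noteq> 0\<^sub>v N"
    proof
      assume eq: "vec N v = 0\<^sub>v N"
      obtain r where "r < N" "v r \<noteq> 0" using v(1) by blast
      thus False using arg_cong[OF eq, of "\<lambda>w. vec_index w r"] by simp
    qed
    moreover have "?A *\<^sub>v vec N v = 0\<^sub>v N"
      using v(2) by (intro eq_vecI) (auto simp: scalar_prod_def atLeast0LessThan mult.commute)
    ultimately show ?l by (intro exI[of _ "vec N v"]) auto
  qed
  finally show ?thesis .
qed

lemma det_scale_rows_cols:
  fixes m :: "nat \<Rightarrow> nat \<Rightarrow> 'b::comm_ring_1"
  shows "det (mat N N (\<lambda>(r, c). \<alpha> r * (\<beta> c * m r c))) = (\<Prod>r<N. \<alpha> r) * (\<Prod>c<N. \<beta> c) * det (mat N N (\<lambda>(r, c). m r c))"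
proof -
  have "(\<Prod>i = 0..<N. mat N N (\<lambda>(r, c). \<alpha> r * (\<beta> c * m r c)) $$ (i, p i)) =
      (\<Prod>r<N. \<alpha> r) * (\<Prod>c<N. \<beta> c) * (\<Prod>i = 0..<N. mat N N (\<lambda>(r, c). m r c) $$ (i, p i))"
    if p: "p permutes {0..<N}" for p
  proof -
    have lt: "p i < N" if "i < N" for i using permutes_in_image[OF p, of i] that by auto
    have "(\<Prod>i = 0..<N. mat N N (\<lambda>(r, c). \<alpha> r * (\<beta> c * m r c)) $$ (i, p i)) =
        (\<Prod>i = 0..<N. \<alpha> i * (\<beta> (p i) * mat N N (\<lambda>(r, c). m r c) $$ (i, p i)))"
      by (rule prod.cong) (auto simp: lt)
    also have "\<dots> = (\<Prod>i = 0..<N. \<alpha> i) * ((\<Prod>i = 0..<N. \<beta> (p i)) *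
        (\<Prod>i = 0..<N. mat N N (\<lambda>(r, c). m r c) $$ (i, p i)))"
      by (simp only: prod.distrib)
    also have "(\<Prod>i = 0..<N. \<beta> (p i)) = (\<Prod>i = 0..<N. \<beta> i)"
      using prod.permute[OF p, of \<beta>] by (simp add: comp_def)
    finally show ?thesis by (simp add: atLeast0LessThan mult.assoc)
  qed
  thus ?thesis
    by (auto simp: det_def'[of _ N] sum_distrib_left mult_ac intro!: sum.cong)
qed

lemma det_subtract_row:
  fixes m :: "nat \<Rightarrow> nat \<Rightarrow> 'b::comm_ring_1"
  assumes "k < N" "l < N" "k \<noteq> l"
  shows "det (mat N N (\<lambda>(r, c). if r = k then m k c - m l c else m r c)) = det (mat N N (\<lambda>(r, c). m r c))"
proof -
  have "mat N N (\<lambda>(r, c). if r = k then m k c - m l c else m r c) =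
      addrow (-1) k l (mat N N (\<lambda>(r, c). m r c))"
    using assms by (intro eq_matI) auto
  thus ?thesis using det_addrow[of l N k "mat N N (\<lambda>(r, c). m r c)" "-1"] assms by simp
qed

lemma det_swap_rows_01:
  fixes m :: "nat \<Rightarrow> nat \<Rightarrow> 'b::comm_ring_1"
  assumes "1 < N"
  shows "det (mat N N (\<lambda>(r, c). if r = 0 then m 1 c else if r = 1 then m 0 c else m r c)) =
    - det (mat N N (\<lambda>(r, c). m r c))"
proof -
  have "mat N N (\<lambda>(r, c). if r = 0 then m 1 c else if r = 1 then m 0 c else m r c) =
      swaprows 0 1 (mat N N (\<lambda>(r, c). m r c))"
    using assms by (intro eq_matI) auto
  thus ?thesis using det_swaprows[of 0 N 1 "mat N N (\<lambda>(r, c). m r c)"] assms by simp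
qed


section \<open>Expansion along two rows\<close>

definition skip :: "nat \<Rightarrow> nat \<Rightarrow> nat" where
  "skip a b = (if b < a then b else Suc b)"

lemma skip_inj: "skip a b = skip a b' \<Longrightarrow> b = b'"
  by (auto simp: skip_def split: if_splits)

lemma skip_image:
  assumes "a \<le> N" shows "skip a ` {..<N} = {..N} - {a}"
proof
  show "skip a ` {..<N} \<subseteq> {..N} - {a}" by (auto simp: skip_def)
  show "{..N} - {a} \<subseteq> skip a ` {..<N}"
  proof
    fix x assume x: "x \<in> {..N} - {a}"
    show "x \<in> skip a ` {..<N}"
    proof (cases "x < a")
      case True
      thus ?thesis using assms by (intro image_eqI[of _ _ x]) (auto simp: skip_def)
    next
      case False
      thus ?thesis using x by (intro image_eqI[of _ _ "x - 1"]) (auto simp: skip_def)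
    qed
  qed
qed

lemma sum_skip:
  assumes "a \<le> N" shows "(\<Sum>b<N. w (skip a b)) + w a = (\<Sum>i\<le>N. w i :: 'b::comm_monoid_add)"
proof -
  have "(\<Sum>b<N. w (skip a b)) = sum w (skip a ` {..<N})"
    by (rule sum.reindex_cong[symmetric, of "skip a"]) (auto simp: inj_on_def dest: skip_inj)
  thus ?thesis using assms sum.remove[of "{..N}" a w] by (simp add: skip_image add.commute)
qed

lemma det_laplace_row_0:
  fixes m :: "nat \<Rightarrow> nat \<Rightarrow> 'b::comm_ring_1"
  shows "det (mat (Suc N) (Suc N) (\<lambda>(r, c). m r c)) =
    (\<Sum>a\<le>N. (-1) ^ a * m 0 a * det (mat N N (\<lambda>(r, c). m (Suc r) (skip a c))))"
proof -
  let ?A = "mat (Suc N) (Suc N) (\<lambda>(r, c). m r c)"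
  have "det ?A = (\<Sum>a<Suc N. ?A $$ (0, a) * cofactor ?A 0 a)"
    by (rule laplace_expansion_row) auto
  also have "\<dots> = (\<Sum>a\<le>N. (-1) ^ a * m 0 a * det (mat N N (\<lambda>(r, c). m (Suc r) (skip a c))))"
  proof (intro sum.cong)
    fix a assume a: "a \<in> {..N}"
    have "mat_delete ?A 0 a = mat N N (\<lambda>(r, c). m (Suc r) (skip a c))"
      unfolding mat_delete_def using a by (intro eq_matI) (auto simp: skip_def)
    thus "?A $$ (0, a) * cofactor ?A 0 a =
        (-1) ^ a * m 0 a * det (mat N N (\<lambda>(r, c). m (Suc r) (skip a c)))"
      using a by (simp add: cofactor_def mult_ac)
  qed auto
  finally show ?thesis .
qed

lemma det_laplace_rows_01:
  fixes m :: "nat \<Rightarrow> nat \<Rightarrow> 'b::comm_ring_1"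
  shows "det (mat (Suc (Suc N)) (Suc (Suc N)) (\<lambda>(r, c). m r c)) =
    (\<Sum>a\<le>Suc N. \<Sum>b\<le>N. (-1) ^ (a + b) * m 0 a * m 1 (skip a b) *
       det (mat N N (\<lambda>(r, c). m (Suc (Suc r)) (skip a (skip b c)))))"
proof -
  have "det (mat (Suc N) (Suc N) (\<lambda>(r, c). m (Suc r) (skip a c))) =
      (\<Sum>b\<le>N. (-1) ^ b * m 1 (skip a b) * det (mat N N (\<lambda>(r, c). m (Suc (Suc r)) (skip a (skip b c)))))"
    for a using det_laplace_row_0[of N "\<lambda>r c. m (Suc r) (skip a c)"] by simp
  thus ?thesis
    unfolding det_laplace_row_0[of "Suc N"] by (simp add: sum_distrib_left power_add mult_ac)
qed


section \<open>Lexicographically least orders\<close>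

text \<open>The matrices considered have two fixed rows \<open>a\<close> and \<open>b\<close> and further rows \<open>H \<rho>\<close> for a list of
  \<open>\<rho>\<close>; the minimality of such a list is used by exchanging rows.\<close>

definition rows_mat :: "nat \<Rightarrow> (nat \<Rightarrow> 'b) \<Rightarrow> (nat \<Rightarrow> 'b) \<Rightarrow> (nat \<Rightarrow> nat \<Rightarrow> 'b) \<Rightarrow> nat list \<Rightarrow> 'b mat" where
  "rows_mat n a b H \<rho> = mat (n + 1) (n + 1) (\<lambda>(r, c).
     if r = 0 then a c else if r = 1 then b c else H (\<rho> ! (r - 2)) c)"

lemma sum_lessThan_Suc_Suc: "(\<Sum>r<Suc (Suc N). f r) = f 0 + f 1 + (\<Sum>l<N. f (Suc (Suc l)) :: 'b::comm_monoid_add)"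
  by (simp add: sum.lessThan_Suc_shift add.assoc del: sum.lessThan_Suc)

lemma sum_list_nth:
  assumes "distinct \<rho>" shows "(\<Sum>l<length \<rho>. f (\<rho> ! l)) = (\<Sum>x\<in>set \<rho>. f x :: 'b::comm_monoid_add)"
  by (rule sum.reindex_bij_betw[OF bij_betw_nth[OF assms]]) auto

text \<open>Linear independence of the rows in terms of the set of the \<open>\<rho>\<close>, as the order of the rows is
  irrelevant for an exchange.\<close>

definition rows_independent :: "nat \<Rightarrow> (nat \<Rightarrow> 'b::field) \<Rightarrow> (nat \<Rightarrow> 'b) \<Rightarrow> (nat \<Rightarrow> nat \<Rightarrow> 'b) \<Rightarrow> nat set \<Rightarrow> bool" where
  "rows_independent n a b H S \<longleftrightarrow> (\<forall>x y v. (\<forall>c\<le>n. x * a c + y * b c + (\<Sum>\<rho>\<in>S. v \<rho> * H \<rho> c) = 0) \<longrightarrow>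
     x = 0 \<and> y = 0 \<and> (\<forall>\<rho>\<in>S. v \<rho> = 0))"

lemma det_rows_mat_nonzero_iff:
  assumes n: "n \<ge> 2" and \<rho>: "length \<rho> = n - 1" "distinct \<rho>"
  shows "det (rows_mat n a b H \<rho>) \<noteq> 0 \<longleftrightarrow> rows_independent n a b H (set \<rho>)"
proof -
  define m where "m r c = (if r = 0 then a c else if r = 1 then b c else H (\<rho> ! (r - 2)) c)" for r c
  have N: "n + 1 = Suc (Suc (length \<rho>))" using n \<rho> by simp
  have sum: "(\<Sum>r<n + 1. v r * m r c) = v 0 * a c + v 1 * b c + (\<Sum>l<length \<rho>. v (l + 2) * H (\<rho> ! l) c)" for v c
    unfolding N sum_lessThan_Suc_Suc by (simp add: m_def)
  have "det (rows_mat n a b H \<rho>) = 0 \<longleftrightarrow>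
      (\<exists>v. (\<exists>r<n + 1. v r \<noteq> 0) \<and> (\<forall>c<n + 1. (\<Sum>r<n + 1. v r * m r c) = 0))"
    using det_eq_0_iff_rows_dependent[of "n + 1" m] by (simp add: rows_mat_def m_def)
  also have "\<dots> \<longleftrightarrow> \<not> rows_independent n a b H (set \<rho>)" (is "?l \<longleftrightarrow> ?r")
  proof
    assume ?l
    then obtain v where v: "\<exists>r<n + 1. v r \<noteq> 0" "\<And>c. c < n + 1 \<Longrightarrow> (\<Sum>r<n + 1. v r * m r c) = 0" by blast
    define w where "w x = v (the_inv_into {..<length \<rho>} ((!) \<rho>) x + 2)" for x
    have inj: "inj_on ((!) \<rho>) {..<length \<rho>}" using \<rho>(2) by (auto simp: inj_on_nth)
    have w: "w (\<rho> ! l) = v (l + 2)" if "l < length \<rho>" for l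
      unfolding w_def using the_inv_into_f_f[OF inj, of l] that by simp
    have "v 0 * a c + v 1 * b c + (\<Sum>x\<in>set \<rho>. w x * H x c) = 0" if "c \<le> n" for c
    proof -
      have "(\<Sum>x\<in>set \<rho>. w x * H x c) = (\<Sum>l<length \<rho>. v (l + 2) * H (\<rho> ! l) c)"
        by (subst sum_list_nth[OF \<rho>(2), symmetric]) (auto simp: w)
      thus ?thesis using v(2)[of c] that sum[of v c] by simp
    qed
    moreover have "v 0 \<noteq> 0 \<or> v 1 \<noteq> 0 \<or> (\<exists>x\<in>set \<rho>. w x \<noteq> 0)"
    proof -
      obtain r where r: "r < n + 1" "v r \<noteq> 0" using v(1) by blast
      show ?thesis
      proof (cases "r < 2")
        case True
        hence "r = 0 \<or> r = 1" by auto
        thus ?thesis using r by auto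
      next
        case False
        hence "r - 2 + 2 = r" by simp
        hence "r - 2 < length \<rho>" "v (r - 2 + 2) \<noteq> 0" using r N by (auto simp del: add_2_eq_Suc')
        hence "w (\<rho> ! (r - 2)) \<noteq> 0" "\<rho> ! (r - 2) \<in> set \<rho>" using w[of "r - 2"] by auto
        thus ?thesis by blast
      qed
    qed
    ultimately show ?r unfolding rows_independent_def by blast
  next
    assume ?r
    then obtain x y w where w: "\<And>c. c \<le> n \<Longrightarrow> x * a c + y * b c + (\<Sum>\<rho>\<in>set \<rho>. w \<rho> * H \<rho> c) = 0"
      "x \<noteq> 0 \<or> y \<noteq> 0 \<or> (\<exists>x\<in>set \<rho>. w x \<noteq> 0)" unfolding rows_independent_def by blast
    define v where "v r = (if r = 0 then x else if r = 1 then y else w (\<rho> ! (r - 2)))" for r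
    have "(\<Sum>r<n + 1. v r * m r c) = 0" if "c < n + 1" for c
      unfolding sum using w(1)[of c] that sum_list_nth[OF \<rho>(2), of "\<lambda>x. w x * H x c"] by (simp add: v_def)
    moreover have "\<exists>r<n + 1. v r \<noteq> 0"
      using w(2)
    proof (elim disjE bexE)
      fix z assume "z \<in> set \<rho>" "w z \<noteq> 0"
      then obtain l where "l < length \<rho>" "w (\<rho> ! l) \<noteq> 0" by (auto simp: in_set_conv_nth)
      thus ?thesis using N by (intro exI[of _ "l + 2"]) (auto simp: v_def)
    next
      assume "x \<noteq> 0" thus ?thesis by (intro exI[of _ 0]) (auto simp: v_def)
    next
      assume "y \<noteq> 0" thus ?thesis using N by (intro exI[of _ 1]) (auto simp: v_def)
    qed
    ultimately show ?l by blast
  qed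
  finally show ?thesis by blast
qed

lemma sorted_list_of_set_exchange_less:
  assumes S: "finite S" and x: "x \<in> S" and y: "y \<notin> S" "y < (x::nat)"
  shows "(sorted_list_of_set (insert y (S - {x})), sorted_list_of_set S) \<in> lexord less_than"
proof -
  let ?s = sorted_list_of_set
  define L where "L = {z \<in> S. z < y}"
  define U where "U = {z \<in> S. z > y}"
  have fin: "finite L" "finite U" using S by (auto simp: L_def U_def)
  have LU: "S = L \<union> U" using y(1) by (auto simp: L_def U_def) (metis linorder_neqE_nat)
  have S_eq: "?s S = ?s L @ ?s U"
  proof (subst sorted_list_of_set_unique[OF S, symmetric], intro conjI)
    show "sorted_wrt (<) (?s L @ ?s U)" using fin by (auto simp: sorted_wrt_append L_def U_def)
    show "set (?s L @ ?s U) = S" using fin LU by simp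
    have "L \<inter> U = {}" by (auto simp: L_def U_def)
    thus "length (?s L @ ?s U) = card S"
      using fin card_Un_disjoint[OF fin] LU by simp
  qed
  have "x \<notin> L" using y(2) by (simp add: L_def)
  hence S': "insert y (S - {x}) = L \<union> insert y (U - {x})" using LU by blast
  have S'_eq: "?s (insert y (S - {x})) = ?s L @ y # ?s (U - {x})"
  proof (subst sorted_list_of_set_unique[symmetric], use S in simp, intro conjI)
    show so: "sorted_wrt (<) (?s L @ y # ?s (U - {x}))"
      using fin by (auto simp: sorted_wrt_append L_def U_def)
    show st: "set (?s L @ y # ?s (U - {x})) = insert y (S - {x})"
      using fin S' by simp
    show "length (?s L @ y # ?s (U - {x})) = card (insert y (S - {x}))"
      unfolding st[symmetric] using so by (simp add: distinct_card strict_sorted_iff del: set_append)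
  qed
  have "U \<noteq> {}" using x y by (auto simp: U_def)
  then obtain w ws where w: "?s U = w # ws" using fin by (cases "?s U") auto
  hence "w \<in> U" using fin by (metis list.set_intros(1) set_sorted_list_of_set)
  hence "y < w" by (simp add: U_def)
  thus ?thesis unfolding S_eq S'_eq w by (intro lexord_append_leftI) simp
qed

text \<open>Write \<open>H \<rho>\<close> in the basis given by the rows. If a row \<open>H z\<close> with \<open>z > \<rho>\<close> occurred, then replacing \<open>z\<close> by
  \<open>\<rho>\<close> would keep the rows independent and give a lexicographically smaller list.\<close>

lemma minimal_orders_span:
  assumes n: "n \<ge> 2" and \<kappa>: "length \<kappa> = n - 1" "sorted_wrt (<) \<kappa>"
    and nz: "det (rows_mat n a b H \<kappa>) \<noteq> (0 :: 'b::field)"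
    and min: "\<And>\<rho>. length \<rho> = n - 1 \<Longrightarrow> sorted_wrt (<) \<rho> \<Longrightarrow> det (rows_mat n a b H \<rho>) \<noteq> 0 \<Longrightarrow>
       \<kappa> = \<rho> \<or> (\<kappa>, \<rho>) \<in> lexord less_than"
    and s: "s < n - 1" "\<rho> < \<kappa> ! s"
  shows "\<exists>x y v. \<forall>c\<le>n. H \<rho> c = x * a c + y * b c + (\<Sum>l<s. v l * H (\<kappa> ! l) c)"
proof -
  have dist: "distinct \<kappa>" using \<kappa>(2) by (simp add: strict_sorted_iff)
  have ind: "rows_independent n a b H (set \<kappa>)"
    using det_rows_mat_nonzero_iff[OF n \<kappa>(1) dist] nz by blast
  have less: "\<kappa> ! i < \<kappa> ! j" if "i < j" "j < n - 1" for i j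
    using sorted_wrt_nth_less[OF \<kappa>(2)] that \<kappa>(1) by simp
  have "\<exists>x y v. \<forall>c\<le>n. H \<rho> c = x * a c + y * b c + (\<Sum>z\<in>{z \<in> set \<kappa>. z < \<kappa> ! s}. v z * H z c)"
  proof (cases "\<rho> \<in> set \<kappa>")
    case True
    have "H \<rho> c = 0 * a c + 0 * b c + (\<Sum>z\<in>{z \<in> set \<kappa>. z < \<kappa> ! s}. (if z = \<rho> then 1 else 0) * H z c)" for c
    proof -
      have "(\<Sum>z\<in>{z \<in> set \<kappa>. z < \<kappa> ! s}. (if z = \<rho> then 1 else 0) * H z c) =
          (\<Sum>z\<in>{z \<in> set \<kappa>. z < \<kappa> ! s}. if z = \<rho> then H z c else 0)"
        by (rule sum.cong) auto
      thus ?thesis using True s(2) by simp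
    qed
    thus ?thesis
      by (intro exI[of _ 0] exI[of _ "\<lambda>z. if z = \<rho> then 1 else 0"]) blast
  next
    case False
    obtain v where v: "\<exists>r<n + 2. v r \<noteq> 0" "\<And>c. c < n + 1 \<Longrightarrow> (\<Sum>r<n + 2. v r *
        (if r = 0 then a c else if r = 1 then b c else if r = n + 1 then H \<rho> c else H (\<kappa> ! (r - 2)) c)) = 0"
    proof -
      let ?m = "\<lambda>r c. if c = n + 1 then 0 else if r = 0 then a c else if r = 1 then b c
        else if r = n + 1 then H \<rho> c else H (\<kappa> ! (r - 2)) c"
      have "det (mat (n + 2) (n + 2) (\<lambda>(c, r). ?m r c)) = 0"
        using det_laplace_row_0 [of "n + 1" "\<lambda>c r. if c = 0 then ?m r (n + 1) else ?m r c"]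
        by (subst det_eq_0_iff_rows_dependent)
           (intro exI[of _ "\<lambda>r. if r = n + 1 then 1 else 0"], auto)
      hence "det (transpose_mat (mat (n + 2) (n + 2) (\<lambda>(c, r). ?m r c))) = 0"
        by (subst det_transpose[of _ "n + 2"]) auto
      also have "transpose_mat (mat (n + 2) (n + 2) (\<lambda>(c, r). ?m r c)) = mat (n + 2) (n + 2) (\<lambda>(r, c). ?m r c)"
        by auto
      finally obtain v where v: "\<exists>r<n + 2. v r \<noteq> 0" "\<forall>c<n + 2. (\<Sum>r<n + 2. v r * ?m r c) = 0"
        unfolding det_eq_0_iff_rows_dependent by blast
      show thesis
      proof (rule that[OF v(1)])
        fix c assume "c < n + 1"
        thus "(\<Sum>r<n + 2. v r * (if r = 0 then a c else if r = 1 then b c else if r = n + 1 then H \<rho> c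
            else H (\<kappa> ! (r - 2)) c)) = 0"
          using v(2)[rule_format, of c] by simp
      qed
    qed
    have N: "n + 1 = Suc (Suc (n - 1))" using n by simp
    have split: "(\<Sum>r<n + 2. f r) = f 0 + f 1 + (\<Sum>l<n - 1. f (Suc (Suc l))) + f (n + 1)" for f :: "nat \<Rightarrow> 'b"
    proof -
      have "(\<Sum>r<n + 2. f r) = (\<Sum>r<n + 1. f r) + f (n + 1)" by simp
      also have "(\<Sum>r<n + 1. f r) = f 0 + f 1 + (\<Sum>l<n - 1. f (Suc (Suc l)))"
        unfolding N sum_lessThan_Suc_Suc ..
      finally show ?thesis .
    qed
    define w where "w x = v (the_inv_into {..<length \<kappa>} ((!) \<kappa>) x + 2)" for x
    have inj: "inj_on ((!) \<kappa>) {..<length \<kappa>}" using dist by (auto simp: inj_on_nth)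
    have w: "w (\<kappa> ! l) = v (l + 2)" if "l < length \<kappa>" for l
      unfolding w_def using the_inv_into_f_f[OF inj, of l] that by simp
    have rel: "v 0 * a c + v 1 * b c + (\<Sum>x\<in>set \<kappa>. w x * H x c) + v (n + 1) * H \<rho> c = 0" if "c \<le> n" for c
    proof -
      have "(\<Sum>x\<in>set \<kappa>. w x * H x c) = (\<Sum>l<n - 1. v (l + 2) * H (\<kappa> ! l) c)"
        using \<kappa>(1) by (subst sum_list_nth[OF dist, symmetric]) (auto simp: w)
      moreover have "(\<Sum>l<n - 1. v (Suc (Suc l)) *
          (if Suc (Suc l) = n + 1 then H \<rho> c else H (\<kappa> ! (Suc (Suc l) - 2)) c)) =
          (\<Sum>l<n - 1. v (l + 2) * H (\<kappa> ! l) c)"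
        by (rule sum.cong) auto
      ultimately show ?thesis using v(2)[of c] that n unfolding split by simp
    qed
    have v1: "v (n + 1) \<noteq> 0"
    proof
      assume 0: "v (n + 1) = 0"
      have *: "v 0 = 0 \<and> v 1 = 0 \<and> (\<forall>x\<in>set \<kappa>. w x = 0)"
      proof (rule ind[unfolded rows_independent_def, rule_format])
        fix c assume "c \<le> n"
        thus "v 0 * a c + v 1 * b c + (\<Sum>x\<in>set \<kappa>. w x * H x c) = 0" using rel[of c] 0 by simp
      qed
      obtain r where r: "r < n + 2" "v r \<noteq> 0" using v(1) by blast
      have "r \<noteq> 0" "r \<noteq> 1" "r \<noteq> n + 1" using * r 0 by (metis)+
      hence "r - 2 < length \<kappa>" "r = r - 2 + 2" using r n \<kappa>(1) by auto
      thus False using w[of "r - 2"] * r(2) by (metis nth_mem)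
    qed
    have zero: "w z = 0" if z: "z \<in> set \<kappa>" "z > \<rho>" for z
    proof (rule ccontr)
      assume wz: "w z \<noteq> 0"
      let ?S = "insert \<rho> (set \<kappa> - {z})"
      let ?\<rho> = "sorted_list_of_set ?S"
      have len: "length ?\<rho> = n - 1"
        using False z \<kappa>(1) distinct_card[OF dist] n by (simp add: card_Diff_singleton)
      have "rows_independent n a b H ?S"
        unfolding rows_independent_def
      proof (intro allI impI)
        fix x y u assume eq: "\<forall>c\<le>n. x * a c + y * b c + (\<Sum>z\<in>?S. u z * H z c) = 0"
        \<comment> \<open>Eliminate the new row by the relation, which contains the removed row.\<close>
        define q where "q = u \<rho> / v (n + 1)"
        have "(x - q * v 0) * a c + (y - q * v 1) * b c +
            (\<Sum>x\<in>set \<kappa>. ((if x = z then 0 else u x) - q * w x) * H x c) = 0" if "c \<le> n" for c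
        proof -
          have "(\<Sum>x\<in>?S. u x * H x c) = u \<rho> * H \<rho> c + (\<Sum>x\<in>set \<kappa> - {z}. u x * H x c)"
            using False by simp
          also have "(\<Sum>x\<in>set \<kappa> - {z}. u x * H x c) = (\<Sum>x\<in>set \<kappa>. (if x = z then 0 else u x) * H x c)"
            by (intro sum.mono_neutral_cong_left) auto
          finally have S: "(\<Sum>x\<in>?S. u x * H x c) =
            u \<rho> * H \<rho> c + (\<Sum>x\<in>set \<kappa>. (if x = z then 0 else u x) * H x c)" .
          have 1: "x * a c + y * b c + (u \<rho> * H \<rho> c + (\<Sum>x\<in>set \<kappa>. (if x = z then 0 else u x) * H x c)) = 0"
            using eq[rule_format, OF that] unfolding S .
          have 2: "q * v 0 * a c + q * v 1 * b c + q * (\<Sum>x\<in>set \<kappa>. w x * H x c) + u \<rho> * H \<rho> c = 0"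
          proof -
            have "q * (v 0 * a c + v 1 * b c + (\<Sum>x\<in>set \<kappa>. w x * H x c) + v (n + 1) * H \<rho> c) = 0"
              using rel[OF that] by simp
            moreover have "q * v (n + 1) = u \<rho>" using v1 by (simp add: q_def)
            ultimately show ?thesis by (simp only: distrib_left mult.assoc[symmetric])
          qed
          have "(\<Sum>x\<in>set \<kappa>. ((if x = z then 0 else u x) - q * w x) * H x c) =
              (\<Sum>x\<in>set \<kappa>. (if x = z then 0 else u x) * H x c) - q * (\<Sum>x\<in>set \<kappa>. w x * H x c)"
            by (simp add: left_diff_distrib sum_subtractf sum_distrib_left mult.assoc)
          moreover have "A - A' + (B - B') + (S - S') = 0"
            if "A + B + (U + S) = 0" "A' + B' + S' + U = 0" for A A' B B' S S' U :: 'b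
          proof -
            have "A - A' + (B - B') + (S - S') = (A + B + (U + S)) - (A' + B' + S' + U)" by simp
            thus ?thesis using that by simp
          qed
          from this[OF 1 2] have "(x - q * v 0) * a c + (y - q * v 1) * b c +
            ((\<Sum>x\<in>set \<kappa>. (if x = z then 0 else u x) * H x c) - q * (\<Sum>x\<in>set \<kappa>. w x * H x c)) = 0"
            by (simp only: left_diff_distrib)
          ultimately show ?thesis by simp
        qed
        hence *: "x - q * v 0 = 0 \<and> y - q * v 1 = 0 \<and> (\<forall>x\<in>set \<kappa>. (if x = z then 0 else u x) - q * w x = 0)"
          using ind[unfolded rows_independent_def, rule_format,
            of "x - q * v 0" "y - q * v 1" "\<lambda>x. (if x = z then 0 else u x) - q * w x"] by blast
        hence "q = 0" using z(1) wz by force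
        thus "x = 0 \<and> y = 0 \<and> (\<forall>\<rho>\<in>?S. u \<rho> = 0)"
          using * v1 by (auto simp: q_def split: if_splits)
      qed
      hence "det (rows_mat n a b H ?\<rho>) \<noteq> 0"
        by (subst det_rows_mat_nonzero_iff[OF n len])
          (simp_all only: distinct_sorted_list_of_set set_sorted_list_of_set finite_insert finite_Diff
            finite_set)
      hence "\<kappa> = ?\<rho> \<or> (\<kappa>, ?\<rho>) \<in> lexord less_than" by (intro min len strict_sorted_list_of_set)
      moreover have "sorted_list_of_set (set \<kappa>) = \<kappa>"
        using \<kappa>(2) dist by (simp add: sorted_list_of_set.idem_if_sorted_distinct strict_sorted_iff)
      hence "(?\<rho>, \<kappa>) \<in> lexord less_than"
        using sorted_list_of_set_exchange_less[of "set \<kappa>" z \<rho>] z False by simp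
      ultimately show False
        using lexord_irreflexive[of less_than \<kappa>] lexord_asymmetric[of less_than ?\<rho> \<kappa>] asym_less_than
        by (metis less_than_iff less_irrefl_nat)
    qed
    have "H \<rho> c = - v 0 / v (n + 1) * a c + (- v 1 / v (n + 1)) * b c +
        (\<Sum>z\<in>{z \<in> set \<kappa>. z < \<kappa> ! s}. (- w z / v (n + 1)) * H z c)" if "c \<le> n" for c
    proof -
      have "(\<Sum>x\<in>set \<kappa>. w x * H x c) = (\<Sum>x\<in>{z \<in> set \<kappa>. z < \<kappa> ! s}. w x * H x c)"
      proof (rule sum.mono_neutral_right)
        show "\<forall>x\<in>set \<kappa> - {z \<in> set \<kappa>. z < \<kappa> ! s}. w x * H x c = 0"
        proof
          fix x assume x: "x \<in> set \<kappa> - {z \<in> set \<kappa>. z < \<kappa> ! s}"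
          hence "\<rho> < x" using s(2) by auto
          thus "w x * H x c = 0" using zero[of x] x by simp
        qed
      qed auto
      moreover have "v (n + 1) * H \<rho> c = - v 0 * a c - v 1 * b c - (\<Sum>x\<in>{z \<in> set \<kappa>. z < \<kappa> ! s}. w x * H x c)"
      proof -
        have "U = - A - B - S" if "A + B + S + U = 0" for A B S U :: 'b
        proof -
          have "U = (A + B + S + U) - A - B - S" by simp
          thus ?thesis using that by simp
        qed
        from this[OF rel[OF that]] show ?thesis using calculation by simp
      qed
      ultimately have "H \<rho> c = (- v 0 * a c - v 1 * b c - (\<Sum>x\<in>{z \<in> set \<kappa>. z < \<kappa> ! s}. w x * H x c)) / v (n + 1)"
        using v1 by (simp add: field_simps)
      also have "\<dots> = - v 0 / v (n + 1) * a c + (- v 1 / v (n + 1)) * b c +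
        (\<Sum>z\<in>{z \<in> set \<kappa>. z < \<kappa> ! s}. (- w z / v (n + 1)) * H z c)"
        by (simp add: diff_divide_distrib sum_divide_distrib sum_negf)
      finally show ?thesis .
    qed
    note H\<rho> = this
    show ?thesis
    proof (intro exI allI impI)
      fix c assume "c \<le> n"
      thus "H \<rho> c = - v 0 / v (n + 1) * a c + (- v 1 / v (n + 1)) * b c +
        (\<Sum>z\<in>{z \<in> set \<kappa>. z < \<kappa> ! s}. (- w z / v (n + 1)) * H z c)" by (rule H\<rho>)
    qed
  qed
  then obtain x y v where *: "\<And>c. c \<le> n \<Longrightarrow> H \<rho> c = x * a c + y * b c +
      (\<Sum>z\<in>{z \<in> set \<kappa>. z < \<kappa> ! s}. v z * H z c)" by blast
  have "(\<Sum>z\<in>{z \<in> set \<kappa>. z < \<kappa> ! s}. v z * H z c) = (\<Sum>l<s. v (\<kappa> ! l) * H (\<kappa> ! l) c)" for c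
  proof -
    have "{z \<in> set \<kappa>. z < \<kappa> ! s} = (!) \<kappa> ` {..<s}"
    proof (intro equalityI subsetI)
      fix z assume "z \<in> {z \<in> set \<kappa>. z < \<kappa> ! s}"
      then obtain l where l: "l < n - 1" "z = \<kappa> ! l" "\<kappa> ! l < \<kappa> ! s" using \<kappa>(1) by (auto simp: in_set_conv_nth)
      hence "l < s" using less[of s l] by (metis linorder_neqE_nat order_less_asym)
      thus "z \<in> (!) \<kappa> ` {..<s}" using l by blast
    qed (use s less \<kappa>(1) in auto)
    moreover have "inj_on ((!) \<kappa>) {..<s}" using dist s(1) \<kappa>(1) by (auto simp: inj_on_nth)
    ultimately show ?thesis by (simp add: sum.reindex)
  qed
  hence "\<forall>c\<le>n. H \<rho> c = x * a c + y * b c + (\<Sum>l<s. v (\<kappa> ! l) * H (\<kappa> ! l) c)" using * by simp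
  note H\<rho> = this[rule_format]
  show ?thesis
  proof (intro exI allI impI)
    fix c assume "c \<le> n"
    thus "H \<rho> c = x * a c + y * b c + (\<Sum>l<s. v (\<kappa> ! l) * H (\<kappa> ! l) c)" by (rule H\<rho>)
  qed
qed

text \<open>Terms of lower order in the rows do not matter: by minimality they are combinations of the
  earlier rows, so the new matrix is the old one multiplied by a triangular matrix.\<close>

lemma det_rows_mat_triangular:
  assumes n: "n \<ge> 2" and \<kappa>: "length \<kappa> = n - 1" "sorted_wrt (<) \<kappa>"
    and nz: "det (rows_mat n a b H \<kappa>) \<noteq> (0 :: 'b::field)"
    and min: "\<And>\<rho>. length \<rho> = n - 1 \<Longrightarrow> sorted_wrt (<) \<rho> \<Longrightarrow> det (rows_mat n a b H \<rho>) \<noteq> 0 \<Longrightarrow>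
       \<kappa> = \<rho> \<or> (\<kappa>, \<rho>) \<in> lexord less_than"
    and a': "\<And>c. c \<le> n \<Longrightarrow> a' c = \<alpha> * a c" and b': "\<And>c. c \<le> n \<Longrightarrow> b' c = \<beta> * b c"
    and H': "\<And>s c. s < n - 1 \<Longrightarrow> c \<le> n \<Longrightarrow>
       H' (\<kappa> ! s) c = \<gamma> s * H (\<kappa> ! s) c + (\<Sum>\<rho><\<kappa> ! s. e s \<rho> * H \<rho> c)"
  shows "det (rows_mat n a' b' H' \<kappa>) = \<alpha> * \<beta> * (\<Prod>s<n - 1. \<gamma> s) * det (rows_mat n a b H \<kappa>)"
proof -
  define comb where "comb s \<rho> t \<longleftrightarrow> (\<forall>c\<le>n. H \<rho> c = fst t * a c + fst (snd t) * b c +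
      (\<Sum>l<s. snd (snd t) l * H (\<kappa> ! l) c))" for s \<rho> t
  define coef where "coef s \<rho> = (SOME t. comb s \<rho> t)" for s \<rho>
  define x where "x s \<rho> = fst (coef s \<rho>)" for s \<rho>
  define y where "y s \<rho> = fst (snd (coef s \<rho>))" for s \<rho>
  define v where "v s \<rho> = snd (snd (coef s \<rho>))" for s \<rho>
  have xyv: "H \<rho> c = x s \<rho> * a c + y s \<rho> * b c + (\<Sum>l<s. v s \<rho> l * H (\<kappa> ! l) c)"
    if s: "s < n - 1" "\<rho> < \<kappa> ! s" and c: "c \<le> n" for s \<rho> c
  proof -
    obtain x' y' v' where "\<forall>c\<le>n. H \<rho> c = x' * a c + y' * b c + (\<Sum>l<s. v' l * H (\<kappa> ! l) c)"
      using minimal_orders_span[OF n \<kappa> nz min s] by blast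
    hence "comb s \<rho> (x', y', v')" by (simp add: comb_def)
    hence "comb s \<rho> (coef s \<rho>)" unfolding coef_def by (rule someI)
    thus ?thesis using c by (simp add: comb_def x_def y_def v_def)
  qed
  define cx where "cx s = (\<Sum>\<rho><\<kappa> ! s. e s \<rho> * x s \<rho>)" for s
  define cy where "cy s = (\<Sum>\<rho><\<kappa> ! s. e s \<rho> * y s \<rho>)" for s
  define cv where "cv s l = (\<Sum>\<rho><\<kappa> ! s. e s \<rho> * v s \<rho> l)" for s l
  have row: "H' (\<kappa> ! s) c = cx s * a c + cy s * b c + (\<Sum>l<s. cv s l * H (\<kappa> ! l) c) + \<gamma> s * H (\<kappa> ! s) c"
    if "s < n - 1" "c \<le> n" for s c
  proof -
    have "(\<Sum>\<rho><\<kappa> ! s. e s \<rho> * H \<rho> c) =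
        (\<Sum>\<rho><\<kappa> ! s. e s \<rho> * x s \<rho> * a c + e s \<rho> * y s \<rho> * b c + (\<Sum>l<s. e s \<rho> * v s \<rho> l * H (\<kappa> ! l) c))"
      by (rule sum.cong) (auto simp: xyv[OF that(1) _ that(2)] algebra_simps sum_distrib_left)
    also have "\<dots> = cx s * a c + cy s * b c + (\<Sum>\<rho><\<kappa> ! s. \<Sum>l<s. e s \<rho> * v s \<rho> l * H (\<kappa> ! l) c)"
      by (simp add: sum.distrib cx_def cy_def sum_distrib_right)
    also have "(\<Sum>\<rho><\<kappa> ! s. \<Sum>l<s. e s \<rho> * v s \<rho> l * H (\<kappa> ! l) c) = (\<Sum>l<s. cv s l * H (\<kappa> ! l) c)"
      by (subst sum.swap) (simp add: cv_def sum_distrib_right)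
    finally show ?thesis using H'[OF that] by simp
  qed
  define B where "B r k = (if r = 0 then if k = 0 then \<alpha> else 0 else if r = 1 then if k = 1 then \<beta> else 0
    else if k = 0 then cx (r - 2) else if k = 1 then cy (r - 2) else if k < r then cv (r - 2) (k - 2)
    else if k = r then \<gamma> (r - 2) else 0)" for r k :: nat
  let ?B = "mat (n + 1) (n + 1) (\<lambda>(r, k). B r k)"
  define m where "m r c = (if r = 0 then a c else if r = 1 then b c else H (\<kappa> ! (r - 2)) c)" for r c
  have N: "n + 1 = Suc (Suc (n - 1))" using n by simp
  have "rows_mat n a' b' H' \<kappa> = ?B * rows_mat n a b H \<kappa>"
  proof (rule eq_matI)
    fix r c assume "r < dim_row (?B * rows_mat n a b H \<kappa>)" "c < dim_col (?B * rows_mat n a b H \<kappa>)"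
    hence r: "r < n + 1" and c: "c < n + 1" by (auto simp: rows_mat_def)
    have "(?B * rows_mat n a b H \<kappa>) $$ (r, c) = (\<Sum>k<n + 1. B r k * m k c)"
      using r c by (simp add: rows_mat_def scalar_prod_def atLeast0LessThan m_def)
    also have "\<dots> = B r 0 * a c + B r 1 * b c + (\<Sum>l<n - 1. B r (l + 2) * H (\<kappa> ! l) c)"
      unfolding N sum_lessThan_Suc_Suc by (simp add: m_def)
    also have "\<dots> = rows_mat n a' b' H' \<kappa> $$ (r, c)"
    proof (cases "r < 2")
      case True
      hence "r = 0 \<or> r = 1" by auto
      thus ?thesis using r c n a' b' by (auto simp: B_def rows_mat_def)
    next
      case False
      define s where "s = r - 2"
      have s: "s < n - 1" "r = s + 2" using False r by (auto simp: s_def)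
      have "(\<Sum>l<n - 1. B r (l + 2) * H (\<kappa> ! l) c) = (\<Sum>l\<in>insert s {..<s}. B r (l + 2) * H (\<kappa> ! l) c)"
        using s by (intro sum.mono_neutral_right) (auto simp: B_def)
      also have "\<dots> = (\<Sum>l<s. cv s l * H (\<kappa> ! l) c) + \<gamma> s * H (\<kappa> ! s) c"
        using s by (simp add: B_def)
      finally show ?thesis using row[OF s(1), of c] s c by (simp add: B_def rows_mat_def)
    qed
    finally show "rows_mat n a' b' H' \<kappa> $$ (r, c) = (?B * rows_mat n a b H \<kappa>) $$ (r, c)" ..
  qed (auto simp: rows_mat_def)
  moreover have "det ?B = prod_list (diag_mat ?B)"
    by (rule det_lower_triangular[of "n + 1"]) (auto simp: B_def)
  moreover have "prod_list (diag_mat ?B) = (\<Prod>r<n + 1. B r r)"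
    by (simp add: prod_list_diag_prod atLeast0LessThan)
  moreover have "(\<Prod>r<n + 1. B r r) = \<alpha> * \<beta> * (\<Prod>s<n - 1. \<gamma> s)"
    unfolding N prod.lessThan_Suc_shift by (simp add: B_def mult.assoc)
  ultimately show ?thesis
    using det_mult[of ?B "n + 1" "rows_mat n a b H \<kappa>"] by (simp add: rows_mat_def)
qed

section \<open>Orders of vanishing of the determinants\<close>

text \<open>The determinants have two special rows \<open>y\<close> and \<open>z\<close> and rows \<open>d s\<close> whose entry in column
  \<open>i\<close> vanishes to order \<open>j i - \<kappa> s\<close>, with leading part \<open>bb s i\<close>. Multiplying the rows by \<open>X ^ \<kappa> s\<close>
  avoids negative exponents.\<close>

locale graded_rows =
  fixes n :: nat and j \<kappa> :: "nat \<Rightarrow> nat" and d bb :: "nat \<Rightarrow> nat \<Rightarrow> 'k::field fps"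
  assumes n: "n \<ge> 2" and j_less: "\<And>i i'. i < i' \<Longrightarrow> i' \<le> n \<Longrightarrow> j i < j i'" and j_0: "j 0 = 0"
    and bb: "\<And>s i. s < n - 1 \<Longrightarrow> i \<le> n \<Longrightarrow> fps_X ^ \<kappa> s * d s i = fps_X ^ j i * bb s i"
begin

definition bordered_det :: "(nat \<Rightarrow> 'k fps) \<Rightarrow> (nat \<Rightarrow> 'k fps) \<Rightarrow> 'k fps" where
  "bordered_det y z = det (mat (n + 1) (n + 1) (\<lambda>(r, c).
     if r = 0 then y c else if r = 1 then z c else d (r - 2) c))"

definition minor :: "(nat \<Rightarrow> nat) \<Rightarrow> 'k fps" where
  "minor \<theta> = det (mat (n - 1) (n - 1) (\<lambda>(s, c). bb s (\<theta> c)))"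

lemma minor_cong: "(\<And>c. c < n - 1 \<Longrightarrow> \<theta> c = \<theta>' c) \<Longrightarrow> minor \<theta> = minor \<theta>'"
  unfolding minor_def by (rule arg_cong[of _ _ det]) (auto intro!: eq_matI)

lemma minor_nth_0: "minor \<theta> $ 0 = det (mat (n - 1) (n - 1) (\<lambda>(s, c). bb s (\<theta> c) $ 0))"
proof -
  interpret h: comm_ring_hom "\<lambda>f :: 'k fps. f $ 0" by unfold_locales auto
  have "map_mat (\<lambda>f. f $ 0) (mat (n - 1) (n - 1) (\<lambda>(s, c). bb s (\<theta> c))) =
      mat (n - 1) (n - 1) (\<lambda>(s, c). bb s (\<theta> c) $ 0)"
    by (intro eq_matI) auto
  thus ?thesis unfolding minor_def by (metis h.hom_det)
qed

definition weight :: "nat \<Rightarrow> nat \<Rightarrow> nat" where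
  "weight a b = (\<Sum>c<n - 1. j (skip a (skip b c)))"

lemma weight_eq:
  assumes "a \<le> n" "b \<le> n - 1" shows "weight a b + j (skip a b) + j a = (\<Sum>i\<le>n. j i)"
proof -
  have "weight a b + j (skip a b) = (\<Sum>c\<le>n - 1. j (skip a c))"
    unfolding weight_def using sum_skip[OF assms(2), of "\<lambda>i. j (skip a i)"] by simp
  also have "{..n - 1} = {..<n}" using n by auto
  finally show ?thesis using sum_skip[OF assms(1), of j] by simp
qed

lemma bordered_det_expansion:
  "fps_X ^ (\<Sum>s<n - 1. \<kappa> s) * bordered_det y z = (\<Sum>a\<le>n. \<Sum>b\<le>n - 1.
     (-1) ^ (a + b) * y a * z (skip a b) * (fps_X ^ weight a b * minor (\<lambda>c. skip a (skip b c))))"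
proof -
  have N: "n + 1 = Suc (Suc (n - 1))" "Suc (n - 1) = n" using n by auto
  have minor: "fps_X ^ (\<Sum>s<n - 1. \<kappa> s) * det (mat (n - 1) (n - 1) (\<lambda>(s, c). d s (skip a (skip b c)))) =
      fps_X ^ weight a b * minor (\<lambda>c. skip a (skip b c))" if ab: "a \<le> n" "b \<le> n - 1" for a b
  proof -
    let ?\<theta> = "\<lambda>c. skip a (skip b c)"
    have \<theta>: "?\<theta> c \<le> n" if "c < n - 1" for c using that by (auto simp: skip_def)
    have "fps_X ^ (\<Sum>s<n - 1. \<kappa> s) * det (mat (n - 1) (n - 1) (\<lambda>(s, c). d s (?\<theta> c))) =
        det (mat (n - 1) (n - 1) (\<lambda>(s, c). fps_X ^ \<kappa> s * (1 * d s (?\<theta> c))))"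
      unfolding det_scale_rows_cols by (simp add: power_sum)
    also have "\<dots> = det (mat (n - 1) (n - 1) (\<lambda>(s, c). 1 * (fps_X ^ j (?\<theta> c) * bb s (?\<theta> c))))"
      using bb \<theta> by (intro arg_cong[of _ _ det] eq_matI) auto
    also have "\<dots> = fps_X ^ weight a b * minor ?\<theta>"
      unfolding det_scale_rows_cols by (simp add: power_sum weight_def minor_def)
    finally show ?thesis .
  qed
  have "bordered_det y z = (\<Sum>a\<le>n. \<Sum>b\<le>n - 1. (-1) ^ (a + b) * y a * z (skip a b) *
      det (mat (n - 1) (n - 1) (\<lambda>(s, c). d s (skip a (skip b c)))))"
    unfolding bordered_det_def using det_laplace_rows_01[of "n - 1"
      "\<lambda>r c. if r = 0 then y c else if r = 1 then z c else d (r - 2) c", unfolded N(2)] by simp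
  hence "fps_X ^ (\<Sum>s<n - 1. \<kappa> s) * bordered_det y z = (\<Sum>a\<le>n. \<Sum>b\<le>n - 1.
     (-1) ^ (a + b) * y a * z (skip a b) * (fps_X ^ (\<Sum>s<n - 1. \<kappa> s) *
      det (mat (n - 1) (n - 1) (\<lambda>(s, c). d s (skip a (skip b c))))))"
    by (simp only: sum_distrib_left mult.left_commute mult.assoc)
  also have "\<dots> = (\<Sum>a\<le>n. \<Sum>b\<le>n - 1.
     (-1) ^ (a + b) * y a * z (skip a b) * (fps_X ^ weight a b * minor (\<lambda>c. skip a (skip b c))))"
    by (intro sum.cong refl) (simp only: atMost_iff minor)
  finally show ?thesis .
qed

lemma bordered_det_dvd:
  assumes "\<And>a b. a \<le> n \<Longrightarrow> b \<le> n - 1 \<Longrightarrow>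
    fps_X ^ B dvd y a * (fps_X ^ weight a b * minor (\<lambda>c. skip a (skip b c)))"
  shows "fps_X ^ B dvd fps_X ^ (\<Sum>s<n - 1. \<kappa> s) * bordered_det y z"
  unfolding bordered_det_expansion
proof (intro dvd_sum)
  fix a b assume "a \<in> {..n}" "b \<in> {..n - 1}"
  hence "fps_X ^ B dvd y a * (fps_X ^ weight a b * minor (\<lambda>c. skip a (skip b c)))"
    using assms by auto
  hence "fps_X ^ B dvd (-1) ^ (a + b) * z (skip a b) *
      (y a * (fps_X ^ weight a b * minor (\<lambda>c. skip a (skip b c))))"
    by (rule dvd_mult)
  thus "fps_X ^ B dvd (-1) ^ (a + b) * y a * z (skip a b) *
      (fps_X ^ weight a b * minor (\<lambda>c. skip a (skip b c)))"
    by (simp add: mult_ac)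
qed

lemma j_le: "i \<le> i' \<Longrightarrow> i' \<le> n \<Longrightarrow> j i \<le> j i'"
  using j_less[of i i'] by (cases "i = i'") auto

lemma fps_X_dvd_iff: "fps_X dvd f \<longleftrightarrow> f $ 0 = (0 :: 'k)"
proof
  assume "f $ 0 = 0"
  hence "f $ n = (fps_X * fps_shift 1 f) $ n" for n by (cases n) simp_all
  hence "f = fps_X * fps_shift 1 f" by (rule fps_ext)
  thus "fps_X dvd f" by (metis dvd_triv_left)
qed (auto elim!: dvdE)

lemma fps_X_power_mult_dvd:
  assumes "B \<le> e + e' \<or> (B \<le> Suc (e + e') \<and> h $ 0 = (0 :: 'k))" "fps_X ^ e dvd f"
  shows "fps_X ^ B dvd f * (fps_X ^ e' * h)"
proof -
  obtain f' where f: "f = fps_X ^ e * f'" using assms(2) by (auto elim: dvdE)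
  have *: "f * (fps_X ^ e' * h) = fps_X ^ (e + e') * h * f'" by (simp add: f power_add mult_ac)
  from assms(1) show ?thesis
  proof (elim disjE conjE)
    assume "B \<le> e + e'"
    thus ?thesis unfolding * by (intro dvd_mult2 le_imp_power_dvd)
  next
    assume B: "B \<le> Suc (e + e')" "h $ 0 = 0"
    have "fps_X ^ B dvd fps_X ^ Suc (e + e')" using B by (intro le_imp_power_dvd)
    also have "\<dots> dvd fps_X ^ (e + e') * h"
      using B fps_X_dvd_iff[of h] by (auto simp: mult.commute intro: mult_dvd_mono)
    finally show ?thesis unfolding * by (rule dvd_mult2)
  qed
qed

lemma orders_sum_split: "(\<Sum>i\<le>n. j i) = (\<Sum>i\<le>n - 2. j i) + j (n - 1) + j n"
proof -
  have "n = Suc (Suc (n - 2))" using n by simp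
  hence "(\<Sum>i\<le>n. j i) = (\<Sum>i\<le>Suc (Suc (n - 2)). j i)" by simp
  also have "\<dots> = (\<Sum>i\<le>n - 2. j i) + j (Suc (n - 2)) + j (Suc (Suc (n - 2)))" by simp
  finally show ?thesis using n by (simp add: numeral_2_eq_2 Suc_diff_Suc)
qed

text \<open>Among the minors, the one avoiding the two last columns has the least order.\<close>

lemma bordered_det_order:
  assumes y: "\<And>a. a \<le> n \<Longrightarrow> fps_X ^ e dvd y a"
  shows "fps_X ^ (e + (\<Sum>i\<le>n - 2. j i)) dvd fps_X ^ (\<Sum>s<n - 1. \<kappa> s) * bordered_det y z"
    and "minor id $ 0 = 0 \<Longrightarrow>
      fps_X ^ Suc (e + (\<Sum>i\<le>n - 2. j i)) dvd fps_X ^ (\<Sum>s<n - 1. \<kappa> s) * bordered_det y z"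
proof -
  have ord: "weight a b \<ge> (\<Sum>i\<le>n - 2. j i) \<and> (weight a b > (\<Sum>i\<le>n - 2. j i) \<or>
      minor (\<lambda>c. skip a (skip b c)) = minor id)" if ab: "a \<le> n" "b \<le> n - 1" for a b
  proof -
    have b': "skip a b \<le> n" "skip a b \<noteq> a" using ab n by (auto simp: skip_def)
    have eq: "weight a b + (j (skip a b) + j a) = (\<Sum>i\<le>n - 2. j i) + (j (n - 1) + j n)"
      using weight_eq[OF ab] orders_sum_split by simp
    have two: "j x + j x' \<le> j (n - 1) + j n \<and> (j x + j x' < j (n - 1) + j n \<or> x = n - 1 \<and> x' = n)"
      if "x < x'" "x' \<le> n" for x x'
    proof (cases "x' = n")
      case True
      hence "x \<le> n - 1" using that by simp
      thus ?thesis using True j_less[of x "n - 1"] n by (cases "x = n - 1") auto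
    next
      case False
      hence "j x' < j n" "j x \<le> j (n - 1)" using that j_less[of x' n] j_le[of x "n - 1"] by auto
      thus ?thesis by simp
    qed
    show ?thesis
    proof (cases "(a = n - 1 \<and> skip a b = n) \<or> (a = n \<and> skip a b = n - 1)")
      case True
      have "minor (\<lambda>c. skip a (skip b c)) = minor id"
        using True ab n by (intro minor_cong) (auto simp: skip_def split: if_splits)
      moreover have "weight a b = (\<Sum>i\<le>n - 2. j i)" using eq True by auto
      ultimately show ?thesis by simp
    next
      case False
      hence "j (skip a b) + j a < j (n - 1) + j n"
        using two[of a "skip a b"] two[of "skip a b" a] b' ab by (cases "a < skip a b") auto
      thus ?thesis using eq by simp
    qed
  qed
  show "fps_X ^ (e + (\<Sum>i\<le>n - 2. j i)) dvd fps_X ^ (\<Sum>s<n - 1. \<kappa> s) * bordered_det y z"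
    by (intro bordered_det_dvd fps_X_power_mult_dvd[of _ e]) (use y ord in auto)
  assume z: "minor id $ 0 = 0"
  show "fps_X ^ Suc (e + (\<Sum>i\<le>n - 2. j i)) dvd fps_X ^ (\<Sum>s<n - 1. \<kappa> s) * bordered_det y z"
  proof (intro bordered_det_dvd fps_X_power_mult_dvd[of _ e])
    fix a b assume "a \<le> n" "b \<le> n - 1"
    thus "Suc (e + (\<Sum>i\<le>n - 2. j i)) \<le> e + weight a b \<or>
       Suc (e + (\<Sum>i\<le>n - 2. j i)) \<le> Suc (e + weight a b) \<and> minor (\<lambda>c. skip a (skip b c)) $ 0 = 0"
      using ord[of a b] z by auto
  qed (use y in auto)
qed

lemma orders_sum_split': "(\<Sum>i\<le>n. j i) = (\<Sum>i=1..n - 1. j i) + j n"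
proof -
  have "{..n} = insert n (insert 0 {1..n - 1})" using n by auto
  thus ?thesis using n j_0 by simp
qed

text \<open>Taking the column \<open>0\<close> for the row \<open>y\<close> is best: any other column costs \<open>Q * j a > j a\<close>.\<close>

lemma bordered_det_order_power:
  assumes y: "\<And>a. a \<le> n \<Longrightarrow> fps_X ^ (Q * j a) dvd y a" and Q: "Q \<ge> 2"
  shows "fps_X ^ (\<Sum>i=1..n - 1. j i) dvd fps_X ^ (\<Sum>s<n - 1. \<kappa> s) * bordered_det y z"
    and "minor Suc $ 0 = 0 \<Longrightarrow>
      fps_X ^ Suc (\<Sum>i=1..n - 1. j i) dvd fps_X ^ (\<Sum>s<n - 1. \<kappa> s) * bordered_det y z"
proof -
  have ord: "Q * j a + weight a b \<ge> (\<Sum>i=1..n - 1. j i) \<and> (Q * j a + weight a b > (\<Sum>i=1..n - 1. j i) \<or>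
      minor (\<lambda>c. skip a (skip b c)) = minor Suc)" if ab: "a \<le> n" "b \<le> n - 1" for a b
  proof -
    have b': "skip a b \<le> n" "skip a b \<noteq> a" using ab n by (auto simp: skip_def)
    have eq: "weight a b + j a + j (skip a b) = (\<Sum>i=1..n - 1. j i) + j n"
      using weight_eq[OF ab] orders_sum_split' by simp
    have jb: "j (skip a b) \<le> j n" using b' by (intro j_le) auto
    show ?thesis
    proof (cases "a = 0")
      case True
      show ?thesis
      proof (cases "skip a b = n")
        case eqn: True
        have "minor (\<lambda>c. skip a (skip b c)) = minor Suc"
          using eqn True ab n by (intro minor_cong) (auto simp: skip_def split: if_splits)
        moreover have "weight a b = (\<Sum>i=1..n - 1. j i)" using eq eqn True j_0 by simp
        ultimately show ?thesis by simp
      next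
        case False
        hence "j (skip a b) < j n" using b' by (intro j_less) auto
        thus ?thesis using eq True j_0 by simp
      qed
    next
      case False
      hence "j a > 0" using j_less[of 0 a] ab j_0 by simp
      moreover have "2 * j a \<le> Q * j a" using Q by (intro mult_right_mono) auto
      ultimately have "(\<Sum>i=1..n - 1. j i) < Q * j a + weight a b" using eq jb by linarith
      thus ?thesis by simp
    qed
  qed
  show "fps_X ^ (\<Sum>i=1..n - 1. j i) dvd fps_X ^ (\<Sum>s<n - 1. \<kappa> s) * bordered_det y z"
  proof (intro bordered_det_dvd)
    fix a b assume "a \<le> n" "b \<le> n - 1"
    thus "fps_X ^ (\<Sum>i=1..n - 1. j i) dvd y a * (fps_X ^ weight a b * minor (\<lambda>c. skip a (skip b c)))"
      using ord by (intro fps_X_power_mult_dvd[of _ "Q * j a"] y) auto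
  qed
  assume z: "minor Suc $ 0 = 0"
  show "fps_X ^ Suc (\<Sum>i=1..n - 1. j i) dvd fps_X ^ (\<Sum>s<n - 1. \<kappa> s) * bordered_det y z"
  proof (intro bordered_det_dvd)
    fix a b assume "a \<le> n" "b \<le> n - 1"
    thus "fps_X ^ Suc (\<Sum>i=1..n - 1. j i) dvd y a * (fps_X ^ weight a b * minor (\<lambda>c. skip a (skip b c)))"
      using ord[of a b] z by (intro fps_X_power_mult_dvd[of _ "Q * j a"] y) auto
  qed
qed

lemma minor_zero_column:
  assumes "c < n - 1" "\<And>s. s < n - 1 \<Longrightarrow> bb s (\<theta> c) = 0" shows "minor \<theta> = 0"
proof -
  have "minor \<theta> = (\<Sum>i<n - 1. mat (n - 1) (n - 1) (\<lambda>(s, c). bb s (\<theta> c)) $$ (i, c) *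
      cofactor (mat (n - 1) (n - 1) (\<lambda>(s, c). bb s (\<theta> c))) i c)"
    unfolding minor_def using assms(1) by (intro laplace_expansion_column) auto
  also have "\<dots> = 0" using assms by (intro sum.neutral) auto
  finally show ?thesis .
qed

text \<open>If the first column is \<open>(0, 1, 0, \<dots>, 0)\<close>, then only the terms with \<open>b = 0\<close> remain, and the
  one with \<open>a = 1\<close> has the least order, since the exponents of \<open>y\<close> are multiplied by \<open>Q\<close>.\<close>

lemma bordered_det_order_exact:
  assumes y: "\<And>a. a \<le> n \<Longrightarrow> fps_X ^ (Q * j a) dvd y a" "y 0 = 0" "y 1 = fps_X ^ (Q * j 1) * \<eta>" and Q: "Q \<ge> 2"
    and z: "z 0 = 1" and bb0: "\<And>s. s < n - 1 \<Longrightarrow> bb s 0 = 0"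
  defines "B \<equiv> Q * j 1 + (\<Sum>i\<le>n - 2. j (i + 2))"
  shows "\<exists>h. fps_X ^ (\<Sum>s<n - 1. \<kappa> s) * bordered_det y z =
    fps_X ^ B * (- (\<eta> * minor (\<lambda>c. c + 2)) + fps_X * h)"
proof -
  let ?t = "\<lambda>a b. (-1) ^ (a + b) * y a * z (skip a b) * (fps_X ^ weight a b * minor (\<lambda>c. skip a (skip b c)))"
  have sum: "(\<Sum>i\<le>n. j i) = j 1 + (\<Sum>i\<le>n - 2. j (i + 2))"
  proof -
    have "{..n} = insert 0 (insert 1 ((\<lambda>i. i + 2) ` {..n - 2}))"
    proof
      show "{..n} \<subseteq> insert 0 (insert 1 ((\<lambda>i. i + 2) ` {..n - 2}))"
      proof
        fix x assume "x \<in> {..n}"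
        hence "x = 0 \<or> x = 1 \<or> x = (x - 2) + 2 \<and> x - 2 \<in> {..n - 2}" by auto
        thus "x \<in> insert 0 (insert 1 ((\<lambda>i. i + 2) ` {..n - 2}))" by blast
      qed
    qed (use n in auto)
    also have "(\<Sum>i\<in>insert 0 (insert 1 ((\<lambda>i. i + 2) ` {..n - 2})). j i) = j 0 + (j 1 + (\<Sum>i\<in>(\<lambda>i. i + 2) ` {..n - 2}. j i))"
      by (subst sum.insert, simp, fastforce, subst sum.insert) auto
    also have "(\<Sum>i\<in>(\<lambda>i. i + 2) ` {..n - 2}. j i) = (\<Sum>i\<le>n - 2. j (i + 2))"
      by (subst sum.reindex) (auto simp: inj_on_def)
    finally show ?thesis by (simp add: j_0)
  qed
  have w: "weight a 0 + j a = (\<Sum>i\<le>n. j i)" if "a \<noteq> 0" "a \<le> n" for a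
    using weight_eq[of a 0] that j_0 by (simp add: skip_def)
  have w1: "weight 1 0 = (\<Sum>i\<le>n - 2. j (i + 2))" using w[of 1] sum n by simp
  have t0: "?t a b = 0" if "a \<le> n" "b \<le> n - 1" "a = 0 \<or> b \<noteq> 0" for a b
  proof (cases "a = 0")
    case True
    thus ?thesis by (simp add: y)
  next
    case False
    hence "minor (\<lambda>c. skip a (skip b c)) = 0"
      using that bb0 n by (intro minor_zero_column[of 0]) (auto simp: skip_def)
    thus ?thesis by simp
  qed
  have ta: "fps_X ^ Suc B dvd ?t a 0" if "2 \<le> a" "a \<le> n" for a
  proof -
    have "j 1 < j a" using that by (intro j_less) auto
    then obtain k where k: "j a = Suc (j 1 + k)" using less_imp_Suc_add by blast
    have "weight a 0 + j a = (\<Sum>i\<le>n - 2. j (i + 2)) + j 1" using w[of a] sum that by simp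
    moreover have "Q * j a = Q * j 1 + Q * Suc k" by (simp add: k algebra_simps)
    moreover have "Q * Suc k \<ge> 2 * Suc k" using Q by (intro mult_right_mono) auto
    ultimately have "Suc B \<le> Q * j a + weight a 0" unfolding B_def using k by simp
    hence "fps_X ^ Suc B dvd y a * (fps_X ^ weight a 0 * minor (\<lambda>c. skip a (skip 0 c)))"
      using that by (intro fps_X_power_mult_dvd[of _ "Q * j a"] y) auto
    hence "fps_X ^ Suc B dvd ((-1) ^ (a + 0) * z (skip a 0)) * (y a * (fps_X ^ weight a 0 * minor (\<lambda>c. skip a (skip 0 c))))"
      by (rule dvd_mult)
    thus ?thesis by (simp add: mult_ac)
  qed
  have "fps_X ^ (\<Sum>s<n - 1. \<kappa> s) * bordered_det y z = (\<Sum>a\<le>n. ?t a 0)"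
    unfolding bordered_det_expansion
  proof (intro sum.cong refl)
    fix a assume "a \<in> {..n}"
    hence "(\<Sum>b\<le>n - 1. ?t a b) = (\<Sum>b\<in>{0}. ?t a b)"
      using t0[of a] by (intro sum.mono_neutral_right) auto
    thus "(\<Sum>b\<le>n - 1. ?t a b) = ?t a 0" by simp
  qed
  also have "\<dots> = (\<Sum>a\<in>insert 1 {2..n}. ?t a 0)"
  proof (rule sum.mono_neutral_right)
    show "\<forall>a\<in>{..n} - insert 1 {2..n}. ?t a 0 = 0"
    proof
      fix a assume "a \<in> {..n} - insert 1 {2..n}"
      hence "a = 0" by auto
      thus "?t a 0 = 0" using t0[of 0 0] by simp
    qed
  qed (use n in auto)
  also have "\<dots> = ?t 1 0 + (\<Sum>a\<in>{2..n}. ?t a 0)" by (rule sum.insert) auto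
  also have "minor (\<lambda>c. skip 1 (skip 0 c)) = minor (\<lambda>c. c + 2)"
    by (rule minor_cong) (auto simp: skip_def)
  hence "?t 1 0 = fps_X ^ B * (- (\<eta> * minor (\<lambda>c. c + 2)))"
    by (simp add: y(3)[simplified] w1[simplified] z B_def skip_def power_add mult_ac)
  also have "fps_X ^ Suc B dvd (\<Sum>a\<in>{2..n}. ?t a 0)" by (intro dvd_sum ta) auto
  then obtain h where "(\<Sum>a\<in>{2..n}. ?t a 0) = fps_X ^ Suc B * h" by (auto elim: dvdE)
  finally have "fps_X ^ (\<Sum>s<n - 1. \<kappa> s) * bordered_det y z =
    fps_X ^ B * (- (\<eta> * minor (\<lambda>c. c + 2)) + fps_X * h)"
    by (simp add: algebra_simps)
  thus ?thesis by blast
qed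

end

section \<open>The places of a curve\<close>

lemma prime_CHAR_finite_field: "prime CHAR('a::{field,finite})"
  by (intro prime_CHAR_semidom finite_imp_CHAR_pos) simp

lemma nonsingular_projective_curveD:
  fixes C :: "('v::finite, 'a::{field,finite} alg_closure) point set" and \<iota> :: "'a alg_closure \<Rightarrow> 'f::field"
  assumes "nonsingular_projective_curve C \<iota> \<xi>"
  shows "function_field C \<iota> \<xi>" "C \<subseteq> proj_space" "proj_closed (to_ac :: 'a \<Rightarrow> 'a alg_closure) C"
    "tr_deg_one \<iota>" "P \<in> C \<Longrightarrow> \<exists>\<pi>. local_parameter \<iota> \<xi> P \<pi>"
proof -
  show "function_field C \<iota> \<xi>" "proj_closed (to_ac :: 'a \<Rightarrow> 'a alg_closure) C"
    "tr_deg_one \<iota>" "P \<in> C \<Longrightarrow> \<exists>\<pi>. local_parameter \<iota> \<xi> P \<pi>"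
    using assms unfolding nonsingular_projective_curve_def by blast+
  thus "C \<subseteq> proj_space" unfolding proj_closed_def by blast
qed

lemma curve_point_of_curve:
  fixes C :: "('v::finite, 'a::{field,finite} alg_closure) point set"
  assumes "nonsingular_projective_curve C \<iota> \<xi>" "P \<in> C" shows "curve_point C \<iota> \<xi> P"
  by unfold_locales (use nonsingular_projective_curveD[OF assms(1)] assms(2) in auto)

definition value_at :: "('k::field \<Rightarrow> 'f::field) \<Rightarrow> ('v::finite \<Rightarrow> 'f) \<Rightarrow> ('v, 'k) point \<Rightarrow> 'f \<Rightarrow> 'k" where
  "value_at \<iota> \<xi> P g = (THE c. takes_value \<iota> \<xi> P g c)"

lemma (in curve_point) value_at_eq: "takes_value \<iota> \<xi> P g c \<Longrightarrow> value_at \<iota> \<xi> P g = c"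
  unfolding value_at_def using takes_value_unique by blast

lemma (in curve_point) takes_value_value_at: "g \<in> local_ring \<iota> \<xi> P \<Longrightarrow> takes_value \<iota> \<xi> P g (value_at \<iota> \<xi> P g)"
  using value_at_eq unfolding local_ring_def by blast

lemma (in curve_point) max_ideal_eq: "max_ideal \<iota> \<xi> P = {g \<in> local_ring \<iota> \<xi> P. value_at \<iota> \<xi> P g = 0}"
  using takes_value_value_at value_at_eq unfolding max_ideal_def local_ring_def by force

lemma place_of_curve:
  fixes C :: "('v::finite, 'a::{field,finite} alg_closure) point set" and \<iota> :: "'a alg_closure \<Rightarrow> 'f::field"
  assumes curve: "nonsingular_projective_curve C \<iota> \<xi>" and P: "P \<in> C"
  shows "place \<iota> (local_ring \<iota> \<xi> P) (value_at \<iota> \<xi> P)"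
proof -
  interpret curve_point C \<iota> \<xi> P by (rule curve_point_of_curve[OF assms])
  note tv = takes_value_value_at
  obtain t where t: "transcendental_over \<iota> t" "\<And>g. algebraic_over (simple_ext \<iota> t) g"
    using nonsingular_projective_curveD(4)[OF curve] unfolding tr_deg_one_def by blast
  show ?thesis
  proof
    fix c g h
    show "\<iota> c \<in> local_ring \<iota> \<xi> P" using takes_value_const unfolding local_ring_def by blast
    show "value_at \<iota> \<xi> P (\<iota> c) = c" by (rule value_at_eq[OF takes_value_const])
    show "alg_dependent \<iota> g h" by (rule const.alg_dependent_if_algebraic[OF t(2) t(2)])
    show "\<exists>a b. a \<in> local_ring \<iota> \<xi> P \<and> b \<in> local_ring \<iota> \<xi> P \<and> b \<noteq> 0 \<and> g = a / b"
      by (rule fraction_of_regular)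
    assume g: "g \<in> local_ring \<iota> \<xi> P"
    show "inverse g \<in> local_ring \<iota> \<xi> P" if "value_at \<iota> \<xi> P g \<noteq> 0"
      using takes_value_inverse[OF tv[OF g] that] unfolding local_ring_def by blast
    assume h: "h \<in> local_ring \<iota> \<xi> P"
    show "g + h \<in> local_ring \<iota> \<xi> P" "g * h \<in> local_ring \<iota> \<xi> P"
      using takes_value_add[OF tv[OF g] tv[OF h]] takes_value_mult[OF tv[OF g] tv[OF h]]
      unfolding local_ring_def by blast+
    show "value_at \<iota> \<xi> P (g + h) = value_at \<iota> \<xi> P g + value_at \<iota> \<xi> P h"
      "value_at \<iota> \<xi> P (g * h) = value_at \<iota> \<xi> P g * value_at \<iota> \<xi> P h"
      using takes_value_add[OF tv[OF g] tv[OF h]] takes_value_mult[OF tv[OF g] tv[OF h]]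
      by (auto intro: value_at_eq)
  next
    show "\<exists>g. g \<notin> range \<iota>"
    proof (rule exI[of _ t], rule notI)
      assume "t \<in> range \<iota>"
      then obtain c where "t = \<iota> c" by blast
      hence "poly (map_poly \<iota> [:- c, 1:]) t = 0" by (simp add: map_poly_pCons const.hom_uminus)
      thus False using t(1) unfolding transcendental_over_def by fastforce
    qed
    show "prime CHAR('a alg_closure)" using prime_CHAR_finite_field[where 'a='a] by simp
    show "\<exists>b. b ^ CHAR('a alg_closure) = c" for c :: "'a alg_closure"
      using nth_root_exists[of "CHAR('a)" c] prime_gt_0_nat[OF prime_CHAR_finite_field[where 'a='a]]
      by simp
  qed
qed

context
  fixes C :: "('v::finite, 'a::{field,finite} alg_closure) point set" and \<iota> :: "'a alg_closure \<Rightarrow> 'f::field"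
    and \<xi> :: "'v \<Rightarrow> 'f" and P :: "('v, 'a alg_closure) point"
  assumes curve: "nonsingular_projective_curve C \<iota> \<xi>" and P: "P \<in> C"
begin

interpretation curve_point C \<iota> \<xi> P by (rule curve_point_of_curve[OF curve P])
interpretation place \<iota> "local_ring \<iota> \<xi> P" "value_at \<iota> \<xi> P" by (rule place_of_curve[OF curve P])

lemma local_parameter_iff: "local_parameter \<iota> \<xi> P \<pi> \<longleftrightarrow> place.parameter (local_ring \<iota> \<xi> P) (value_at \<iota> \<xi> P) \<pi>"
  by (simp add: local_parameter_def parameter_def max_ideal_eq)

lemma val_eq_vl: "val \<iota> \<xi> P = place.vl (local_ring \<iota> \<xi> P) (value_at \<iota> \<xi> P)"
  unfolding val_def vl_def local_parameter_iff max_ideal_eq by (rule refl)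

lemma place_param_of_curve:
  "place_param \<iota> (local_ring \<iota> \<xi> P) (value_at \<iota> \<xi> P) (SOME \<pi>. local_parameter \<iota> \<xi> P \<pi>)"
  by unfold_locales (use someI_ex[OF nonsingular_projective_curveD(5)[OF curve P]] local_parameter_iff in blast)

lemma pderiv_sum_distrib: "pderiv (sum f A) = (\<Sum>a\<in>A. pderiv (f a))"
  by (induction A rule: infinite_finite_induct) (auto simp: pderiv_add)

lemma separable_overD:
  fixes g :: "'f"
  assumes "separable_over L g"
  obtains d b where "\<And>j. j \<le> d \<Longrightarrow> b j \<in> L \<or> b j = 0" "(\<Sum>j\<le>d. b j * g ^ j) = 0"
    "(\<Sum>j\<le>d. of_nat j * b j * g ^ (j - 1)) \<noteq> 0"
proof -
  obtain B where B: "set (coeffs B) \<subseteq> L" "coprime B (pderiv B)" "poly B g = 0"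
    using assms unfolding separable_over_def by blast
  show thesis
  proof (rule that[where d = "Polynomial.degree B" and b = "poly.coeff B"])
    show "poly.coeff B j \<in> L \<or> poly.coeff B j = 0" for j
      using B(1) coeff_in_coeffs[of B j] by (cases "B = 0"; cases "j \<le> Polynomial.degree B") (auto simp: coeff_eq_0)
    show "(\<Sum>j\<le>Polynomial.degree B. poly.coeff B j * g ^ j) = 0" using B(3) by (simp add: poly_altdef)
    have "pderiv B = (\<Sum>j\<le>Polynomial.degree B. Polynomial.monom (of_nat j * poly.coeff B j) (j - 1))"
      by (subst (1) poly_as_sum_of_monoms[symmetric]) (simp only: pderiv_sum_distrib pderiv_monom)
    hence "poly (pderiv B) g = (\<Sum>j\<le>Polynomial.degree B. of_nat j * poly.coeff B j * g ^ (j - 1))"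
      by (simp only: poly_sum poly_monom)
    moreover have "poly (pderiv B) g \<noteq> 0"
    proof
      assume "poly (pderiv B) g = 0"
      hence "[:- g, 1:] dvd B" "[:- g, 1:] dvd pderiv B" using B(3) by (auto simp: poly_eq_0_iff_dvd)
      hence "is_unit [:- g, 1:]" using B(2) coprime_common_divisor by blast
      thus False by (auto dest: is_unit_pCons_iff[THEN iffD1])
    qed
    ultimately show "(\<Sum>j\<le>Polynomial.degree B. of_nat j * poly.coeff B j * g ^ (j - 1)) \<noteq> 0" by simp
  qed
qed

lemma to_ac_hom: "comm_ring_hom (to_ac :: 'a \<Rightarrow> 'a alg_closure)"
  by unfold_locales auto

lemma coord_quotient_base: "a \<in> P \<Longrightarrow> a i \<noteq> 0 \<Longrightarrow> \<xi> l / \<xi> i \<in> base_functions \<iota> \<xi>"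
proof -
  assume a: "a \<in> P" "a i \<noteq> 0"
  interpret ta: comm_ring_hom "to_ac :: 'a \<Rightarrow> 'a alg_closure" by (rule to_ac_hom)
  interpret c: comm_ring_hom "\<iota> \<circ> (to_ac :: 'a \<Rightarrow> 'a alg_closure)"
    by unfold_locales (auto simp: const.hom_add const.hom_mult)
  show ?thesis unfolding base_functions_def homog_quotients_def
    using coord_nonzero[OF a] c.mpoly_eval_coord_form[of \<xi>]
    by (intro CollectI exI[of _ "1 :: nat"] exI[of _ "coord_form l"] exI[of _ "coord_form i"] conjI
        homogeneous_coord_form) simp_all
qed

text \<open>The function field is generated by the constants and the quotients of coordinates, which are
  separable over the field generated by \<open>t\<close>.\<close>

lemma separable_variable_of_separating:
  assumes t: "separating_variable \<iota> \<xi> t" shows "separable_variable \<iota> t"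
  unfolding separable_variable_def
proof (intro allI impI)
  fix A assume A: "range \<iota> \<subseteq> A" "t \<in> A" "\<forall>g\<in>A. \<forall>h\<in>A. g + h \<in> A \<and> g * h \<in> A"
    "\<forall>g\<in>A. inverse g \<in> A"
    and sep: "\<forall>d b y. (\<forall>j\<le>d. b j \<in> A) \<longrightarrow> (\<Sum>j\<le>d. b j * y ^ j) = 0 \<longrightarrow>
        (\<Sum>j\<le>d. of_nat j * b j * y ^ (j - 1)) \<noteq> 0 \<longrightarrow> y \<in> A"
  have 01: "0 \<in> A" "1 \<in> A" using A(1) const.hom_zero const.hom_one by (metis rangeI subsetD)+
  have sum': "(\<And>i. i \<in> I \<Longrightarrow> f i \<in> A) \<Longrightarrow> sum f I \<in> A" for f and I :: "('v \<Rightarrow>\<^sub>0 nat) set"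
    by (induction I rule: infinite_finite_induct) (use A(3) 01 in auto)
  have sum'': "(\<And>i. i \<in> I \<Longrightarrow> f i \<in> A) \<Longrightarrow> sum f I \<in> A" for f and I :: "nat set"
    by (induction I rule: infinite_finite_induct) (use A(3) 01 in auto)
  have prod: "(\<And>i. i \<in> I \<Longrightarrow> f i \<in> A) \<Longrightarrow> prod f I \<in> A" for f and I :: "'v set"
    by (induction I rule: infinite_finite_induct) (use A(3) 01 in auto)
  have power: "x \<in> A \<Longrightarrow> x ^ n \<in> A" for n x by (induction n) (use A(3) 01 in auto)
  have div: "x \<in> A \<Longrightarrow> y \<in> A \<Longrightarrow> x / y \<in> A" for x y using A(3,4) by (simp add: divide_inverse)
  have poly: "poly (map_poly (\<iota> \<circ> to_ac) p) t \<in> A" for p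
    unfolding poly_altdef using A power by (intro sum'') (auto simp: coeff_map_poly image_subset_iff)
  have base: "g \<in> A" if g: "g \<in> base_functions \<iota> \<xi>" for g
  proof -
    have "separable_over (simple_ext (\<iota> \<circ> to_ac) t) g" using t g unfolding separating_variable_def by blast
    then obtain d b where *: "\<And>j. j \<le> d \<Longrightarrow> b j \<in> simple_ext (\<iota> \<circ> to_ac) t \<or> b j = 0"
      "(\<Sum>j\<le>d. b j * g ^ j) = 0" "(\<Sum>j\<le>d. of_nat j * b j * g ^ (j - 1)) \<noteq> 0"
      by (rule separable_overD) blast
    show ?thesis
    proof (rule sep[rule_format, OF _ *(2,3)])
      fix j assume "j \<le> d"
      thus "b j \<in> A" using *(1)[of j] poly div 01 by (auto simp: simple_ext_def)
    qed
  qed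
  obtain a where a: "a \<in> P" using point_nonempty by blast
  then obtain i where i: "a i \<noteq> 0" using point_nonzero by blast
  have form: "mpoly_eval \<iota> \<xi> G / \<xi> i ^ d \<in> A" if "homogeneous d G" for d G
  proof -
    have "mpoly_eval \<iota> \<xi> G / \<xi> i ^ d = mpoly_eval \<iota> (\<lambda>l. inverse (\<xi> i) * \<xi> l) G"
      by (simp add: mpoly_eval_scale[OF that] power_inverse divide_inverse)
    also have "\<dots> \<in> A"
      unfolding mpoly_eval_def
    proof (rule sum')
      fix m
      have "inverse (\<xi> i) * \<xi> l \<in> A" for l
        using base[OF coord_quotient_base[OF a i]] by (simp add: divide_inverse mult.commute)
      hence "(\<Prod>l\<in>UNIV. (inverse (\<xi> i) * \<xi> l) ^ Poly_Mapping.lookup m l) \<in> A" by (intro prod power)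
      thus "\<iota> (Poly_Mapping.lookup G m) * (\<Prod>l\<in>UNIV. (inverse (\<xi> i) * \<xi> l) ^ Poly_Mapping.lookup m l) \<in> A"
        using A(1,3) by blast
    qed
    finally show ?thesis .
  qed
  have "g \<in> A" for g
  proof -
    have "g \<in> homog_quotients \<iota> \<xi>" using ff by (simp add: function_field_def)
    then obtain d G H where *: "homogeneous d G" "homogeneous d H"
      "g = mpoly_eval \<iota> \<xi> G / mpoly_eval \<iota> \<xi> H" unfolding homog_quotients_def by blast
    have "g = (mpoly_eval \<iota> \<xi> G / \<xi> i ^ d) / (mpoly_eval \<iota> \<xi> H / \<xi> i ^ d)"
      using coord_nonzero[OF a i] *(3) by simp
    thus ?thesis using div[OF form[OF *(1)] form[OF *(2)]] by (simp only:)
  qed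
  thus "A = UNIV" by blast
qed

end

section \<open>Frobenius maps\<close>

lemma finite_field_power_card:
  fixes x :: "'a::{field,finite}" shows "x ^ (CARD('a) ^ r) = x"
proof -
  have *: "x ^ CARD('a) = x" for x :: 'a
  proof (cases "x = 0")
    case False
    have "(\<Prod>y\<in>UNIV - {0}. x * y) = (\<Prod>y\<in>UNIV - {0}. y)"
      by (rule prod.reindex_bij_witness[of _ "\<lambda>y. y / x" "\<lambda>y. x * y"]) (use False in auto)
    moreover have "(\<Prod>y\<in>UNIV - {0}. x * y) = x ^ (CARD('a) - 1) * (\<Prod>y\<in>UNIV - {0}. y)"
      by (simp add: prod.distrib)
    ultimately have "x ^ (CARD('a) - 1) = 1" by simp
    moreover have "x ^ CARD('a) = x * x ^ (CARD('a) - 1)"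
      using finite_UNIV_card_ge_0[where ?'a = 'a] by (simp flip: power_Suc)
    ultimately show ?thesis by simp
  qed (use finite_UNIV_card_ge_0[where ?'a = 'a] in auto)
  show ?thesis by (induction r) (simp_all add: * power_mult)
qed

text \<open>The polynomial \<open>(X + 1) ^ q - X ^ q - 1\<close> has degree less than \<open>q\<close> and vanishes on the field of
  \<open>q\<close> elements, so \<open>q\<close>-th powers are additive.\<close>

lemma frobenius_binomial:
  assumes "0 < k" "k < CARD('a::{field,finite})" shows "CHAR('a) dvd (CARD('a) choose k)"
proof -
  let ?q = "CARD('a)"
  define B where "B = [:1, 1:] ^ ?q - Polynomial.monom 1 ?q - (1 :: 'a poly)"
  have q: "?q > 1" using assms by simp
  have coeff: "poly.coeff ([:1, 1:] ^ ?q) i = (of_nat (?q choose i) :: 'a)" for i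
  proof (cases "i \<le> ?q")
    case False
    have "Polynomial.degree ([:1, 1 :: 'a:] ^ ?q) \<le> ?q" using degree_power_le[of "[:1, 1 :: 'a:]" ?q] by simp
    thus ?thesis using False by (simp add: coeff_eq_0 binomial_eq_0)
  qed (simp add: coeff_linear_poly_power)
  have B: "poly.coeff B i = (if 0 < i \<and> i < ?q then of_nat (?q choose i) else 0)" for i
    using q by (auto simp: B_def coeff binomial_eq_0 one_pCons coeff_pCons split: nat.split)
  have "B = 0"
  proof (rule ccontr)
    assume nz: "B \<noteq> 0"
    have "Polynomial.degree B \<le> ?q - 1" by (rule degree_le) (auto simp: B)
    moreover have "{x. poly B x = 0} = UNIV"
      using finite_field_power_card[where 'a='a and r=1] by (auto simp: B_def poly_monom add.commute)
    hence "?q \<le> Polynomial.degree B" using card_poly_roots_bound[OF nz] by simp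
    ultimately show False using q by simp
  qed
  hence "of_nat (?q choose k) = (0 :: 'a)" using B[of k] assms by simp
  thus ?thesis by (simp add: of_nat_eq_0_iff_char_dvd)
qed

lemma frobenius_add:
  fixes x y :: "'b::comm_ring_1"
  assumes "CHAR('b) = CHAR('a::{field,finite})"
  shows "(x + y) ^ (CARD('a) ^ r) = x ^ (CARD('a) ^ r) + y ^ (CARD('a) ^ r)"
proof -
  have *: "(x + y) ^ CARD('a) = x ^ CARD('a) + y ^ CARD('a)" for x y :: 'b
  proof -
    have q: "CARD('a) > 0" by simp
    have "(x + y) ^ CARD('a) = (\<Sum>k\<le>CARD('a). of_nat (CARD('a) choose k) * x ^ k * y ^ (CARD('a) - k))"
      by (rule binomial_ring)
    also have "\<dots> = (\<Sum>k\<in>{0, CARD('a)}. of_nat (CARD('a) choose k) * x ^ k * y ^ (CARD('a) - k))"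
    proof (rule sum.mono_neutral_right)
      show "\<forall>k\<in>{..CARD('a)} - {0, CARD('a)}. of_nat (CARD('a) choose k) * x ^ k * y ^ (CARD('a) - k) = 0"
      proof
        fix k assume "k \<in> {..CARD('a)} - {0, CARD('a)}"
        hence "CHAR('b) dvd (CARD('a) choose k)" unfolding assms by (intro frobenius_binomial) auto
        hence "of_nat (CARD('a) choose k) = (0 :: 'b)" by (simp add: of_nat_eq_0_iff_char_dvd)
        thus "of_nat (CARD('a) choose k) * x ^ k * y ^ (CARD('a) - k) = 0" by simp
      qed
    qed auto
    finally show ?thesis using q by (simp add: add.commute)
  qed
  show ?thesis by (induction r arbitrary: x y) (simp_all add: * power_mult)
qed

lemma frobenius_sum:
  fixes f :: "'i \<Rightarrow> 'b::comm_ring_1"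
  assumes "CHAR('b) = CHAR('a::{field,finite})"
  shows "(sum f I) ^ (CARD('a) ^ r) = (\<Sum>i\<in>I. f i ^ (CARD('a) ^ r))"
  by (induction I rule: infinite_finite_induct) (auto simp: frobenius_add[OF assms] zero_power)


section \<open>Semilinear automorphisms of the function field\<close>

lemma mpoly_eval_hom:
  assumes "comm_ring_hom \<theta>" shows "mpoly_eval (\<lambda>c. \<theta> (\<phi> c)) (\<lambda>i. \<theta> (x i)) G = \<theta> (mpoly_eval \<phi> x G)"
proof -
  interpret comm_ring_hom \<theta> by fact
  show ?thesis by (simp add: mpoly_eval_def hom_sum hom_mult hom_prod hom_power)
qed

context
  fixes \<theta> :: "'b::zero \<Rightarrow> 'c::zero"
  assumes theta_0_iff: "\<And>c. \<theta> c = 0 \<longleftrightarrow> c = 0"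
begin

lemma lookup_map_0: "Poly_Mapping.lookup (Poly_Mapping.map \<theta> G) m = \<theta> (Poly_Mapping.lookup G m)"
proof -
  have "\<theta> 0 = 0" using theta_0_iff by blast
  thus ?thesis by (simp add: Poly_Mapping.map.rep_eq when_def)
qed

lemma keys_map_0: "Poly_Mapping.keys (Poly_Mapping.map \<theta> G) = Poly_Mapping.keys G"
  unfolding keys.rep_eq lookup_map_0 theta_0_iff ..

lemma mpoly_eval_map: "mpoly_eval \<phi> x (Poly_Mapping.map \<theta> G) = mpoly_eval (\<lambda>c. \<phi> (\<theta> c)) x G"
  unfolding mpoly_eval_def keys_map_0 lookup_map_0 ..

lemma homogeneous_map: "homogeneous d G \<Longrightarrow> homogeneous d (Poly_Mapping.map \<theta> G)"
  unfolding homogeneous_def keys_map_0 .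

end

text \<open>An automorphism \<open>\<theta>\<close> of the constants that fixes the finite field permutes the points of \<open>C\<close>.
  So applying \<open>\<theta>\<close> to the coefficients of forms is well defined on the function field. This gives a
  \<open>\<theta>\<close>-semilinear endomorphism fixing the functions defined over the finite field.\<close>

locale semilinear =
  fixes C :: "('v::finite, 'a::{field,finite} alg_closure) point set" and \<iota> :: "'a alg_closure \<Rightarrow> 'f::field"
    and \<xi> :: "'v \<Rightarrow> 'f" and P :: "('v, 'a alg_closure) point"
    and \<theta> \<theta>' :: "'a alg_closure \<Rightarrow> 'a alg_closure"
  assumes curve: "nonsingular_projective_curve C \<iota> \<xi>" and P: "P \<in> C"
    and hom: "field_hom \<theta>" "field_hom \<theta>'" and inv: "\<And>c. \<theta>' (\<theta> c) = c" "\<And>c. \<theta> (\<theta>' c) = c"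
    and fixed: "\<And>c. \<theta> (to_ac c) = to_ac c"
    and rational: "\<exists>a\<in>P. \<forall>i. \<theta> (a i) = a i"
begin

sublocale t: field_hom \<theta> by (rule hom)
sublocale t': field_hom \<theta>' by (rule hom)
sublocale cp: curve_point C \<iota> \<xi> P by (rule curve_point_of_curve[OF curve P])
sublocale pl: place \<iota> "local_ring \<iota> \<xi> P" "value_at \<iota> \<xi> P" by (rule place_of_curve[OF curve P])

lemma theta_eq_0_iff: "\<theta> c = 0 \<longleftrightarrow> c = 0" and theta'_eq_0_iff: "\<theta>' c = 0 \<longleftrightarrow> c = 0"
  using inv t.hom_zero t'.hom_zero by metis+

lemma fixed': "\<theta>' (to_ac c) = to_ac c" using inv(1) fixed by metis

end

text \<open>The equations of \<open>C\<close> have coefficients in the finite field, which \<open>\<theta>\<close> fixes.\<close>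

lemma point_image_in_curve:
  fixes C :: "('v::finite, 'a::{field,finite} alg_closure) point set"
  assumes closed: "proj_closed (to_ac :: 'a \<Rightarrow> 'a alg_closure) C" and P: "P \<in> C"
    and hom: "field_hom \<theta>" and inv: "\<And>c. \<theta> (\<theta>' c) = c" and nz: "\<And>c. \<theta>' c = 0 \<longleftrightarrow> c = 0" "\<And>c. \<theta> c = 0 \<longleftrightarrow> c = 0"
    and fixed: "\<And>c. \<theta> (to_ac (c :: 'a)) = to_ac c"
  shows "(\<lambda>b i. \<theta> (b i)) ` P \<in> C"
proof -
  interpret t: field_hom \<theta> by fact
  obtain S :: "('v, 'a) mpoly set" where S: "C = {P \<in> proj_space. \<forall>G\<in>S. vanishes_at to_ac G P}"
    using closed unfolding proj_closed_def by blast
  obtain a :: "'v \<Rightarrow> 'a alg_closure" where a: "a \<noteq> (\<lambda>_. 0)" "P = {(\<lambda>i. c * a i) |c. c \<noteq> 0}"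
    using P S unfolding proj_space_def by blast
  have "(\<lambda>b i. \<theta> (b i)) ` P = {(\<lambda>i. c * \<theta> (a i)) |c. c \<noteq> 0}"
  proof (intro equalityI subsetI)
    fix x assume "x \<in> (\<lambda>b i. \<theta> (b i)) ` P"
    then obtain c where "c \<noteq> 0" "x = (\<lambda>i. \<theta> (c * a i))" using a(2) by auto
    thus "x \<in> {(\<lambda>i. c * \<theta> (a i)) |c. c \<noteq> 0}" using nz by (auto simp: t.hom_mult intro!: exI[of _ "\<theta> c"])
  next
    fix x assume "x \<in> {(\<lambda>i. c * \<theta> (a i)) |c. c \<noteq> 0}"
    then obtain c where c: "c \<noteq> 0" "x = (\<lambda>i. c * \<theta> (a i))" by auto
    hence "x = (\<lambda>i. \<theta> (\<theta>' c * a i))" "\<theta>' c \<noteq> 0" using nz by (auto simp: t.hom_mult inv)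
    thus "x \<in> (\<lambda>b i. \<theta> (b i)) ` P" using a(2) by auto
  qed
  moreover have "(\<lambda>i. \<theta> (a i)) \<noteq> (\<lambda>_. 0)" using a(1) nz(2) by (auto simp: fun_eq_iff)
  ultimately have "(\<lambda>b i. \<theta> (b i)) ` P \<in> proj_space" unfolding proj_space_def by blast
  moreover have "vanishes_at to_ac G ((\<lambda>b i. \<theta> (b i)) ` P)" if "G \<in> S" for G
    unfolding vanishes_at_def
  proof
    fix x assume "x \<in> (\<lambda>b i. \<theta> (b i)) ` P"
    then obtain b where b: "b \<in> P" "x = (\<lambda>i. \<theta> (b i))" by blast
    have "mpoly_eval to_ac x G = mpoly_eval (\<lambda>c. \<theta> (to_ac c)) (\<lambda>i. \<theta> (b i)) G" using b(2) fixed by simp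
    also have "\<dots> = \<theta> (mpoly_eval to_ac b G)" by (rule mpoly_eval_hom) unfold_locales
    also have "mpoly_eval to_ac b G = 0" using S P that b(1) by (auto simp: vanishes_at_def)
    finally show "mpoly_eval to_ac x G = 0" by simp
  qed
  ultimately show ?thesis using S by blast
qed

context semilinear
begin

lemma twisted_vanish_iff:
  assumes "homogeneous d G"
  shows "mpoly_eval (\<lambda>c. \<iota> (\<theta> c)) \<xi> G = 0 \<longleftrightarrow> mpoly_eval \<iota> \<xi> G = 0"
proof -
  note closed = nonsingular_projective_curveD(3)[OF curve]
  have ff: "mpoly_eval \<iota> \<xi> H = 0 \<longleftrightarrow> (\<forall>P\<in>C. \<forall>b\<in>P. mpoly_eval id b H = 0)" if "homogeneous d H" for H
    using nonsingular_projective_curveD(1)[OF curve] that unfolding function_field_def vanishes_at_def by blast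
  have tw: "mpoly_eval \<theta> (\<lambda>i. \<theta> (b i)) G = \<theta> (mpoly_eval id b G)" for b
    using mpoly_eval_hom[of \<theta> id b G] t.comm_ring_hom_axioms by simp
  have "mpoly_eval (\<lambda>c. \<iota> (\<theta> c)) \<xi> G = mpoly_eval \<iota> \<xi> (Poly_Mapping.map \<theta> G)"
    by (rule mpoly_eval_map[OF theta_eq_0_iff, symmetric])
  also have "\<dots> = 0 \<longleftrightarrow> (\<forall>P\<in>C. \<forall>b\<in>P. mpoly_eval id b (Poly_Mapping.map \<theta> G) = 0)"
    by (rule ff[OF homogeneous_map[OF theta_eq_0_iff assms]])
  also have "\<dots> \<longleftrightarrow> (\<forall>P\<in>C. \<forall>b\<in>P. mpoly_eval \<theta> b G = 0)"
    by (simp add: mpoly_eval_map[OF theta_eq_0_iff])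
  also have "\<dots> \<longleftrightarrow> (\<forall>P\<in>C. \<forall>b\<in>P. mpoly_eval id b G = 0)"
  proof (intro iffI ballI)
    fix P b assume *: "\<forall>P\<in>C. \<forall>b\<in>P. mpoly_eval \<theta> b G = 0" "P \<in> C" "b \<in> P"
    have "(\<lambda>b i. \<theta> (b i)) ` P \<in> C"
      by (rule point_image_in_curve[OF closed *(2) hom(1) inv(2) theta'_eq_0_iff theta_eq_0_iff fixed])
    moreover have "(\<lambda>i. \<theta> (b i)) \<in> (\<lambda>b i. \<theta> (b i)) ` P" using *(3) by blast
    ultimately have "mpoly_eval \<theta> (\<lambda>i. \<theta> (b i)) G = 0" by (rule *(1)[rule_format])
    thus "mpoly_eval id b G = 0" by (simp add: tw theta_eq_0_iff)
  next
    fix P b assume *: "\<forall>P\<in>C. \<forall>b\<in>P. mpoly_eval id b G = 0" "P \<in> C" "b \<in> P"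
    have "(\<lambda>b i. \<theta>' (b i)) ` P \<in> C"
      by (rule point_image_in_curve[OF closed *(2) hom(2) inv(1) theta_eq_0_iff theta'_eq_0_iff fixed'])
    moreover have "(\<lambda>i. \<theta>' (b i)) \<in> (\<lambda>b i. \<theta>' (b i)) ` P" using *(3) by blast
    ultimately have "mpoly_eval id (\<lambda>i. \<theta>' (b i)) G = 0" by (rule *(1)[rule_format])
    thus "mpoly_eval \<theta> b G = 0" using tw[of "\<lambda>i. \<theta>' (b i)"] by (simp add: inv)
  qed
  also have "\<dots> \<longleftrightarrow> mpoly_eval \<iota> \<xi> G = 0" by (rule ff[OF assms, symmetric])
  finally show ?thesis .
qed

sublocale tw: comm_ring_hom "\<lambda>c. \<iota> (\<theta> c)"
  by unfold_locales (simp_all add: t.hom_add t.hom_mult cp.const.hom_add cp.const.hom_mult)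

definition twist :: "'f \<Rightarrow> 'f" where
  "twist g = (SOME g'. \<exists>d G H. homogeneous d G \<and> homogeneous d H \<and> mpoly_eval \<iota> \<xi> H \<noteq> 0 \<and>
     g = mpoly_eval \<iota> \<xi> G / mpoly_eval \<iota> \<xi> H \<and>
     g' = mpoly_eval (\<lambda>c. \<iota> (\<theta> c)) \<xi> G / mpoly_eval (\<lambda>c. \<iota> (\<theta> c)) \<xi> H)"

lemma twist_eq:
  assumes "homogeneous d G" "homogeneous d H" "mpoly_eval \<iota> \<xi> H \<noteq> 0"
  shows "twist (mpoly_eval \<iota> \<xi> G / mpoly_eval \<iota> \<xi> H) =
    mpoly_eval (\<lambda>c. \<iota> (\<theta> c)) \<xi> G / mpoly_eval (\<lambda>c. \<iota> (\<theta> c)) \<xi> H"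
proof -
  let ?g = "mpoly_eval \<iota> \<xi> G / mpoly_eval \<iota> \<xi> H"
  have "\<exists>g' d G H. homogeneous d G \<and> homogeneous d H \<and> mpoly_eval \<iota> \<xi> H \<noteq> 0 \<and>
     ?g = mpoly_eval \<iota> \<xi> G / mpoly_eval \<iota> \<xi> H \<and>
     g' = mpoly_eval (\<lambda>c. \<iota> (\<theta> c)) \<xi> G / mpoly_eval (\<lambda>c. \<iota> (\<theta> c)) \<xi> H"
    by (rule exI[of _ "mpoly_eval (\<lambda>c. \<iota> (\<theta> c)) \<xi> G / mpoly_eval (\<lambda>c. \<iota> (\<theta> c)) \<xi> H"], rule exI[of _ d], rule exI[of _ G], rule exI[of _ H], intro conjI assms refl)
  from someI_ex[OF this] obtain e G' H' where *: "homogeneous e G'" "homogeneous e H'" "mpoly_eval \<iota> \<xi> H' \<noteq> 0"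
     "?g = mpoly_eval \<iota> \<xi> G' / mpoly_eval \<iota> \<xi> H'"
     "twist ?g = mpoly_eval (\<lambda>c. \<iota> (\<theta> c)) \<xi> G' / mpoly_eval (\<lambda>c. \<iota> (\<theta> c)) \<xi> H'"
    unfolding twist_def by blast
  have nz: "mpoly_eval (\<lambda>c. \<iota> (\<theta> c)) \<xi> H \<noteq> 0" "mpoly_eval (\<lambda>c. \<iota> (\<theta> c)) \<xi> H' \<noteq> 0"
    using twisted_vanish_iff assms(2,3) *(2,3) by blast+
  let ?F = "G * H' + Poly_Mapping.single 0 (-1) * (G' * H)"
  have F: "homogeneous (d + e) ?F"
    using homogeneous_mult[OF homogeneous_const homogeneous_mult[OF *(1) assms(2)], of "-1"]
    by (intro homogeneous_add homogeneous_mult[OF assms(1) *(2)]) (simp add: add.commute)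
  have "mpoly_eval \<iota> \<xi> G * mpoly_eval \<iota> \<xi> H' = mpoly_eval \<iota> \<xi> G' * mpoly_eval \<iota> \<xi> H"
    using *(4) unfolding frac_eq_eq[OF assms(3) *(3)] .
  hence "mpoly_eval \<iota> \<xi> ?F = 0"
    by (simp add: cp.const.mpoly_eval_add cp.const.mpoly_eval_mult cp.const.mpoly_eval_single cp.const.hom_uminus)
  hence "mpoly_eval (\<lambda>c. \<iota> (\<theta> c)) \<xi> ?F = 0" using twisted_vanish_iff[OF F] by simp
  hence "mpoly_eval (\<lambda>c. \<iota> (\<theta> c)) \<xi> G * mpoly_eval (\<lambda>c. \<iota> (\<theta> c)) \<xi> H' =
      mpoly_eval (\<lambda>c. \<iota> (\<theta> c)) \<xi> G' * mpoly_eval (\<lambda>c. \<iota> (\<theta> c)) \<xi> H"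
    by (simp add: tw.mpoly_eval_add tw.mpoly_eval_mult tw.mpoly_eval_single t.hom_uminus cp.const.hom_uminus)
  thus ?thesis unfolding *(5) frac_eq_eq[OF nz(2) nz(1)] by simp
qed

lemma form_quotient:
  obtains d G H where "homogeneous d G" "homogeneous d H" "mpoly_eval \<iota> \<xi> H \<noteq> 0"
    "g = mpoly_eval \<iota> \<xi> G / mpoly_eval \<iota> \<xi> H" "mpoly_eval (\<lambda>c. \<iota> (\<theta> c)) \<xi> H \<noteq> 0"
    "twist g = mpoly_eval (\<lambda>c. \<iota> (\<theta> c)) \<xi> G / mpoly_eval (\<lambda>c. \<iota> (\<theta> c)) \<xi> H"
proof -
  have "g \<in> homog_quotients \<iota> \<xi>" using cp.ff by (simp add: function_field_def)
  then obtain d G H where *: "homogeneous d G" "homogeneous d H" "mpoly_eval \<iota> \<xi> H \<noteq> 0"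
    "g = mpoly_eval \<iota> \<xi> G / mpoly_eval \<iota> \<xi> H" unfolding homog_quotients_def by blast
  show thesis
  proof (rule that[OF *])
    show "mpoly_eval (\<lambda>c. \<iota> (\<theta> c)) \<xi> H \<noteq> 0" using twisted_vanish_iff[OF *(2)] *(3) by blast
    show "twist g = mpoly_eval (\<lambda>c. \<iota> (\<theta> c)) \<xi> G / mpoly_eval (\<lambda>c. \<iota> (\<theta> c)) \<xi> H"
      unfolding *(4) by (rule twist_eq[OF *(1-3)])
  qed
qed

lemma twist_add: "twist (g + h) = twist g + twist h" and twist_mult: "twist (g * h) = twist g * twist h"
proof -
  obtain d G H where 1: "homogeneous d G" "homogeneous d H" "mpoly_eval \<iota> \<xi> H \<noteq> 0"
    "g = mpoly_eval \<iota> \<xi> G / mpoly_eval \<iota> \<xi> H" "mpoly_eval (\<lambda>c. \<iota> (\<theta> c)) \<xi> H \<noteq> 0"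
    "twist g = mpoly_eval (\<lambda>c. \<iota> (\<theta> c)) \<xi> G / mpoly_eval (\<lambda>c. \<iota> (\<theta> c)) \<xi> H" by (rule form_quotient)
  obtain e G' H' where 2: "homogeneous e G'" "homogeneous e H'" "mpoly_eval \<iota> \<xi> H' \<noteq> 0"
    "h = mpoly_eval \<iota> \<xi> G' / mpoly_eval \<iota> \<xi> H'" "mpoly_eval (\<lambda>c. \<iota> (\<theta> c)) \<xi> H' \<noteq> 0"
    "twist h = mpoly_eval (\<lambda>c. \<iota> (\<theta> c)) \<xi> G' / mpoly_eval (\<lambda>c. \<iota> (\<theta> c)) \<xi> H'" by (rule form_quotient)
  have HH: "homogeneous (d + e) (H * H')" "mpoly_eval \<iota> \<xi> (H * H') \<noteq> 0"
    using homogeneous_mult[OF 1(2) 2(2)] 1(3) 2(3) by (auto simp: cp.const.mpoly_eval_mult)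
  have A: "homogeneous (d + e) (G * H' + G' * H)"
    using homogeneous_mult[OF 1(1) 2(2)] homogeneous_mult[OF 2(1) 1(2)]
    by (intro homogeneous_add) (simp_all add: add.commute)
  have "g + h = mpoly_eval \<iota> \<xi> (G * H' + G' * H) / mpoly_eval \<iota> \<xi> (H * H')"
    unfolding 1(4) 2(4) add_frac_eq[OF 1(3) 2(3)]
    by (simp add: cp.const.mpoly_eval_add cp.const.mpoly_eval_mult)
  hence "twist (g + h) = mpoly_eval (\<lambda>c. \<iota> (\<theta> c)) \<xi> (G * H' + G' * H) / mpoly_eval (\<lambda>c. \<iota> (\<theta> c)) \<xi> (H * H')"
    using twist_eq[OF A HH] by simp
  also have "\<dots> = twist g + twist h"
    unfolding 1(6) 2(6) add_frac_eq[OF 1(5) 2(5)] by (simp add: tw.mpoly_eval_add tw.mpoly_eval_mult)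
  finally show "twist (g + h) = twist g + twist h" .
  have "g * h = mpoly_eval \<iota> \<xi> (G * G') / mpoly_eval \<iota> \<xi> (H * H')"
    unfolding 1(4) 2(4) by (simp add: cp.const.mpoly_eval_mult)
  hence "twist (g * h) = mpoly_eval (\<lambda>c. \<iota> (\<theta> c)) \<xi> (G * G') / mpoly_eval (\<lambda>c. \<iota> (\<theta> c)) \<xi> (H * H')"
    using twist_eq[OF homogeneous_mult[OF 1(1) 2(1)] HH] by simp
  thus "twist (g * h) = twist g * twist h"
    unfolding 1(6) 2(6) by (simp add: tw.mpoly_eval_mult)
qed

lemma twist_const: "twist (\<iota> c) = \<iota> (\<theta> c)"
  using twist_eq[OF homogeneous_const[of c] homogeneous_one]
  by (simp add: cp.const.mpoly_eval_single tw.mpoly_eval_single)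

lemma twist_base:
  assumes "g \<in> base_functions \<iota> \<xi>" shows "twist g = g"
proof -
  obtain d G H where *: "homogeneous d G" "homogeneous d H" "mpoly_eval (\<iota> \<circ> to_ac) \<xi> H \<noteq> 0"
    "g = mpoly_eval (\<iota> \<circ> to_ac) \<xi> G / mpoly_eval (\<iota> \<circ> to_ac) \<xi> (H :: ('v, 'a) mpoly)"
    using assms unfolding base_functions_def homog_quotients_def by blast
  have m: "mpoly_eval \<iota> \<xi> (Poly_Mapping.map to_ac F) = mpoly_eval (\<iota> \<circ> to_ac) \<xi> F"
    "mpoly_eval (\<lambda>c. \<iota> (\<theta> c)) \<xi> (Poly_Mapping.map to_ac F) = mpoly_eval (\<iota> \<circ> to_ac) \<xi> F" for F :: "('v, 'a) mpoly"
    by (simp_all add: mpoly_eval_map comp_def fixed)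
  have h: "homogeneous d (Poly_Mapping.map to_ac F)" if "homogeneous d F" for F :: "('v, 'a) mpoly"
    by (rule homogeneous_map) (use that in auto)
  show ?thesis using twist_eq[OF h[OF *(1)] h[OF *(2)]] *(3) unfolding m *(4) by blast
qed

lemma twist_value:
  assumes "takes_value \<iota> \<xi> P g c" shows "takes_value \<iota> \<xi> P (twist g) (\<theta> c)"
proof -
  obtain a where a: "a \<in> P" "\<And>i. \<theta> (a i) = a i" using rational by blast
  obtain d G H where *: "homogeneous d G" "homogeneous d H" "mpoly_eval id a H \<noteq> 0"
     "g = mpoly_eval \<iota> \<xi> G / mpoly_eval \<iota> \<xi> H" "c = mpoly_eval id a G / mpoly_eval id a H"
    using assms unfolding cp.takes_value_iff[OF a(1)] by blast
  have nz: "mpoly_eval \<iota> \<xi> H \<noteq> 0" using cp.vanish_imp_zero[OF *(2) _ a(1)] *(3) by blast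
  have m: "mpoly_eval \<iota> \<xi> (Poly_Mapping.map \<theta> F) = mpoly_eval (\<lambda>c. \<iota> (\<theta> c)) \<xi> F" for F :: "('v, 'a alg_closure) mpoly"
    by (rule mpoly_eval_map[OF theta_eq_0_iff])
  have e: "mpoly_eval id a (Poly_Mapping.map \<theta> F) = \<theta> (mpoly_eval id a F)" for F :: "('v, 'a alg_closure) mpoly"
    using mpoly_eval_hom[OF t.comm_ring_hom_axioms, of id a F]
    by (simp add: a(2) mpoly_eval_map[OF theta_eq_0_iff])
  show ?thesis
    unfolding cp.takes_value_iff[OF a(1)]
  proof (intro exI conjI)
    show "homogeneous d (Poly_Mapping.map \<theta> G)" "homogeneous d (Poly_Mapping.map \<theta> H)"
      by (rule homogeneous_map[OF theta_eq_0_iff *(1)], rule homogeneous_map[OF theta_eq_0_iff *(2)])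
    show "mpoly_eval id a (Poly_Mapping.map \<theta> H) \<noteq> 0" using *(3) by (simp add: e theta_eq_0_iff)
    show "twist g = mpoly_eval \<iota> \<xi> (Poly_Mapping.map \<theta> G) / mpoly_eval \<iota> \<xi> (Poly_Mapping.map \<theta> H)"
      unfolding m *(4) by (rule twist_eq[OF *(1,2) nz])
    show "\<theta> c = mpoly_eval id a (Poly_Mapping.map \<theta> G) / mpoly_eval id a (Poly_Mapping.map \<theta> H)"
      unfolding e *(5) by (rule t.hom_div)
  qed
qed

lemma twist_local: "g \<in> local_ring \<iota> \<xi> P \<Longrightarrow> twist g \<in> local_ring \<iota> \<xi> P"
  and value_at_twist: "g \<in> local_ring \<iota> \<xi> P \<Longrightarrow> value_at \<iota> \<xi> P (twist g) = \<theta> (value_at \<iota> \<xi> P g)"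
proof -
  assume "g \<in> local_ring \<iota> \<xi> P"
  note tv = twist_value[OF cp.takes_value_value_at[OF this]]
  show "twist g \<in> local_ring \<iota> \<xi> P" using tv unfolding local_ring_def by blast
  show "value_at \<iota> \<xi> P (twist g) = \<theta> (value_at \<iota> \<xi> P g)" by (rule cp.value_at_eq[OF tv])
qed

lemma inverse_semilinear: "semilinear C \<iota> \<xi> P \<theta>' \<theta>"
proof -
  obtain a where "a \<in> P" "\<And>i. \<theta> (a i) = a i" using rational by blast
  moreover from this have "\<theta>' (a i) = a i" for i using inv(1)[of "a i"] by simp
  ultimately have "\<exists>a\<in>P. \<forall>i. \<theta>' (a i) = a i" by blast
  thus ?thesis by (intro semilinear.intro curve P hom inv fixed')
qed

lemma twist_twist: "semilinear.twist \<iota> \<xi> \<theta>' (twist g) = g"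
proof -
  interpret o: semilinear C \<iota> \<xi> P \<theta>' \<theta> by (rule inverse_semilinear)
  obtain d G H where *: "homogeneous d G" "homogeneous d H" "mpoly_eval \<iota> \<xi> H \<noteq> 0"
    "g = mpoly_eval \<iota> \<xi> G / mpoly_eval \<iota> \<xi> H" "mpoly_eval (\<lambda>c. \<iota> (\<theta> c)) \<xi> H \<noteq> 0"
    "twist g = mpoly_eval (\<lambda>c. \<iota> (\<theta> c)) \<xi> G / mpoly_eval (\<lambda>c. \<iota> (\<theta> c)) \<xi> H" by (rule form_quotient)
  have m: "mpoly_eval \<iota> \<xi> (Poly_Mapping.map \<theta> F) = mpoly_eval (\<lambda>c. \<iota> (\<theta> c)) \<xi> F"
    "mpoly_eval (\<lambda>c. \<iota> (\<theta>' c)) \<xi> (Poly_Mapping.map \<theta> F) = mpoly_eval \<iota> \<xi> F" for F :: "('v, 'a alg_closure) mpoly"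
    by (simp_all add: mpoly_eval_map[OF theta_eq_0_iff] inv)
  show ?thesis
    using o.twist_eq[OF homogeneous_map[OF theta_eq_0_iff *(1)] homogeneous_map[OF theta_eq_0_iff *(2)]] *(3-6)
    unfolding m by simp
qed

text \<open>Neither the automorphism nor its inverse lowers the order, since both map the maximal ideal into
  itself.\<close>

lemma vl_twist:
  assumes g: "g \<in> local_ring \<iota> \<xi> P" "g \<noteq> 0" and param: "pl.parameter \<pi>"
  shows "pl.vl (twist g) = pl.vl g"
proof -
  interpret pp: place_param \<iota> "local_ring \<iota> \<xi> P" "value_at \<iota> \<xi> P" \<pi> by unfold_locales (rule param)
  interpret o: semilinear C \<iota> \<xi> P \<theta>' \<theta> by (rule inverse_semilinear)
  have le: "pl.vl g \<le> pl.vl (semilinear.twist \<iota> \<xi> \<eta> g) \<and> semilinear.twist \<iota> \<xi> \<eta> g \<noteq> 0"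
    if s: "semilinear C \<iota> \<xi> P \<eta> \<eta>'" and g: "g \<in> local_ring \<iota> \<xi> P" "g \<noteq> 0" for \<eta> \<eta>' g
  proof -
    interpret s: semilinear C \<iota> \<xi> P \<eta> \<eta>' by (rule s)
    interpret s': semilinear C \<iota> \<xi> P \<eta>' \<eta> by (rule s.inverse_semilinear)
    have nz: "s.twist x \<noteq> 0" if "x \<noteq> 0" for x
      using that s.twist_twist[of x] s'.twist_const[of 0] by auto
    obtain e w where w: "w \<in> local_ring \<iota> \<xi> P" "value_at \<iota> \<xi> P w \<noteq> 0" "g = \<pi> ^ e * w"
      using pp.factorization[OF g] by blast
    have w0: "w \<noteq> 0" using w(2) by auto
    have p: "s.twist (\<pi> ^ e) = s.twist \<pi> ^ e"
      using s.twist_const[of 1] by (induction e) (auto simp: s.twist_mult)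
    have R: "s.twist \<pi> \<in> local_ring \<iota> \<xi> P" "value_at \<iota> \<xi> P (s.twist \<pi>) = 0"
      by (simp_all add: s.twist_local s.value_at_twist)
    then obtain x where x: "x \<in> local_ring \<iota> \<xi> P" "s.twist \<pi> = \<pi> * x" using pp.param_dvd by blast
    have x0: "x \<noteq> 0" using nz[of \<pi>] x(2) by auto
    have y: "x ^ e * s.twist w \<in> local_ring \<iota> \<xi> P" "x ^ e * s.twist w \<noteq> 0"
      using x w s.twist_local nz w0 x0 by (auto simp: pl.R_mult pl.R_power)
    have "s.twist g = \<pi> ^ e * (x ^ e * s.twist w)"
      by (simp add: w(3) s.twist_mult p x(2) power_mult_distrib mult_ac)
    hence "pl.vl (s.twist g) = int e * pl.vl \<pi> + pl.vl (x ^ e * s.twist w)"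
      using y by (simp add: pp.vl_mult pp.vl_power del: mult_eq_0_iff)
    moreover have "pl.vl \<pi> = 1" by (rule pp.vl_eqI[of 1]) auto
    moreover have "pl.vl (x ^ e * s.twist w) \<ge> 0" using pp.vl_nonneg_iff y by blast
    moreover have "pl.vl g = int e" by (rule pp.vl_eqI[of w]) (use w in \<open>auto simp: mult.commute\<close>)
    ultimately show ?thesis using nz g by simp
  qed
  have "pl.vl g \<le> pl.vl (twist g)" "twist g \<noteq> 0" using le[of \<theta> \<theta>' g] g semilinear_axioms by auto
  moreover have "pl.vl (twist g) \<le> pl.vl (o.twist (twist g))"
    using le[of \<theta>' \<theta> "twist g"] o.semilinear_axioms twist_local[OF g(1)] calculation(2) by auto
  ultimately show ?thesis by (simp add: twist_twist)
qed

end

section \<open>The Frobenius determinant in a local parameter\<close>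

text \<open>The automorphism is the inverse of \<open>c \<mapsto> c ^ (q ^ r)\<close>: then the \<open>q ^ r\<close>-th power of the image of a
  combination with coefficients \<open>a\<close> has coefficients \<open>a\<close> again.\<close>

lemma semilinear_of_rational_point:
  fixes C :: "('v::finite, 'a::{field,finite} alg_closure) point set" and \<iota> :: "'a alg_closure \<Rightarrow> 'f::field"
  assumes curve: "nonsingular_projective_curve C \<iota> \<xi>" and P: "P \<in> rational_points C (CARD('a) ^ r)"
  obtains \<theta> \<theta>' where "semilinear C \<iota> \<xi> P \<theta> \<theta>'" "\<And>c. \<theta> c ^ (CARD('a) ^ r) = c"
proof -
  let ?Q = "CARD('a) ^ r"
  define \<theta>' :: "'a alg_closure \<Rightarrow> 'a alg_closure" where "\<theta>' c = c ^ ?Q" for c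
  have Q: "?Q > 0" by simp
  have char: "CHAR('a alg_closure) = CHAR('a)" by simp
  have hom': "field_hom \<theta>'"
    using Q by unfold_locales (auto simp: \<theta>'_def frobenius_add[OF char] power_mult_distrib)
  interpret h: field_hom \<theta>' by (rule hom')
  have inj: "inj \<theta>'"
  proof (rule injI)
    fix x y assume "\<theta>' x = \<theta>' y"
    hence "\<theta>' (x - y) = 0" by (simp add: h.hom_minus)
    thus "x = y" using Q by (simp add: \<theta>'_def)
  qed
  have surj: "surj \<theta>'"
  proof (rule surjI)
    show "\<theta>' (SOME b. b ^ ?Q = c) = c" for c
      unfolding \<theta>'_def by (rule someI_ex) (rule nth_root_exists[OF Q])
  qed
  define \<theta> where "\<theta> = Hilbert_Choice.inv \<theta>'"
  have i: "\<theta>' (\<theta> c) = c" "\<theta> (\<theta>' c) = c" for c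
    using inj surj by (simp_all add: \<theta>_def surj_f_inv_f inv_f_f)
  have "field_hom \<theta>"
  proof unfold_locales
    show "\<theta> 0 = 0" using i(2)[of 0] by simp
    show "\<theta> 1 = 1" using i(2)[of 1] by simp
    show "\<theta> (x + y) = \<theta> x + \<theta> y" for x y using i(2)[of "\<theta> x + \<theta> y"] by (simp add: h.hom_add i)
    show "\<theta> (x * y) = \<theta> x * \<theta> y" for x y using i(2)[of "\<theta> x * \<theta> y"] by (simp add: h.hom_mult i)
  qed
  moreover have "\<theta> (to_ac c) = to_ac c" for c :: 'a
  proof -
    have "\<theta>' (to_ac c) = to_ac c" by (simp only: \<theta>'_def to_ac_power[symmetric] finite_field_power_card)
    thus ?thesis using i(2)[of "to_ac c"] by simp
  qed
  moreover obtain a where a: "a \<in> P" "\<And>i. a i ^ ?Q = a i" using P unfolding rational_points_def by blast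
  have "\<theta> (a k) = a k" for k using i(2)[of "a k"] a(2)[of k] by (simp add: \<theta>'_def)
  hence "\<exists>a\<in>P. \<forall>i. \<theta> (a i) = a i" using a(1) by blast
  moreover have "P \<in> C" using P by (simp add: rational_points_def)
  ultimately have "semilinear C \<iota> \<xi> P \<theta> \<theta>'"
    by (intro semilinear.intro curve hom' i)
  thus thesis using that i(1) by (simp add: \<theta>'_def)
qed

lemma (in curve_point) takes_value_sum:
  "(\<And>i. i \<in> I \<Longrightarrow> takes_value \<iota> \<xi> P (g i) (b i)) \<Longrightarrow> takes_value \<iota> \<xi> P (sum g I) (sum b I)"
  using takes_value_const[of 0]
  by (induction I rule: infinite_finite_induct) (auto intro: takes_value_add)

text \<open>A relation would hold for the coordinates of every image point.\<close>

lemma nondegenerate_independent: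
  fixes C :: "('v::finite, 'a::{field,finite} alg_closure) point set" and \<iota> :: "'a alg_closure \<Rightarrow> 'f::field"
  assumes curve: "nonsingular_projective_curve C \<iota> \<xi>" and nd: "nondegenerate C \<iota> \<xi> n f"
    and a: "\<exists>i\<le>n. a i \<noteq> 0"
  shows "(\<Sum>i\<le>n. \<iota> (a i) * f i) \<noteq> 0"
proof
  assume 0: "(\<Sum>i\<le>n. \<iota> (a i) * f i) = 0"
  obtain P' b where P': "P' \<in> C" "b \<in> image_coords \<iota> \<xi> n f P'" "(\<Sum>i\<le>n. a i * b i) \<noteq> 0"
    using nd a unfolding nondegenerate_def by blast
  obtain h where h: "\<And>i. i \<le> n \<Longrightarrow> takes_value \<iota> \<xi> P' (h * f i) (b i)"
    using P'(2) unfolding image_coords_def by blast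
  interpret curve_point C \<iota> \<xi> P' by (rule curve_point_of_curve[OF curve P'(1)])
  have "takes_value \<iota> \<xi> P' (\<Sum>i\<le>n. \<iota> (a i) * (h * f i)) (\<Sum>i\<le>n. a i * b i)"
    by (intro takes_value_sum takes_value_mult takes_value_const h) auto
  also have "(\<Sum>i\<le>n. \<iota> (a i) * (h * f i)) = h * (\<Sum>i\<le>n. \<iota> (a i) * f i)"
    by (simp add: sum_distrib_left mult_ac)
  also have "\<dots> = \<iota> 0" using 0 by simp
  finally show False using takes_value_unique[OF _ takes_value_const] P'(3) by blast
qed

text \<open>Multiplication by \<open>X ^ k\<close> turns the \<open>k\<close>-th Hasse derivative into multiplication of the coefficients by
  binomial coefficients.\<close>

lemma fps_hasse_factor:
  "fps_X ^ k * fps_hasse k (fps_X ^ j * w) = fps_X ^ j * Abs_fps (\<lambda>i. of_nat ((j + i) choose k) * w $ i)"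
proof (rule fps_ext)
  fix i
  have "(fps_X ^ k * fps_hasse k (fps_X ^ j * w)) $ i = of_nat (i choose k) * (fps_X ^ j * w) $ i"
    by (auto simp: fps_X_power_mult_nth fps_hasse_nth binomial_eq_0)
  thus "(fps_X ^ k * fps_hasse k (fps_X ^ j * w)) $ i =
      (fps_X ^ j * Abs_fps (\<lambda>i. of_nat ((j + i) choose k) * w $ i)) $ i"
    by (auto simp: fps_X_power_mult_nth)
qed

context place_param
begin

lemma expand_det:
  assumes "\<And>r c. r < N \<Longrightarrow> c < N \<Longrightarrow> m r c \<in> R"
  shows "det (mat N N (\<lambda>(r, c). m r c)) \<in> R"
    and "expand (det (mat N N (\<lambda>(r, c). m r c))) = det (mat N N (\<lambda>(r, c). expand (m r c)))"
proof -
  let ?S = "{p. p permutes {0..<N}}"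
  have lt: "p i < N" if "p \<in> ?S" "i < N" for p i using permutes_in_image[of p "{0..<N}" i] that by auto
  have det: "det (mat N N (\<lambda>(r, c). m r c)) = (\<Sum>p\<in>?S. signof p * (\<Prod>i = 0..<N. m i (p i)))"
    unfolding det_def'[OF mat_carrier] using lt by (intro sum.cong) auto
  have R: "(\<Prod>i = 0..<N. m i (p i)) \<in> R" if "p \<in> ?S" for p
    using lt[OF that] assms by (intro R_prod) auto
  have sR: "signof p \<in> R" and sE: "expand (signof p) = signof p" for p :: "nat \<Rightarrow> nat"
    using R_uminus[OF R_1] expand_uminus[OF R_1] by (auto simp: sign_def)
  show "det (mat N N (\<lambda>(r, c). m r c)) \<in> R"
    unfolding det by (intro R_sum R_mult sR R)
  have E: "expand (\<Prod>i = 0..<N. m i (p i)) = (\<Prod>i = 0..<N. expand (m i (p i)))" if "p \<in> ?S" for p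
    using lt[OF that] assms by (intro expand_prod) auto
  have "expand (det (mat N N (\<lambda>(r, c). m r c))) = (\<Sum>p\<in>?S. expand (signof p * (\<Prod>i = 0..<N. m i (p i))))"
    unfolding det by (rule expand_sum) (intro R_mult sR R)
  also have "\<dots> = (\<Sum>p\<in>?S. signof p * (\<Prod>i = 0..<N. expand (m i (p i))))"
    by (intro sum.cong refl) (simp only: expand_mult[OF sR R] sE E)
  also have "\<dots> = det (mat N N (\<lambda>(r, c). expand (m r c)))"
    unfolding det_def'[OF mat_carrier] using lt by (intro sum.cong) auto
  finally show "expand (det (mat N N (\<lambda>(r, c). m r c))) = det (mat N N (\<lambda>(r, c). expand (m r c)))" .
qed

lemma expand_factor_vl:
  assumes "g \<in> R" "g \<noteq> 0" "vl g = int k" obtains w where "expand g = fps_X ^ k * w" "w $ 0 \<noteq> 0"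
proof -
  have s: "subdegree (expand g) = k" "expand g \<noteq> 0" using subdegree_expand[OF assms(1,2)] assms(3) by auto
  show thesis
  proof (rule that[of "unit_factor (expand g)"])
    show "expand g = fps_X ^ k * unit_factor (expand g)"
      using fps_unit_factor_decompose[of "expand g"] s by (simp add: fps_unit_factor_def fps_shift_times_fps_X_power mult.commute subdegree_decompose)
    show "unit_factor (expand g) $ 0 \<noteq> 0" using s nth_subdegree_nonzero[OF s(2)] by (simp add: fps_unit_factor_def)
  qed
qed

text \<open>Leibniz' rule and the chain rule at once: the \<open>r\<close>-th derivative of \<open>h * g\<close> with respect to \<open>\<pi>\<close>
  is a combination of the derivatives of \<open>g\<close> with respect to \<open>t\<close> of order at most \<open>r\<close>.\<close>

lemma hasse_param_mult_change:
  assumes t: "separable_variable \<iota> t"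
  shows "hasse \<iota> \<pi> r (h * g) = h * hasse \<iota> \<pi> 1 t ^ r * hasse \<iota> t r g +
    (\<Sum>\<rho><r. (taylor h * (taylor t - fps_const t) ^ \<rho>) $ r * hasse \<iota> t \<rho> g)"
proof -
  note tay = taylor_hom_param
  define s where "s = taylor t - fps_const t"
  have s0: "s $ 0 = 0" using taylor_nth_0[OF field_hom_const tay] by (simp add: s_def)
  have low: "(s ^ \<rho>) $ i = 0" if "i < \<rho>" for i \<rho>
    using startsby_zero_power_prefix[OF s0] that by simp
  have tg: "taylor g $ i = (\<Sum>\<rho>\<le>r. hasse \<iota> t \<rho> g * (s ^ \<rho>) $ i)" if "i \<le> r" for i
  proof -
    have "taylor g $ i = (\<Sum>\<rho>\<le>i. hasse \<iota> t \<rho> g * (s ^ \<rho>) $ i)"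
      unfolding s_def by (rule hasse_change_variable(2)[OF field_hom_const tay t])
    also have "\<dots> = (\<Sum>\<rho>\<le>r. hasse \<iota> t \<rho> g * (s ^ \<rho>) $ i)"
      using that by (intro sum.mono_neutral_left) (auto simp: low)
    finally show ?thesis .
  qed
  have "hasse \<iota> \<pi> r (h * g) = (\<Sum>i\<le>r. taylor h $ i * taylor g $ (r - i))"
    unfolding hasse_param_eq taylor_mult[OF field_hom_const tay] by (simp add: fps_mult_nth atLeast0AtMost)
  also have "\<dots> = (\<Sum>i\<le>r. \<Sum>\<rho>\<le>r. taylor h $ i * (s ^ \<rho>) $ (r - i) * hasse \<iota> t \<rho> g)"
    by (intro sum.cong refl) (simp only: tg[OF diff_le_self] sum_distrib_left mult_ac)
  also have "\<dots> = (\<Sum>\<rho>\<le>r. (taylor h * s ^ \<rho>) $ r * hasse \<iota> t \<rho> g)"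
    by (subst sum.swap) (simp add: fps_mult_nth atLeast0AtMost sum_distrib_right)
  also have "\<dots> = (taylor h * s ^ r) $ r * hasse \<iota> t r g + (\<Sum>\<rho><r. (taylor h * s ^ \<rho>) $ r * hasse \<iota> t \<rho> g)"
    by (simp add: lessThan_Suc_atMost[symmetric] add.commute)
  also have "(taylor h * s ^ r) $ r = (\<Sum>i\<in>{0}. taylor h $ i * (s ^ r) $ (r - i))"
    unfolding fps_mult_nth by (rule sum.mono_neutral_right) (auto simp: low)
  also have "\<dots> = h * hasse \<iota> \<pi> 1 t ^ r"
    using startsby_zero_power_nth_same[OF s0, of r] taylor_nth_0[OF field_hom_const tay, of h]
    by (simp add: hasse_param_eq s_def)
  finally show ?thesis unfolding s_def .
qed

end

locale frobenius_data =
  fixes C :: "('v::finite, 'a::{field,finite} alg_closure) point set"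
    and \<iota> :: "'a alg_closure \<Rightarrow> 'f::field" and \<xi> :: "'v \<Rightarrow> 'f"
    and f :: "nat \<Rightarrow> 'f" and t :: 'f and n u m :: nat and \<kappa> :: "nat list"
    and P :: "('v, 'a alg_closure) point"
  assumes curve: "nonsingular_projective_curve C \<iota> \<xi>"
    and n: "n \<ge> 2" and um: "1 \<le> u" "u < m"
    and f: "\<forall>i\<le>n. f i \<in> base_functions \<iota> \<xi>" "nondegenerate C \<iota> \<xi> n f"
    and t: "separating_variable \<iota> \<xi> t"
    and kappa: "frob_order_sequence \<iota> t u m n f \<kappa>" "\<kappa> ! 0 = 0"
    and P: "P \<in> C"
begin

definition \<pi> :: 'f where "\<pi> = (SOME \<pi>. local_parameter \<iota> \<xi> P \<pi>)"

sublocale place_param \<iota> "local_ring \<iota> \<xi> P" "value_at \<iota> \<xi> P" \<pi>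
  unfolding \<pi>_def by (rule place_param_of_curve[OF curve P])

abbreviation "T \<equiv> frob_divisor \<iota> \<xi> t u m n f \<kappa> P"
abbreviation "js \<equiv> orders (linear_series \<iota> \<xi> n f) P"

lemma val_vl: "val \<iota> \<xi> P = vl" by (rule val_eq_vl[OF curve P])

lemma indep: "\<exists>i\<le>n. a i \<noteq> 0 \<Longrightarrow> (\<Sum>i\<le>n. \<iota> (a i) * f i) \<noteq> 0"
  by (rule nondegenerate_independent[OF curve f(2)])

lemma f_nonzero: "i \<le> n \<Longrightarrow> f i \<noteq> 0"
proof -
  assume i: "i \<le> n"
  have "(\<Sum>k\<le>n. \<iota> (if k = i then 1 else 0) * f k) = (\<Sum>k\<le>n. if k = i then f k else 0)"
    by (rule sum.cong) auto
  thus ?thesis using indep[of "\<lambda>k. if k = i then 1 else 0"] i by auto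
qed

definition i0 :: nat where "i0 = (SOME i. i \<le> n \<and> vl (f i) = Min ((\<lambda>i. vl (f i)) ` {..n}))"

lemma i0: "i0 \<le> n" "vl (f i0) = Min ((\<lambda>i. vl (f i)) ` {..n})"
proof -
  have "Min ((\<lambda>i. vl (f i)) ` {..n}) \<in> (\<lambda>i. vl (f i)) ` {..n}" by (rule Min_in) auto
  then obtain i where "i \<le> n" "vl (f i) = Min ((\<lambda>i. vl (f i)) ` {..n})" by (elim imageE) simp
  hence "i \<le> n \<and> vl (f i) = Min ((\<lambda>i. vl (f i)) ` {..n})" by (rule conjI)
  hence *: "i0 \<le> n \<and> vl (f i0) = Min ((\<lambda>i. vl (f i)) ` {..n})" unfolding i0_def by (rule someI)
  show "i0 \<le> n" by (rule conjunct1[OF *])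
  show "vl (f i0) = Min ((\<lambda>i. vl (f i)) ` {..n})" by (rule conjunct2[OF *])
qed

lemma E_div_eq: "E_div \<iota> \<xi> n f P = - vl (f i0)"
  by (simp add: E_div_def val_vl i0)

text \<open>Normalized so that all functions are regular at \<open>P\<close> and one of them is \<open>1\<close>.\<close>

definition F :: "nat \<Rightarrow> 'f" where "F i = f i / f i0"

lemma F_R: "i \<le> n \<Longrightarrow> F i \<in> local_ring \<iota> \<xi> P"
proof -
  assume i: "i \<le> n"
  have "vl (f i0) \<le> vl (f i)" unfolding i0(2) using i by (intro Min_le) auto
  hence "vl (F i) \<ge> 0" using f_nonzero[OF i] f_nonzero[OF i0(1)]
    by (simp add: F_def divide_inverse vl_mult vl_inverse)
  thus ?thesis using f_nonzero[OF i] f_nonzero[OF i0(1)] vl_nonneg_iff[of "F i"] by (simp add: F_def)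
qed

lemma F_i0: "F i0 = 1" using f_nonzero[OF i0(1)] by (simp add: F_def)

definition L :: "(nat \<Rightarrow> 'a alg_closure) \<Rightarrow> 'f" where "L a = (\<Sum>i\<le>n. \<iota> (a i) * F i)"

lemma L_eq: "L a = (\<Sum>i\<le>n. \<iota> (a i) * f i) * inverse (f i0)"
  by (simp add: L_def F_def sum_distrib_right divide_inverse mult.assoc)

lemma L_R: "L a \<in> local_ring \<iota> \<xi> P" unfolding L_def using F_R by (intro R_intros) auto

lemma L_nonzero: "\<exists>i\<le>n. a i \<noteq> 0 \<Longrightarrow> L a \<noteq> 0"
  using indep[of a] f_nonzero[OF i0(1)] by (simp add: L_eq)

definition J :: "nat set" where "J = {j. \<exists>a. (\<exists>i\<le>n. a i \<noteq> 0) \<and> vl (L a) = int j}"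

lemma order_set_eq: "order_set (linear_series \<iota> \<xi> n f) P = J"
proof -
  have v: "vl (\<Sum>i\<le>n. \<iota> (a i) * f i) + E_div \<iota> \<xi> n f P = vl (L a)" if "\<exists>i\<le>n. a i \<noteq> 0" for a
    using indep[OF that] f_nonzero[OF i0(1)] by (simp add: L_eq vl_mult vl_inverse E_div_eq)
  have "(\<exists>D\<in>linear_series \<iota> \<xi> n f. D P = int j) \<longleftrightarrow> (\<exists>a. (\<exists>i\<le>n. a i \<noteq> 0) \<and> vl (L a) = int j)" for j
  proof
    assume "\<exists>D\<in>linear_series \<iota> \<xi> n f. D P = int j"
    then obtain D where D: "D \<in> linear_series \<iota> \<xi> n f" "D P = int j" by blast
    then obtain a where "\<exists>i\<le>n. a i \<noteq> 0"
      "D = (\<lambda>P. div_fun \<iota> \<xi> (\<Sum>i\<le>n. \<iota> (a i) * f i) P + E_div \<iota> \<xi> n f P)"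
      unfolding linear_series_def by blast
    hence a: "\<exists>i\<le>n. a i \<noteq> 0" "vl (\<Sum>i\<le>n. \<iota> (a i) * f i) + E_div \<iota> \<xi> n f P = int j"
      using D(2) by (simp_all add: div_fun_def val_vl)
    thus "\<exists>a. (\<exists>i\<le>n. a i \<noteq> 0) \<and> vl (L a) = int j" using v[OF a(1)] by (intro exI[of _ a]) simp
  next
    assume "\<exists>a. (\<exists>i\<le>n. a i \<noteq> 0) \<and> vl (L a) = int j"
    then obtain a where a: "\<exists>i\<le>n. a i \<noteq> 0" "vl (L a) = int j" by blast
    let ?D = "\<lambda>P. div_fun \<iota> \<xi> (\<Sum>i\<le>n. \<iota> (a i) * f i) P + E_div \<iota> \<xi> n f P"
    have D: "?D \<in> linear_series \<iota> \<xi> n f" unfolding linear_series_def using a(1) by blast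
    have "?D P = int j" using v[OF a(1)] a(2) by (simp add: div_fun_def val_vl)
    thus "\<exists>D\<in>linear_series \<iota> \<xi> n f. D P = int j" by (intro bexI[OF _ D])
  qed
  thus ?thesis unfolding order_set_def J_def by simp
qed

lemma J: "finite J" "card J = n + 1"
  using order_basis[of n F] F_R L_nonzero unfolding J_def L_def by blast+

lemma js_eq: "js = sorted_list_of_set J"
  by (simp add: orders_def order_set_eq)

lemma length_js: "length js = n + 1" and set_js: "set js = J"
  using J by (simp_all add: js_eq)

lemma js_less: "i < i' \<Longrightarrow> i' \<le> n \<Longrightarrow> js ! i < js ! i'"
  using sorted_wrt_nth_less[of "(<)" js i i'] length_js strict_sorted_list_of_set[of J] by (simp add: js_eq)

lemma L_unit: "i \<le> n \<Longrightarrow> L (\<lambda>k. if k = i then 1 else 0) = F i"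
proof -
  assume "i \<le> n"
  moreover have "L (\<lambda>k. if k = i then 1 else 0) = (\<Sum>k\<le>n. if k = i then F k else 0)"
    unfolding L_def by (rule sum.cong) auto
  ultimately show ?thesis by simp
qed

lemma js_0: "js ! 0 = 0"
proof -
  have "vl (L (\<lambda>k. if k = i0 then 1 else 0)) = int 0" using L_unit[OF i0(1)] by (simp add: F_i0 vl_1)
  hence "0 \<in> J" using i0(1) unfolding J_def by (intro CollectI exI[of _ "\<lambda>k. if k = i0 then 1 else 0"]) auto
  hence "0 \<in> set js" by (simp add: set_js)
  then obtain i where "i < n + 1" "js ! i = 0" by (auto simp: in_set_conv_nth length_js)
  thus ?thesis using js_less[of 0 i] by (cases "i = 0") auto
qed

lemma js_1_le: "x \<in> J \<Longrightarrow> x \<noteq> 0 \<Longrightarrow> js ! 1 \<le> x"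
proof -
  assume x: "x \<in> J" "x \<noteq> 0"
  hence "x \<in> set js" by (simp add: set_js)
  then obtain i where i: "i < n + 1" "js ! i = x" by (auto simp: in_set_conv_nth length_js)
  have "i \<noteq> 0"
  proof
    assume "i = 0"
    thus False using i(2) x(2) js_0 by simp
  qed
  hence "i = 1 \<or> 1 < i" by linarith
  thus ?thesis using js_less[of 1 i] i by auto
qed

text \<open>The coefficients of functions of the given orders. For order \<open>0\<close> the constant function \<open>1\<close> is chosen, which
  the case of a rational point uses to clear a column.\<close>

definition A :: "nat \<Rightarrow> nat \<Rightarrow> 'a alg_closure" where
  "A i = (if i = 0 then (\<lambda>k. if k = i0 then 1 else 0) else (SOME a. (\<exists>i\<le>n. a i \<noteq> 0) \<and> vl (L a) = int (js ! i)))"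

lemma A: "i \<le> n \<Longrightarrow> \<exists>k\<le>n. A i k \<noteq> 0" "i \<le> n \<Longrightarrow> vl (L (A i)) = int (js ! i)"
proof -
  assume i: "i \<le> n"
  have "(\<exists>k\<le>n. A i k \<noteq> 0) \<and> vl (L (A i)) = int (js ! i)"
  proof (cases "i = 0")
    case True
    thus ?thesis using i0(1) L_unit[OF i0(1)] by (auto simp: A_def F_i0 vl_1 js_0)
  next
    case False
    have "js ! i \<in> set js" using i by (intro nth_mem) (simp add: length_js)
    hence "js ! i \<in> J" by (simp add: set_js)
    hence "\<exists>a. (\<exists>i\<le>n. a i \<noteq> 0) \<and> vl (L a) = int (js ! i)" unfolding J_def by blast
    from someI_ex[OF this] show ?thesis unfolding A_def using False by simp
  qed
  thus "\<exists>k\<le>n. A i k \<noteq> 0" "vl (L (A i)) = int (js ! i)" by auto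
qed

definition g :: "nat \<Rightarrow> 'f" where "g i = L (A i)"

lemma g: "g i \<in> local_ring \<iota> \<xi> P" "i \<le> n \<Longrightarrow> g i \<noteq> 0" "i \<le> n \<Longrightarrow> vl (g i) = int (js ! i)"
  using L_R L_nonzero A by (auto simp: g_def)

lemma g_0: "g 0 = 1" using L_unit[OF i0(1)] by (simp add: g_def A_def F_i0)

lemma det_A: "det (mat (n + 1) (n + 1) (\<lambda>(i, c). A i c)) \<noteq> 0"
proof
  assume "det (mat (n + 1) (n + 1) (\<lambda>(i, c). A i c)) = 0"
  then obtain v where v: "\<exists>r<n + 1. v r \<noteq> 0" "\<And>c. c < n + 1 \<Longrightarrow> (\<Sum>r<n + 1. v r * A r c) = 0"
    unfolding det_eq_0_iff_rows_dependent by blast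
  have v2: "(\<Sum>r\<le>n. v r * A r c) = 0" if "c \<le> n" for c
    using v(2)[of c] that by (simp add: lessThan_Suc_atMost del: sum.lessThan_Suc)
  have "(\<Sum>r\<le>n. \<iota> (v r) * g r) = (\<Sum>r\<le>n. \<Sum>c\<le>n. \<iota> (v r * A r c) * F c)"
    by (simp add: g_def L_def sum_distrib_left const.hom_mult mult.assoc)
  also have "\<dots> = (\<Sum>c\<le>n. \<iota> (\<Sum>r\<le>n. v r * A r c) * F c)"
    by (subst sum.swap) (simp add: const.hom_sum sum_distrib_right)
  also have "\<dots> = 0" by (rule sum.neutral) (auto simp: v2)
  finally have eq: "(\<Sum>r\<le>n. \<iota> (v r) * g r) = 0" .
  have inj: "inj_on (\<lambda>r. vl (g r)) {..n}"
  proof (rule inj_onI)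
    fix x y assume *: "x \<in> {..n}" "y \<in> {..n}" "vl (g x) = vl (g y)"
    hence "js ! x = js ! y" using g(3)[of x] g(3)[of y] by simp
    thus "x = y" using js_less[of x y] js_less[of y x] *(1,2) by (cases x y rule: linorder_cases) auto
  qed
  have "v r = 0" if "r < n + 1" for r
    by (rule distinct_vl_independent[OF _ _ inj eq]) (use g that in auto)
  thus False using v(1) by blast
qed

lemma kappa_props: "length \<kappa> = n - 1" "sorted_wrt (<) \<kappa>"
  using kappa(1) unfolding frob_order_sequence_def by auto

lemma sum_list_kappa: "sum_list \<kappa> = (\<Sum>s<n - 1. \<kappa> ! s)"
  by (simp add: sum_list_sum_nth kappa_props atLeast0LessThan)

lemma frob_det_eq: "frob_det \<iota> t u m n f \<rho> =
    det (rows_mat n (\<lambda>c. f c ^ (CARD('a) ^ m)) (\<lambda>c. f c ^ (CARD('a) ^ u)) (\<lambda>\<rho> c. hasse \<iota> t \<rho> (f c)) \<rho>)"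
  by (simp add: frob_det_def rows_mat_def)

definition yy :: "nat \<Rightarrow> 'f" where "yy i = (\<Sum>c\<le>n. \<iota> (A i c) * F c ^ (CARD('a) ^ m))"
definition zz :: "nat \<Rightarrow> 'f" where "zz i = (\<Sum>c\<le>n. \<iota> (A i c) * F c ^ (CARD('a) ^ u))"

definition N :: 'f where
  "N = det (rows_mat n yy zz (\<lambda>\<rho> i. hasse \<iota> \<pi> \<rho> (g i)) \<kappa>)"

lemma hasse_param_linear: "hasse \<iota> \<pi> r (\<Sum>c\<le>n. \<iota> (a c) * x c) = (\<Sum>c\<le>n. \<iota> (a c) * hasse \<iota> \<pi> r (x c))"
  unfolding hasse_param_eq
  by (simp add: taylor_sum[OF field_hom_const taylor_hom_param] taylor_mult[OF field_hom_const taylor_hom_param]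
      taylor_const[OF field_hom_const taylor_hom_param] fps_sum_nth)

text \<open>The divisor at \<open>P\<close> is the order of the determinant in the local parameter, for a basis adapted to
  the orders.\<close>

lemma T_eq_vl_N: "N \<noteq> 0" "T = vl N"
proof -
  define \<delta> where "\<delta> = hasse \<iota> \<pi> 1 t"
  define h where "h = inverse (f i0)"
  define D where "D = frob_det \<iota> t u m n f \<kappa>"
  have sep: "separable_variable \<iota> t" by (rule separable_variable_of_separating[OF curve P t])
  have D0: "D \<noteq> 0" using kappa(1) by (simp add: frob_order_sequence_def D_def)
  have \<delta>0: "\<delta> \<noteq> 0"
    using taylor_separable_nonzero[OF field_hom_const taylor_hom_param sep] by (simp add: \<delta>_def hasse_param_eq)
  have h0: "h \<noteq> 0" and vh: "vl h = E_div \<iota> \<xi> n f P"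
    using f_nonzero[OF i0(1)] by (simp_all add: h_def vl_inverse E_div_eq)
  have Fh: "F c = h * f c" for c by (simp add: F_def h_def divide_inverse mult.commute)
  let ?M = "rows_mat n (\<lambda>c. F c ^ (CARD('a) ^ m)) (\<lambda>c. F c ^ (CARD('a) ^ u)) (\<lambda>\<rho> c. hasse \<iota> \<pi> \<rho> (F c)) \<kappa>"
  have det_M: "det ?M = h ^ (CARD('a) ^ m) * h ^ (CARD('a) ^ u) * (\<Prod>s<n - 1. h * \<delta> ^ (\<kappa> ! s)) * D"
    unfolding D_def frob_det_eq
  proof (rule det_rows_mat_triangular[where e = "\<lambda>s \<rho>. (taylor h * (taylor t - fps_const t) ^ \<rho>) $ (\<kappa> ! s)"])
    show "det (rows_mat n (\<lambda>c. f c ^ (CARD('a) ^ m)) (\<lambda>c. f c ^ (CARD('a) ^ u)) (\<lambda>\<rho> c. hasse \<iota> t \<rho> (f c)) \<kappa>) \<noteq> 0"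
      using D0 unfolding D_def frob_det_eq .
    show "\<kappa> = \<rho> \<or> (\<kappa>, \<rho>) \<in> lexord less_than"
      if "length \<rho> = n - 1" "sorted_wrt (<) \<rho>"
        "det (rows_mat n (\<lambda>c. f c ^ (CARD('a) ^ m)) (\<lambda>c. f c ^ (CARD('a) ^ u)) (\<lambda>\<rho> c. hasse \<iota> t \<rho> (f c)) \<rho>) \<noteq> 0" for \<rho>
      using kappa(1) that unfolding frob_order_sequence_def frob_det_eq by blast
    show "hasse \<iota> \<pi> (\<kappa> ! s) (F c) = h * \<delta> ^ (\<kappa> ! s) * hasse \<iota> t (\<kappa> ! s) (f c) +
        (\<Sum>\<rho><\<kappa> ! s. (taylor h * (taylor t - fps_const t) ^ \<rho>) $ (\<kappa> ! s) * hasse \<iota> t \<rho> (f c))" for s c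
      unfolding Fh \<delta>_def by (rule hasse_param_mult_change[OF sep])
  qed (simp_all add: Fh power_mult_distrib n kappa_props)
  have prod: "(\<Prod>s<n - 1. h * \<delta> ^ (\<kappa> ! s)) = h ^ (n - 1) * \<delta> ^ sum_list \<kappa>"
    by (simp add: prod.distrib sum_list_kappa power_sum)
  have M0: "det ?M \<noteq> 0" using D0 \<delta>0 h0 by (simp add: det_M prod)
  have "vl (det ?M) = int (CARD('a) ^ m) * vl h + int (CARD('a) ^ u) * vl h + (int (n - 1) * vl h + int (sum_list \<kappa>) * vl \<delta>) + vl D"
    unfolding det_M prod using D0 \<delta>0 h0 by (simp only: vl_mult vl_power mult_eq_0_iff power_eq_0_iff simp_thms)
  also have "\<dots> = T"
  proof -
    have "int (CARD('a) ^ m + CARD('a) ^ u + n - 1) = int (CARD('a) ^ m) + int (CARD('a) ^ u) + int (n - 1)" using n by simp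
    thus ?thesis
      unfolding frob_divisor_def div_fun_def div_diff_def val_vl vh \<pi>_def[symmetric] \<delta>_def[symmetric] D_def[symmetric]
      by (simp only: distrib_right add_ac)
  qed
  finally have T: "T = vl (det ?M)" ..
  let ?B = "mat (n + 1) (n + 1) (\<lambda>(c, i). \<iota> (A i c))"
  have "rows_mat n yy zz (\<lambda>\<rho> i. hasse \<iota> \<pi> \<rho> (g i)) \<kappa> = ?M * ?B"
  proof (rule eq_matI)
    fix r i assume ri: "r < dim_row (?M * ?B)" "i < dim_col (?M * ?B)"
    hence r: "r < n + 1" and i: "i < n + 1" by (auto simp: rows_mat_def)
    have "(?M * ?B) $$ (r, i) = (\<Sum>c<n + 1. ?M $$ (r, c) * \<iota> (A i c))"
      using r i by (simp add: rows_mat_def scalar_prod_def atLeast0LessThan)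
    also have "\<dots> = (\<Sum>c\<le>n. \<iota> (A i c) * ?M $$ (r, c))"
      by (simp only: Suc_eq_plus1[symmetric] lessThan_Suc_atMost mult.commute)
    also have "\<dots> = (\<Sum>c\<le>n. \<iota> (A i c) * (if r = 0 then F c ^ (CARD('a) ^ m) else if r = 1 then F c ^ (CARD('a) ^ u)
        else hasse \<iota> \<pi> (\<kappa> ! (r - 2)) (F c)))"
      using r by (intro sum.cong) (auto simp: rows_mat_def)
    also have "\<dots> = rows_mat n yy zz (\<lambda>\<rho> i. hasse \<iota> \<pi> \<rho> (g i)) \<kappa> $$ (r, i)"
      using r i by (simp add: rows_mat_def yy_def zz_def g_def L_def hasse_param_linear)
    finally show "rows_mat n yy zz (\<lambda>\<rho> i. hasse \<iota> \<pi> \<rho> (g i)) \<kappa> $$ (r, i) = (?M * ?B) $$ (r, i)" ..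
  qed (auto simp: rows_mat_def)
  hence "N = det ?M * det ?B"
    unfolding N_def by (simp only:) (rule det_mult[of _ "n + 1"], auto simp: rows_mat_def)
  also have "det ?B = \<iota> (det (mat (n + 1) (n + 1) (\<lambda>(i, c). A i c)))"
  proof -
    have "?B = map_mat \<iota> (transpose_mat (mat (n + 1) (n + 1) (\<lambda>(i, c). A i c)))"
      by (intro eq_matI) auto
    thus ?thesis by (simp only: const.hom_det) (subst det_transpose[of _ "n + 1"], auto)
  qed
  finally have N_eq: "N = det ?M * \<iota> (det (mat (n + 1) (n + 1) (\<lambda>(i, c). A i c)))" .
  let ?d = "det (mat (n + 1) (n + 1) (\<lambda>(i, c). A i c))"
  have d: "\<iota> ?d \<noteq> 0" "vl (\<iota> ?d) = 0"
    using det_A ev_const[of ?d] R_const[of ?d] by (auto intro!: vl_unit)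
  show "N \<noteq> 0" using N_eq M0 d(1) by (simp only: mult_eq_0_iff simp_thms)
  show "T = vl N" unfolding N_eq T vl_mult[OF M0 d(1)] d(2) by simp
qed

definition w :: "nat \<Rightarrow> 'a alg_closure fps" where
  "w i = (SOME w. expand (g i) = fps_X ^ (js ! i) * w \<and> w $ 0 \<noteq> 0)"

lemma w: "i \<le> n \<Longrightarrow> expand (g i) = fps_X ^ (js ! i) * w i" "i \<le> n \<Longrightarrow> w i $ 0 \<noteq> 0"
proof -
  assume i: "i \<le> n"
  have "\<exists>w. expand (g i) = fps_X ^ (js ! i) * w \<and> w $ 0 \<noteq> 0"
    by (rule expand_factor_vl[OF g(1) g(2)[OF i] g(3)[OF i]]) blast
  from someI_ex[OF this] show "expand (g i) = fps_X ^ (js ! i) * w i" "w i $ 0 \<noteq> 0"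
    unfolding w_def by auto
qed

definition dd :: "nat \<Rightarrow> nat \<Rightarrow> 'a alg_closure fps" where "dd s i = fps_hasse (\<kappa> ! s) (expand (g i))"
definition bb :: "nat \<Rightarrow> nat \<Rightarrow> 'a alg_closure fps" where
  "bb s i = Abs_fps (\<lambda>k. of_nat ((js ! i + k) choose (\<kappa> ! s)) * w i $ k)"

sublocale gr: graded_rows n "(!) js" "(!) \<kappa>" dd bb
  by unfold_locales (use n js_less js_0 in \<open>auto simp: dd_def bb_def w fps_hasse_factor\<close>)

lemma yy_R: "yy i \<in> local_ring \<iota> \<xi> P" and zz_R: "zz i \<in> local_ring \<iota> \<xi> P"
  unfolding yy_def zz_def using F_R by (auto intro!: R_intros)

lemma expand_N: "expand N = gr.bordered_det (\<lambda>i. expand (yy i)) (\<lambda>i. expand (zz i))"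
proof -
  let ?m = "\<lambda>r c. if r = 0 then yy c else if r = 1 then zz c else hasse \<iota> \<pi> (\<kappa> ! (r - 2)) (g c)"
  have "expand N = expand (det (mat (n + 1) (n + 1) (\<lambda>(r, c). ?m r c)))"
    by (simp add: N_def rows_mat_def)
  also have "\<dots> = det (mat (n + 1) (n + 1) (\<lambda>(r, c). expand (?m r c)))"
    by (rule expand_det(2)) (auto intro: yy_R zz_R hasse_param_R g)
  also have "\<dots> = gr.bordered_det (\<lambda>i. expand (yy i)) (\<lambda>i. expand (zz i))"
    unfolding gr.bordered_det_def
    by (intro arg_cong[of _ _ det] eq_matI) (auto simp: dd_def expand_hasse_param[OF g(1)])
  finally show ?thesis .
qed

lemma N_R: "N \<in> local_ring \<iota> \<xi> P"
  unfolding N_def rows_mat_def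
  using expand_det(1)[of "n + 1" "\<lambda>r c. if r = 0 then yy c else if r = 1 then zz c else hasse \<iota> \<pi> (\<kappa> ! (r - 2)) (g c)"]
    yy_R zz_R hasse_param_R g(1) by simp

lemma T_eq_subdegree: "T + int (\<Sum>s<n - 1. \<kappa> ! s) = int (subdegree (fps_X ^ (\<Sum>s<n - 1. \<kappa> ! s) * expand N))"
  and X_expand_N_nonzero: "fps_X ^ (\<Sum>s<n - 1. \<kappa> ! s) * expand N \<noteq> 0"
  using subdegree_expand[OF N_R T_eq_vl_N(1)] T_eq_vl_N(2) by simp_all

lemma T_ge:
  assumes "fps_X ^ B dvd fps_X ^ (\<Sum>s<n - 1. \<kappa> ! s) * expand N"
  shows "T \<ge> int B - int (\<Sum>s<n - 1. \<kappa> ! s)"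
proof -
  have "B \<le> subdegree (fps_X ^ (\<Sum>s<n - 1. \<kappa> ! s) * expand N)"
    using assms X_expand_N_nonzero fps_dvd_iff[of "fps_X ^ B" "fps_X ^ (\<Sum>s<n - 1. \<kappa> ! s) * expand N"] by simp
  thus ?thesis using T_eq_subdegree by linarith
qed

lemma minor_eq_0_iff:
  assumes "k \<le> 2"
  shows "gr.minor (\<lambda>c. c + k) $ 0 = 0 \<longleftrightarrow> int CHAR('a) dvd binom_det js \<kappa> n k"
proof -
  let ?b = "\<lambda>s c. int ((js ! (k + c)) choose (\<kappa> ! s))"
  let ?A = "mat (n - 1) (n - 1) (\<lambda>(s, c). ?b s c)"
  have "gr.minor (\<lambda>c. c + k) $ 0 = det (mat (n - 1) (n - 1) (\<lambda>(s, c). 1 * (w (k + c) $ 0 * of_int (?b s c))))"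
    unfolding gr.minor_nth_0 by (intro arg_cong[of _ _ det] eq_matI) (auto simp: bb_def add.commute)
  also have "\<dots> = (\<Prod>c<n - 1. w (k + c) $ 0) * det (mat (n - 1) (n - 1) (\<lambda>(s, c). of_int (?b s c)))"
    unfolding det_scale_rows_cols by simp
  also have "det (mat (n - 1) (n - 1) (\<lambda>(s, c). of_int (?b s c))) = (of_int (binom_det js \<kappa> n k) :: 'a alg_closure)"
  proof -
    have "mat (n - 1) (n - 1) (\<lambda>(s, c). of_int (?b s c) :: 'a alg_closure) = map_mat of_int ?A"
      by (intro eq_matI) auto
    hence "det (mat (n - 1) (n - 1) (\<lambda>(s, c). of_int (?b s c) :: 'a alg_closure)) = of_int (det ?A)"
      by (simp only: of_int_hom.hom_det)
    also have "?A = transpose_mat (mat (n - 1) (n - 1) (\<lambda>(i, s). int ((js ! (k + i)) choose (\<kappa> ! s))))"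
      by (intro eq_matI) auto
    hence "det ?A = binom_det js \<kappa> n k"
      unfolding binom_det_def by (simp only:) (rule det_transpose[of _ "n - 1"], simp)
    finally show ?thesis .
  qed
  finally have "gr.minor (\<lambda>c. c + k) $ 0 = (\<Prod>c<n - 1. w (k + c) $ 0) * of_int (binom_det js \<kappa> n k)" .
  moreover have "(\<Prod>c<n - 1. w (k + c) $ 0) \<noteq> 0" using w(2) assms by simp
  ultimately show ?thesis by (simp add: of_int_eq_0_iff_char_dvd)
qed

lemma sum_diff_kappa: "(\<Sum>i\<le>n - 2. int (x i) - int (\<kappa> ! i)) = int (\<Sum>i\<le>n - 2. x i) - int (\<Sum>s<n - 1. \<kappa> ! s)"
proof -
  have "{..n - 2} = {..<n - 1}" using n by auto
  thus ?thesis by (simp add: sum_subtractf)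
qed

text \<open>For arbitrary \<open>P\<close>, the general estimate applies to the given rows.\<close>

lemma bound_arbitrary:
  "T \<ge> (\<Sum>i\<le>n - 2. int (js ! i) - int (\<kappa> ! i))"
  "int CHAR('a) dvd binom_det js \<kappa> n 0 \<Longrightarrow> T > (\<Sum>i\<le>n - 2. int (js ! i) - int (\<kappa> ! i))"
proof -
  note b = gr.bordered_det_order[of 0 "\<lambda>i. expand (yy i)" "\<lambda>i. expand (zz i)", folded expand_N]
  show "T \<ge> (\<Sum>i\<le>n - 2. int (js ! i) - int (\<kappa> ! i))"
    unfolding sum_diff_kappa by (rule T_ge) (use b(1) in simp)
  assume p: "int CHAR('a) dvd binom_det js \<kappa> n 0"
  have "gr.minor id $ 0 = 0" using minor_eq_0_iff[of 0] p by (simp add: id_def)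
  hence "T \<ge> int (Suc (\<Sum>i\<le>n - 2. js ! i)) - int (\<Sum>s<n - 1. \<kappa> ! s)"
    by (intro T_ge) (use b(2) in simp)
  thus "T > (\<Sum>i\<le>n - 2. int (js ! i) - int (\<kappa> ! i))" unfolding sum_diff_kappa by simp
qed

end

context frobenius_data
begin

lemma char_K: "CHAR('f) = CHAR('a)"
  using char_f by simp

lemma card_power_ge_2: "r > 0 \<Longrightarrow> CARD('a) ^ r \<ge> 2"
proof -
  assume "r > 0"
  have "card {0, 1 :: 'a} \<le> CARD('a)" by (rule card_mono) auto
  hence "CARD('a) \<ge> 2" by simp
  thus ?thesis using \<open>r > 0\<close> self_le_power[of "CARD('a)" r] by linarith
qed

lemma expand_power_dvd:
  "x \<in> local_ring \<iota> \<xi> P \<Longrightarrow> fps_X ^ k dvd expand x \<Longrightarrow> fps_X ^ (k * e) dvd expand (x ^ e)"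
  by (simp add: expand_power power_mult dvd_power_same)

text \<open>If \<open>P\<close> is rational over the field of \<open>q ^ r\<close> elements, then the row of \<open>q ^ r\<close>-th powers consists
  of the \<open>q ^ r\<close>-th powers of functions of the same orders as the \<open>g i\<close>: apply the inverse Frobenius
  map to the coefficients.\<close>

definition frob_row :: "nat \<Rightarrow> nat \<Rightarrow> 'f" where
  "frob_row r i = (\<Sum>c\<le>n. \<iota> (A i c) * F c ^ (CARD('a) ^ r))"

lemma frob_row_rational:
  assumes P: "P \<in> rational_points C (CARD('a) ^ r)"
  obtains G where "\<And>i. G i \<in> local_ring \<iota> \<xi> P" "\<And>i. i \<le> n \<Longrightarrow> G i \<noteq> 0"
    "\<And>i. i \<le> n \<Longrightarrow> vl (G i) = int (js ! i)" "\<And>i. frob_row r i = G i ^ (CARD('a) ^ r)"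
proof -
  let ?Q = "CARD('a) ^ r"
  obtain \<theta> \<theta>' where s: "semilinear C \<iota> \<xi> P \<theta> \<theta>'" and \<theta>: "\<And>c. \<theta> c ^ ?Q = c"
    using semilinear_of_rational_point[OF curve P] by blast
  interpret s: semilinear C \<iota> \<xi> P \<theta> \<theta>' by (rule s)
  have tF: "s.twist (F c) = F c" if "c \<le> n" for c
  proof -
    have "f i0 * F c = f c" using f_nonzero[OF i0(1)] by (simp add: F_def)
    hence "s.twist (f i0) * s.twist (F c) = s.twist (f c)" by (simp flip: s.twist_mult)
    hence "f i0 * s.twist (F c) = f c" using f(1) i0(1) that by (simp add: s.twist_base)
    thus ?thesis using f_nonzero[OF i0(1)] by (simp add: F_def field_simps)
  qed
  have sum: "s.twist (sum x I) = (\<Sum>i\<in>I. s.twist (x i))" for x and I :: "nat set"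
    using s.twist_const[of 0] by (induction I rule: infinite_finite_induct) (auto simp: s.twist_add)
  show thesis
  proof (rule that[of "\<lambda>i. s.twist (g i)"])
    show "s.twist (g i) \<in> local_ring \<iota> \<xi> P" for i by (rule s.twist_local[OF g(1)])
    fix i
    have "s.twist (g i) = (\<Sum>c\<le>n. \<iota> (\<theta> (A i c)) * F c)"
      by (simp add: g_def L_def sum s.twist_mult s.twist_const tF)
    hence "s.twist (g i) ^ ?Q = (\<Sum>c\<le>n. (\<iota> (\<theta> (A i c)) * F c) ^ ?Q)"
      by (simp only: frobenius_sum[OF char_K])
    also have "\<dots> = frob_row r i"
      unfolding frob_row_def by (simp only: power_mult_distrib const.hom_power[symmetric] \<theta>)
    finally show "frob_row r i = s.twist (g i) ^ ?Q" ..
    assume i: "i \<le> n"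
    show "vl (s.twist (g i)) = int (js ! i)"
      using s.vl_twist[OF g(1) g(2)[OF i] param] g(3)[OF i] by simp
    show "s.twist (g i) \<noteq> 0"
      using s.twist_twist[of "g i"] g(2)[OF i] semilinear.twist_const[OF s.inverse_semilinear, of 0] by auto
  qed
qed

lemma frob_row_expand:
  assumes P: "P \<in> rational_points C (CARD('a) ^ r)" and i: "i \<le> n"
  obtains v where "expand (frob_row r i) = fps_X ^ (CARD('a) ^ r * js ! i) * v" "v $ 0 \<noteq> 0"
proof -
  obtain G where G: "\<And>i. G i \<in> local_ring \<iota> \<xi> P" "\<And>i. i \<le> n \<Longrightarrow> G i \<noteq> 0"
    "\<And>i. i \<le> n \<Longrightarrow> vl (G i) = int (js ! i)" "\<And>i. frob_row r i = G i ^ (CARD('a) ^ r)"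
    using frob_row_rational[OF P] by blast
  have "vl (frob_row r i) = int (CARD('a) ^ r * js ! i)"
    unfolding G(4) using vl_power[OF G(2)[OF i], of "CARD('a) ^ r"] G(3)[OF i] by simp
  moreover have "frob_row r i \<in> local_ring \<iota> \<xi> P" "frob_row r i \<noteq> 0"
    unfolding G(4) using G(1,2) i by (auto intro: R_power)
  ultimately show thesis using expand_factor_vl[of "frob_row r i"] that by blast
qed

lemma yy_frob_row: "yy i = frob_row m i" and zz_frob_row: "zz i = frob_row u i"
  by (simp_all add: yy_def zz_def frob_row_def)

lemma bordered_det_swap: "gr.bordered_det z y = - gr.bordered_det y z"
proof -
  let ?m = "\<lambda>r c. if r = 0 then y c else if r = 1 then z c else dd (r - 2) c"
  have "gr.bordered_det z y = det (mat (n + 1) (n + 1) (\<lambda>(r, c). if r = 0 then ?m 1 c else if r = 1 then ?m 0 c else ?m r c))"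
    unfolding gr.bordered_det_def by (intro arg_cong[of _ _ det] eq_matI) auto
  also have "\<dots> = - gr.bordered_det y z"
    unfolding gr.bordered_det_def by (rule det_swap_rows_01) (use n in simp)
  finally show ?thesis .
qed

lemma sum_diff_kappa': "(\<Sum>i=1..n - 1. int (js ! i) - int (\<kappa> ! (i - 1))) = int (\<Sum>i=1..n - 1. js ! i) - int (\<Sum>s<n - 1. \<kappa> ! s)"
proof -
  have "(\<Sum>i=1..n - 1. int (\<kappa> ! (i - 1))) = (\<Sum>s<n - 1. int (\<kappa> ! s))"
    by (rule sum.reindex_bij_witness[of _ Suc "\<lambda>i. i - 1"]) auto
  thus ?thesis by (simp add: sum_subtractf)
qed

lemma bound_rational_u_or_m:
  assumes r: "r \<in> {u, m}" and P: "P \<in> rational_points C (CARD('a) ^ r)"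
  shows "T \<ge> (\<Sum>i=1..n - 1. int (js ! i) - int (\<kappa> ! (i - 1)))"
    and "int CHAR('a) dvd binom_det js \<kappa> n 1 \<Longrightarrow> T > (\<Sum>i=1..n - 1. int (js ! i) - int (\<kappa> ! (i - 1)))"
proof -
  have r0: "r > 0" using r um by auto
  have dvd: "fps_X ^ (CARD('a) ^ r * js ! i) dvd expand (frob_row r i)" if i: "i \<le> n" for i
  proof -
    obtain v where "expand (frob_row r i) = fps_X ^ (CARD('a) ^ r * js ! i) * v"
      by (rule frob_row_expand[OF P i])
    thus ?thesis by simp
  qed
  have est: "fps_X ^ (\<Sum>i=1..n - 1. js ! i) dvd fps_X ^ (\<Sum>s<n - 1. \<kappa> ! s) * expand N \<and>
    (gr.minor Suc $ 0 = 0 \<longrightarrow> fps_X ^ Suc (\<Sum>i=1..n - 1. js ! i) dvd fps_X ^ (\<Sum>s<n - 1. \<kappa> ! s) * expand N)"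
  proof (cases "r = m")
    case True
    show ?thesis unfolding expand_N yy_frob_row
      using gr.bordered_det_order_power[of "CARD('a) ^ r" "\<lambda>i. expand (frob_row m i)" "\<lambda>i. expand (zz i)"]
        dvd card_power_ge_2[OF r0] True by blast
  next
    case False
    hence ru: "r = u" using r by simp
    have "expand N = - gr.bordered_det (\<lambda>i. expand (zz i)) (\<lambda>i. expand (yy i))"
      unfolding expand_N by (rule bordered_det_swap)
    thus ?thesis unfolding zz_frob_row
      using gr.bordered_det_order_power[of "CARD('a) ^ r" "\<lambda>i. expand (frob_row u i)" "\<lambda>i. expand (yy i)"]
        dvd card_power_ge_2[OF r0] ru by simp
  qed
  show "T \<ge> (\<Sum>i=1..n - 1. int (js ! i) - int (\<kappa> ! (i - 1)))"
    unfolding sum_diff_kappa' by (rule T_ge) (rule conjunct1[OF est])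
  assume "int CHAR('a) dvd binom_det js \<kappa> n 1"
  hence "gr.minor Suc $ 0 = 0" using minor_eq_0_iff[of 1] by simp
  hence "T \<ge> int (Suc (\<Sum>i=1..n - 1. js ! i)) - int (\<Sum>s<n - 1. \<kappa> ! s)"
    using est by (intro T_ge) blast
  thus "T > (\<Sum>i=1..n - 1. int (js ! i) - int (\<kappa> ! (i - 1)))" unfolding sum_diff_kappa' by simp
qed

lemma bordered_det_subtract: "gr.bordered_det (\<lambda>i. y i - z i) z = gr.bordered_det y z"
proof -
  let ?m = "\<lambda>r c. if r = 0 then y c else if r = 1 then z c else dd (r - 2) c"
  have "gr.bordered_det (\<lambda>i. y i - z i) z =
      det (mat (n + 1) (n + 1) (\<lambda>(r, c). if r = 0 then ?m 0 c - ?m 1 c else ?m r c))"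
    unfolding gr.bordered_det_def by (intro arg_cong[of _ _ det] eq_matI) auto
  also have "\<dots> = gr.bordered_det y z"
    unfolding gr.bordered_det_def by (rule det_subtract_row) (use n in auto)
  finally show ?thesis .
qed

text \<open>The values \<open>F c\<close> at \<open>P\<close> are rational over the field of \<open>Q = q ^ (m - u)\<close> elements. So \<open>F c ^ Q - F c\<close>
  is \<open>W ^ Q - W\<close> for \<open>W = F c - F c (P)\<close>, which is a combination of the \<open>f i / f i0\<close> vanishing at \<open>P\<close>.\<close>

lemma bound_rational_m_minus_u:
  assumes P: "P \<in> rational_points C (CARD('a) ^ (m - u))"
  shows "T \<ge> int (js ! 1 * CARD('a) ^ u) + (\<Sum>i\<le>n - 2. int (js ! i) - int (\<kappa> ! i))"
    and "int CHAR('a) dvd binom_det js \<kappa> n 0 \<Longrightarrow>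
      T > int (js ! 1 * CARD('a) ^ u) + (\<Sum>i\<le>n - 2. int (js ! i) - int (\<kappa> ! i))"
proof -
  let ?Q = "CARD('a) ^ (m - u)" and ?e = "js ! 1 * CARD('a) ^ u"
  obtain \<theta> \<theta>' where s: "semilinear C \<iota> \<xi> P \<theta> \<theta>'" and \<theta>: "\<And>c. \<theta> c ^ ?Q = c"
    using semilinear_of_rational_point[OF curve P] by blast
  interpret s: semilinear C \<iota> \<xi> P \<theta> \<theta>' by (rule s)
  have QK: "(x + y) ^ ?Q = x ^ ?Q + y ^ ?Q" for x y :: 'f by (rule frobenius_add[OF char_K])
  have dvdF: "fps_X ^ ?e dvd expand (F c ^ (CARD('a) ^ m) - F c ^ (CARD('a) ^ u))" if c: "c \<le> n" for c
  proof -
    have tF: "s.twist (F c) = F c"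
    proof -
      have "f i0 * F c = f c" using f_nonzero[OF i0(1)] by (simp add: F_def)
      hence "s.twist (f i0) * s.twist (F c) = s.twist (f c)" by (simp flip: s.twist_mult)
      hence "f i0 * s.twist (F c) = f c" using f(1) i0(1) c by (simp add: s.twist_base)
      thus ?thesis using f_nonzero[OF i0(1)] by (simp add: F_def field_simps)
    qed
    define \<gamma> where "\<gamma> = value_at \<iota> \<xi> P (F c)"
    have "\<theta> \<gamma> = \<gamma>" using s.value_at_twist[OF F_R[OF c]] by (simp add: tF \<gamma>_def)
    hence \<gamma>: "\<gamma> ^ ?Q = \<gamma>" using \<theta>[of \<gamma>] by simp
    define W where "W = F c - \<iota> \<gamma>"
    have WR: "W \<in> local_ring \<iota> \<xi> P" and W0: "value_at \<iota> \<xi> P W = 0"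
      using F_R[OF c] by (simp_all add: W_def R_diff R_const ev_diff ev_const \<gamma>_def)
    have W: "fps_X ^ (js ! 1) dvd expand W"
    proof (cases "W = 0")
      case False
      define a where "a i = (if i = c then 1 else 0) - \<gamma> * (if i = i0 then 1 else 0)" for i
      have "W = L (\<lambda>k. if k = c then 1 else 0) - \<iota> \<gamma> * L (\<lambda>k. if k = i0 then 1 else 0)"
        using L_unit[OF c] L_unit[OF i0(1)] by (simp add: W_def F_i0)
      also have "\<dots> = L a"
        unfolding L_def a_def sum_distrib_left sum_subtractf[symmetric]
        by (intro sum.cong refl) (simp only: const.hom_minus const.hom_mult left_diff_distrib mult.assoc)
      finally have WL: "W = L a" .
      have a: "\<exists>i\<le>n. a i \<noteq> 0"
      proof (rule ccontr)
        assume "\<not> ?thesis"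
        hence "L a = 0" by (simp add: L_def)
        thus False using WL False by simp
      qed
      define k where "k = subdegree (expand W)"
      have vk: "vl W = int k" using subdegree_expand(2)[OF WR False] by (simp add: k_def)
      have "k \<in> J" unfolding J_def using a vk WL by auto
      moreover have "k \<noteq> 0"
      proof
        assume "k = 0"
        hence "expand W $ 0 \<noteq> 0" using subdegree_expand(1)[OF WR False] k_def by (metis nth_subdegree_nonzero)
        thus False using W0 by (simp add: expand_nth_0)
      qed
      ultimately have "js ! 1 \<le> k" by (rule js_1_le)
      thus ?thesis using fps_dvd_iff[of "fps_X ^ (js ! 1)" "expand W"] subdegree_expand(1)[OF WR False]
        by (simp add: k_def)
    qed simp
    have FQ: "F c ^ ?Q - F c = W ^ ?Q - W"
    proof -
      have "F c ^ ?Q = (W + \<iota> \<gamma>) ^ ?Q" by (simp add: W_def)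
      also have "\<dots> = W ^ ?Q + \<iota> \<gamma>" by (simp only: QK const.hom_power[symmetric] \<gamma>)
      finally show ?thesis by (simp add: W_def)
    qed
    have Q0: "?Q > 0" by simp
    then obtain Q' where "?Q = Suc Q'" using gr0_implies_Suc by blast
    hence "W ^ ?Q - W = W * (W ^ Q' - 1)" by (simp add: algebra_simps)
    hence "expand (W ^ ?Q - W) = expand W * expand (W ^ Q' - 1)"
      using WR by (simp add: expand_mult R_diff R_power)
    hence d: "fps_X ^ (js ! 1) dvd expand (F c ^ ?Q - F c)" using W unfolding FQ by simp
    have FR: "F c ^ ?Q - F c \<in> local_ring \<iota> \<xi> P" using F_R[OF c] by (intro R_intros)
    have "F c ^ (CARD('a) ^ m) = (F c ^ ?Q) ^ (CARD('a) ^ u)"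
      using um(2) by (simp flip: power_mult power_add)
    also have "F c ^ ?Q = F c + (F c ^ ?Q - F c)" by simp
    also have "(F c + (F c ^ ?Q - F c)) ^ (CARD('a) ^ u) = F c ^ (CARD('a) ^ u) + (F c ^ ?Q - F c) ^ (CARD('a) ^ u)"
      by (rule frobenius_add[OF char_K])
    finally have "F c ^ (CARD('a) ^ m) - F c ^ (CARD('a) ^ u) = (F c ^ ?Q - F c) ^ (CARD('a) ^ u)"
      by (simp only: add_diff_cancel_left')
    thus ?thesis using expand_power_dvd[OF FR d, of "CARD('a) ^ u"] by (simp only:)
  qed
  have dvd: "fps_X ^ ?e dvd expand (yy i) - expand (zz i)" for i
  proof -
    have "expand (yy i) - expand (zz i) = expand (yy i - zz i)"
      by (rule expand_diff[OF yy_R zz_R, symmetric])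
    also have "yy i - zz i = (\<Sum>c\<le>n. \<iota> (A i c) * (F c ^ (CARD('a) ^ m) - F c ^ (CARD('a) ^ u)))"
      by (simp add: yy_def zz_def sum_subtractf right_diff_distrib)
    also have "expand \<dots> = (\<Sum>c\<le>n. expand (\<iota> (A i c)) * expand (F c ^ (CARD('a) ^ m) - F c ^ (CARD('a) ^ u)))"
      using F_R by (subst expand_sum) (auto intro!: R_intros sum.cong expand_mult)
    finally have e: "expand (yy i) - expand (zz i) =
        (\<Sum>c\<le>n. expand (\<iota> (A i c)) * expand (F c ^ (CARD('a) ^ m) - F c ^ (CARD('a) ^ u)))" .
    show ?thesis unfolding e by (intro dvd_sum dvd_mult dvdF) simp
  qed
  have eN: "expand N = gr.bordered_det (\<lambda>i. expand (yy i) - expand (zz i)) (\<lambda>i. expand (zz i))"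
    unfolding expand_N by (rule bordered_det_subtract[symmetric])
  note b = gr.bordered_det_order[of ?e "\<lambda>i. expand (yy i) - expand (zz i)" "\<lambda>i. expand (zz i)", OF dvd, folded eN]
  show "T \<ge> int ?e + (\<Sum>i\<le>n - 2. int (js ! i) - int (\<kappa> ! i))"
    using T_ge[OF b(1)] unfolding sum_diff_kappa by simp
  assume p: "int CHAR('a) dvd binom_det js \<kappa> n 0"
  have "gr.minor id $ 0 = 0" using minor_eq_0_iff[of 0] p by (simp add: id_def)
  from T_ge[OF b(2)[OF this]]
  show "T > int ?e + (\<Sum>i\<le>n - 2. int (js ! i) - int (\<kappa> ! i))" unfolding sum_diff_kappa by simp
qed

lemma rational_points_power:
  assumes "P \<in> rational_points C CARD('a)" shows "P \<in> rational_points C (CARD('a) ^ r)"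
proof -
  obtain a where a: "P \<in> C" "a \<in> P" "\<And>i. a i ^ CARD('a) = a i"
    using assms unfolding rational_points_def by blast
  have "a i ^ (CARD('a) ^ r) = a i" for i by (induction r) (simp_all add: power_mult a(3))
  thus ?thesis using a unfolding rational_points_def by blast
qed

text \<open>The first column is \<open>(1, 1, 1, 0, \<dots>, 0)\<close> as \<open>g 0 = 1\<close> and \<open>\<kappa> ! 0 = 0\<close>. Subtracting the second row
  from the first and the third clears it, without changing the leading parts of the third row.\<close>

lemma bound_rational:
  assumes P: "P \<in> rational_points C CARD('a)"
  shows "T \<ge> int (js ! 1 * CARD('a) ^ u) + (\<Sum>i\<le>n - 2. int (js ! (i + 2)) - int (\<kappa> ! i))"
    and "T = int (js ! 1 * CARD('a) ^ u) + (\<Sum>i\<le>n - 2. int (js ! (i + 2)) - int (\<kappa> ! i)) \<longleftrightarrow>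
      \<not> int CHAR('a) dvd binom_det js \<kappa> n 2"
proof -
  let ?Q = "CARD('a) ^ u" and ?Q' = "CARD('a) ^ m"
  let ?y = "\<lambda>i. expand (yy i)" and ?z = "\<lambda>i. expand (zz i)"
  have Q: "?Q \<ge> 2" "?Q < ?Q'"
    using card_power_ge_2[of u] card_power_ge_2[of 1] um power_strict_increasing[of u m "CARD('a)"] by auto
  define \<eta> where "\<eta> i = (SOME v. ?y i = fps_X ^ (?Q' * js ! i) * v \<and> v $ 0 \<noteq> 0)" for i
  define \<zeta> where "\<zeta> i = (SOME v. ?z i = fps_X ^ (?Q * js ! i) * v \<and> v $ 0 \<noteq> 0)" for i
  have \<eta>: "?y i = fps_X ^ (?Q' * js ! i) * \<eta> i" if "i \<le> n" for i
  proof -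
    have "\<exists>v. ?y i = fps_X ^ (?Q' * js ! i) * v \<and> v $ 0 \<noteq> 0"
      unfolding yy_frob_row by (rule frob_row_expand[OF rational_points_power[OF P] that]) blast
    from someI_ex[OF this] show ?thesis unfolding \<eta>_def by blast
  qed
  have \<zeta>: "?z i = fps_X ^ (?Q * js ! i) * \<zeta> i" "\<zeta> i $ 0 \<noteq> 0" if "i \<le> n" for i
  proof -
    have "\<exists>v. ?z i = fps_X ^ (?Q * js ! i) * v \<and> v $ 0 \<noteq> 0"
      unfolding zz_frob_row by (rule frob_row_expand[OF rational_points_power[OF P] that]) blast
    from someI_ex[OF this] show "?z i = fps_X ^ (?Q * js ! i) * \<zeta> i" "\<zeta> i $ 0 \<noteq> 0" unfolding \<zeta>_def by blast+
  qed
  have "(\<Sum>c\<le>n. \<iota> (A 0 c) * F c ^ Q) = 1" for Q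
  proof -
    have "(\<Sum>c\<le>n. \<iota> (A 0 c) * F c ^ Q) = (\<Sum>c\<le>n. if c = i0 then F c ^ Q else 0)"
      by (intro sum.cong) (auto simp: A_def)
    thus ?thesis using i0(1) by (simp add: F_i0)
  qed
  hence y0: "?y 0 = 1" and z0: "?z 0 = 1" by (simp_all add: yy_def zz_def)
  have js1: "js ! 1 > 0" using js_less[of 0 1] n by simp
  have js_pos: "js ! i > 0" if "0 < i" "i \<le> n" for i using js_less[of 0 i] that by simp
  have kappa_pos: "\<kappa> ! s > 0" if "0 < s" "s < n - 1" for s
    using sorted_wrt_nth_less[OF kappa_props(2), of 0 s] that kappa_props(1) by simp
  define d' where "d' s i = (if s = 0 then dd s i - ?z i else dd s i)" for s i
  define b' where "b' s i = (if i = 0 then 0 else if s = 0 then bb s i - fps_X ^ ((?Q - 1) * js ! i) * \<zeta> i else bb s i)" for s i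
  have d'_b': "fps_X ^ (\<kappa> ! s) * d' s i = fps_X ^ (js ! i) * b' s i" if si: "s < n - 1" "i \<le> n" for s i
  proof -
    consider "i = 0" "s = 0" | "i = 0" "s > 0" | "i > 0" "s = 0" | "i > 0" "s > 0" by auto
    thus ?thesis
    proof cases
      case 1
      thus ?thesis by (simp add: d'_def b'_def dd_def kappa g_0 z0)
    next
      case 2
      have "fps_hasse (\<kappa> ! s) (1 :: 'a alg_closure fps) = 0"
        using kappa_pos[OF 2(2) si(1)] by (intro fps_ext) (auto simp: fps_hasse_nth)
      thus ?thesis using 2 by (simp add: d'_def b'_def dd_def g_0)
    next
      case 3
      have "js ! i + (?Q - 1) * js ! i = ?Q * js ! i" using Q by (cases ?Q) auto
      hence "fps_X ^ (js ! i) * (fps_X ^ ((?Q - 1) * js ! i) * \<zeta> i) = ?z i"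
        using \<zeta>(1)[OF si(2)] by (simp flip: power_add mult.assoc)
      moreover have "fps_X ^ (\<kappa> ! 0) * dd 0 i = fps_X ^ (js ! i) * bb 0 i" using gr.bb[of 0 i] si 3 by simp
      ultimately show ?thesis using 3 by (simp add: d'_def b'_def right_diff_distrib kappa(2))
    next
      case 4
      thus ?thesis using gr.bb[OF si] by (simp add: d'_def b'_def)
    qed
  qed
  interpret g': graded_rows n "(!) js" "(!) \<kappa>" d' b'
    by unfold_locales (use n js_less js_0 d'_b' in auto)
  have N: "expand N = g'.bordered_det (\<lambda>i. ?y i - ?z i) ?z"
  proof -
    let ?m = "\<lambda>r c. if r = 0 then ?y c - ?z c else if r = 1 then ?z c else dd (r - 2) c"
    have "expand N = gr.bordered_det (\<lambda>i. ?y i - ?z i) ?z"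
      unfolding expand_N by (rule bordered_det_subtract[symmetric])
    also have "\<dots> = det (mat (n + 1) (n + 1) (\<lambda>(r, c). ?m r c))"
      unfolding gr.bordered_det_def by (rule refl)
    also have "\<dots> = det (mat (n + 1) (n + 1) (\<lambda>(r, c). if r = 2 then ?m 2 c - ?m 1 c else ?m r c))"
      by (rule det_subtract_row[symmetric]) (use n in auto)
    also have "\<dots> = g'.bordered_det (\<lambda>i. ?y i - ?z i) ?z"
      unfolding g'.bordered_det_def by (intro arg_cong[of _ _ det] eq_matI) (auto simp: d'_def)
    finally show ?thesis .
  qed
  define \<eta>' where "\<eta>' i = fps_X ^ ((?Q' - ?Q) * js ! i) * \<eta> i - \<zeta> i" for i
  have y': "?y i - ?z i = fps_X ^ (?Q * js ! i) * \<eta>' i" if "i \<le> n" for i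
  proof -
    have "?Q' * js ! i = ?Q * js ! i + (?Q' - ?Q) * js ! i"
      using Q(2) by (simp flip: add_mult_distrib)
    thus ?thesis unfolding \<eta>'_def \<eta>[OF that] \<zeta>(1)[OF that]
      by (simp only: power_add right_diff_distrib mult.assoc)
  qed
  have \<eta>'1: "\<eta>' 1 $ 0 \<noteq> 0"
    using \<zeta>(2)[of 1] n js1 Q(2) by (simp add: \<eta>'_def fps_mult_nth_0)
  have "\<exists>h. fps_X ^ (\<Sum>s<n - 1. \<kappa> ! s) * g'.bordered_det (\<lambda>i. ?y i - ?z i) ?z =
      fps_X ^ (?Q * js ! 1 + (\<Sum>i\<le>n - 2. js ! (i + 2))) * (- (\<eta>' 1 * g'.minor (\<lambda>c. c + 2)) + fps_X * h)"
  proof (rule g'.bordered_det_order_exact)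
    show "fps_X ^ (?Q * js ! i) dvd ?y i - ?z i" if "i \<le> n" for i unfolding y'[OF that] by (rule dvd_triv_left)
    show "?y 1 - ?z 1 = fps_X ^ (?Q * js ! 1) * \<eta>' 1" by (rule y') (use n in simp)
  qed (use Q(1) y0 z0 in \<open>auto simp: b'_def\<close>)
  then obtain h where h: "fps_X ^ (\<Sum>s<n - 1. \<kappa> ! s) * expand N =
      fps_X ^ (?Q * js ! 1 + (\<Sum>i\<le>n - 2. js ! (i + 2))) * (- (\<eta>' 1 * g'.minor (\<lambda>c. c + 2)) + fps_X * h)"
    unfolding N by blast
  let ?B = "?Q * js ! 1 + (\<Sum>i\<le>n - 2. js ! (i + 2))"
  let ?R = "- (\<eta>' 1 * g'.minor (\<lambda>c. c + 2)) + fps_X * h"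
  have R: "?R \<noteq> 0" using X_expand_N_nonzero unfolding h by auto
  have Teq: "T + int (\<Sum>s<n - 1. \<kappa> ! s) = int ?B + int (subdegree ?R)"
    unfolding T_eq_subdegree h using R by simp
  have rhs: "int (js ! 1 * ?Q) + (\<Sum>i\<le>n - 2. int (js ! (i + 2)) - int (\<kappa> ! i)) = int ?B - int (\<Sum>s<n - 1. \<kappa> ! s)"
    unfolding sum_diff_kappa by (simp add: mult.commute)
  have minor: "g'.minor (\<lambda>c. c + 2) $ 0 = gr.minor (\<lambda>c. c + 2) $ 0"
    unfolding g'.minor_nth_0 gr.minor_nth_0
  proof (intro arg_cong[of _ _ det] eq_matI)
    fix s c assume "s < dim_row (mat (n - 1) (n - 1) (\<lambda>(s, c). bb s (c + 2) $ 0))"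
      "c < dim_col (mat (n - 1) (n - 1) (\<lambda>(s, c). bb s (c + 2) $ 0))"
    hence sc: "s < n - 1" "c < n - 1" by auto
    hence "(?Q - 1) * js ! (c + 2) > 0" using js_pos[of "c + 2"] Q(1) by simp
    hence "b' s (c + 2) $ 0 = bb s (c + 2) $ 0" by (simp add: b'_def)
    thus "mat (n - 1) (n - 1) (\<lambda>(s, c). b' s (c + 2) $ 0) $$ (s, c) =
        mat (n - 1) (n - 1) (\<lambda>(s, c). bb s (c + 2) $ 0) $$ (s, c)" using sc by simp
  qed auto
  show "T \<ge> int (js ! 1 * ?Q) + (\<Sum>i\<le>n - 2. int (js ! (i + 2)) - int (\<kappa> ! i))"
    unfolding rhs using Teq by simp
  have "T = int (js ! 1 * ?Q) + (\<Sum>i\<le>n - 2. int (js ! (i + 2)) - int (\<kappa> ! i)) \<longleftrightarrow> subdegree ?R = 0"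
    unfolding rhs using Teq by auto
  also have "\<dots> \<longleftrightarrow> ?R $ 0 \<noteq> 0" using R by (simp add: subdegree_eq_0_iff)
  also have "\<dots> \<longleftrightarrow> gr.minor (\<lambda>c. c + 2) $ 0 \<noteq> 0" using \<eta>'1 minor by simp
  also have "\<dots> \<longleftrightarrow> \<not> int CHAR('a) dvd binom_det js \<kappa> n 2" using minor_eq_0_iff[of 2] by blast
  finally show "T = int (js ! 1 * ?Q) + (\<Sum>i\<le>n - 2. int (js ! (i + 2)) - int (\<kappa> ! i)) \<longleftrightarrow>
      \<not> int CHAR('a) dvd binom_det js \<kappa> n 2" .
qed

end


section \<open>The local bounds for the Frobenius divisor\<close>

theorem proposition4p1:
  fixes C :: "('v::finite, 'a::{field,finite} alg_closure) point set"
    and \<iota> :: "'a alg_closure \<Rightarrow> 'f::field" and \<xi> :: "'v \<Rightarrow> 'f"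
    and f :: "nat \<Rightarrow> 'f" and t :: 'f and n u m p q :: nat and \<kappa> j :: "nat list"
    and P :: "('v, 'a alg_closure) point" and T :: "('v, 'a alg_closure) divisor"
  assumes p: "p = CHAR('a)" and q: "q = CARD('a)"
    and curve: "nonsingular_projective_curve C \<iota> \<xi>"
    and n: "n \<ge> 2" and um: "1 \<le> u" "u < m" "coprime u m"
    and f: "\<forall>i\<le>n. f i \<in> base_functions \<iota> \<xi>" "nondegenerate C \<iota> \<xi> n f"
    and t: "separating_variable \<iota> \<xi> t"
    and kappa: "frob_order_sequence \<iota> t u m n f \<kappa>" "\<kappa> ! 0 = 0"
    and T: "T = frob_divisor \<iota> \<xi> t u m n f \<kappa>"
    and P: "P \<in> C"
    and j: "j = orders (linear_series \<iota> \<xi> n f) P"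
  shows
    \<comment> \<open>(1)\<close>
    "(P \<in> rational_points C q \<longrightarrow>
        T P \<ge> int (j ! 1 * q ^ u) + (\<Sum>i\<le>n-2. int (j ! (i + 2)) - int (\<kappa> ! i))) \<and>
    \<comment> \<open>(2)\<close>
     (P \<in> rational_points C (q ^ (m - u)) \<longrightarrow>
        T P \<ge> int (j ! 1 * q ^ u) + (\<Sum>i\<le>n-2. int (j ! i) - int (\<kappa> ! i))) \<and>
    \<comment> \<open>(3)\<close>
     (\<forall>r\<in>{u, m}. P \<in> rational_points C (q ^ r) \<longrightarrow>
        T P \<ge> (\<Sum>i=1..n-1. int (j ! i) - int (\<kappa> ! (i - 1)))) \<and>
    \<comment> \<open>(4)\<close>
     T P \<ge> (\<Sum>i\<le>n-2. int (j ! i) - int (\<kappa> ! i)) \<and>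
    \<comment> \<open>(i)\<close>
     (P \<in> rational_points C q \<longrightarrow>
        (T P = int (j ! 1 * q ^ u) + (\<Sum>i\<le>n-2. int (j ! (i + 2)) - int (\<kappa> ! i))
          \<longleftrightarrow> \<not> int p dvd binom_det j \<kappa> n 2)) \<and>
    \<comment> \<open>(ii)\<close>
     (int p dvd binom_det j \<kappa> n 1 \<longrightarrow>
        (\<forall>r\<in>{u, m}. P \<in> rational_points C (q ^ r) \<longrightarrow>
           T P > (\<Sum>i=1..n-1. int (j ! i) - int (\<kappa> ! (i - 1))))) \<and>
    \<comment> \<open>(iii)\<close>
     (int p dvd binom_det j \<kappa> n 0 \<longrightarrow>
        (P \<in> rational_points C (q ^ (m - u)) \<longrightarrow>
           T P > int (j ! 1 * q ^ u) + (\<Sum>i\<le>n-2. int (j ! i) - int (\<kappa> ! i))) \<and>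
        T P > (\<Sum>i\<le>n-2. int (j ! i) - int (\<kappa> ! i)))"
proof -
  interpret D: frobenius_data C \<iota> \<xi> f t n u m \<kappa> P
    by (rule frobenius_data.intro[OF curve n um(1,2) f t kappa P])
  show ?thesis
    unfolding p q T j
    by (intro conjI impI ballI D.bound_rational D.bound_rational_m_minus_u D.bound_rational_u_or_m
        D.bound_arbitrary)
qed

end
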